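(* Let $k=2k_1$ with $k_1$ a positive integer and let $E_{p,q}$ denote the $k\times k$ matrix units. Let $$R^{\dagger}_{k\times k,1}=\mathrm{span}\{(E_{p,q})_{[1,1]}(m,n)-(E_{k_1+q,k_1+p})_{[1,1]}(n,m),\ (E_{p,k_1+q})_{[1,1]}(m,n)+(E_{q,k_1+p})_{[1,1]}(n,m),$$ $$(E_{k_1+p,q})_{[1,1]}(m,n)+(E_{k_1+q,p})_{[1,1]}(n,m)\mid 1\le p,q\le k_1,\ m,n\in\mathbb{N}\},$$ $$R^{\dagger}_{k\times k,2}=\mathrm{span}\{(E_{p,q})_{[0,0]}(m,n)+(E_{k_1+q,k_1+p})_{[0,0]}(n,m),\ (E_{p,k_1+q})_{[0,0]}(m,n)-(E_{q,k_1+p})_{[0,0]}(n,m),$$ $$(E_{k_1+p,q})_{[0,0]}(m,n)-(E_{k_1+q,p})_{[0,0]}(n,m)\mid 1\le p,q\le k_1,\ m,n\in\mathbb{N}\},$$ with the conformal algebra structures $(\partial,Y^+(\cdot,z))$ described in the context. Then: (1) The conformal algebras $R^{\dagger}_{k\times k,1}$ and $R^{\dagger}_{k\times k,2}$ are simple. (2) $R^{\dagger}_{k\times k,1}$ is generated by its subspace of weight $2$, $$(R^{\dagger}_{k\times k,1})^{(2)}=\mathrm{span}\{(E_{p,q})_{[1,1]}(\epsilon,1-\epsilon)-(E_{k_1+q,k_1+p})_{[1,1]}(1-\epsilon,\epsilon),\ (E_{p,k_1+q})_{[1,1]}(1,0)+(E_{q,k_1+p})_{[1,1]}(0,1),$$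 $$(E_{k_1+p,q})_{[1,1]}(1,0)+(E_{k_1+q,p})_{[1,1]}(0,1)\mid 1\le p,q\le k_1,\ \epsilon=0,1\},$$ when $k_1>1$, and by the set $$\{(E_{1,2})_{[1,1]}(2,0)+(E_{1,2})_{[1,1]}(0,2),\ (E_{2,1})_{[1,1]}(2,0)+(E_{2,1})_{[1,1]}(0,2),\ (E_{1,1})_{[1,1]}(0,1)-(E_{2,2})_{[1,1]}(1,0)\}$$ if $k_1=1$. (3) $R^{\dagger}_{k\times k,2}$ is generated by its subspace of weight $2$ (writing $E_{p,q}$ for $(E_{p,q})_{[0,0]}(0,0)$), $$(R^{\dagger}_{k\times k,2})^{(2)}=\mathrm{span}\{E_{p,q}+E_{k_1+q,k_1+p},\ E_{p,k_1+q}-E_{q,k_1+p},\ E_{k_1+p,q}-E_{k_1+q,p}\mid 1\le p,q\le k_1\},$$ if $k_1>1$, and by the set $$\{(I_2)_{[0,0]}(0,0),\ (E_{1,2})_{[0,0]}(1,0)-(E_{1,2})_{[0,0]}(0,1),\ (E_{2,1})_{[0,0]}(1,0)-(E_{2,1})_{[0,0]}(0,1)\}$$ if $k_1=1$, where $I_2$ is the $2\times 2$ identity matrix.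
   Context: Conventions. $\mathbb{F}$ is an arbitrary field of characteristic $0$; $\mathbb{N}=\{0,1,2,\dots\}$; $\binom{a}{n}=a(a-1)\cdots(a-n+1)/n!$ for $a\in\mathbb{Z}$, $n\in\mathbb{N}$. $\mathrm{Res}_x$ takes the coefficient of $x^{-1}$. All binomials such as $(z-x)^{-1}$ are expanded in nonnegative powers of the second variable. $LM(V_1,V_2)$ is the space of linear maps $V_1\to V_2$. Conformal superalgebra. A conformal superalgebra $(R,\partial,Y^+(\cdot,z))$ is a $\mathbb{Z}_2$-graded $\mathbb{F}[\partial]$-module $R=R_0\oplus R_1$ with a $\mathbb{Z}_2$-graded linear map $Y^+(\cdot,z):R\to LM(R,R[z^{-1}]z^{-1})$ such that, for $u\in R_i$, $v\in R_j$: $Y^+(\partial u,z)=\frac{d}{dz}Y^+(u,z)$; $Y^+(u,z)v=(-1)^{ij}\mathrm{Res}_x\frac{e^{x\partial}Y^+(v,-x)u}{z-x}$; $Y^+(u,z_1)Y^+(v,z_2)-(-1)^{ij}Y^+(v,z_2)Y^+(u,z_1)=\mathrm{Res}_x\frac{Y^+(Y^+(u,z_1-x)v,x)}{z_2-x}$. If $R_1=\{0\}$ it is called a conformal algebra. Write $Y^+(u,z)=\sum_{n\ge 0}u_nz^{-n-1}$. An ideal is a subspace $\mathcal{I}\subset R$ with $\partial(\mathcal{I})\subset\mathcal{I}$ and $Y^+(u,z)\mathcal{I}\subset\mathcal{I}[z^{-1}]$ for all $u\in R$. $R$ is simple if its only ideals are $\{0\}$ and $R$. A (sub-)algebra $R'$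 is generated by a subset $S$ if $R'=\mathrm{span}\{u^1_{m_1}\cdots u^p_{m_p}v\mid u^1,\dots,u^p,v\in S,\ p,m_1,\dots,m_p\in\mathbb{N}\}$ (for $p=0$ the expression is $v$). Construction. Let $\mathcal{A}=M_{k\times k}(\mathbb{F})$ be the algebra of $k\times k$ matrices. For each $i\in\{0,1\}$ take the vector space $\mathcal{A}\otimes\mathbb{F}[t_1,t_2]$ and denote $u\otimes t_1^mt_2^n$ in the $i$-th copy by $u_{[i,i]}(m,n)$ ($u\in\mathcal{A}$, $m,n\in\mathbb{N}$). On each copy define $$\partial u_{[i,i]}(m,n)=(m+1)u_{[i,i]}(m+1,n)+(n+1)u_{[i,i]}(m,n+1)$$ and $$Y^+(u_{[i,i]}(m_1,m_2),z)v_{[i,i]}(n_1,n_2)=(n_1\delta_{i,0}+1)\binom{-n_1-1-\delta_{i,0}}{m_2}\sum_{p=0}^{m_1+m_2+n_1+\delta_{i,0}}\binom{p}{m_1}(uv)_{[i,i]}(p,n_2)z^{p-m_1-m_2-n_1-1-\delta_{i,0}}$$ $$-\bigl(\delta_{i,1}-(n_2+1)\delta_{i,0}\bigr)\binom{-n_2-1-\delta_{i,0}}{m_1}\sum_{q=0}^{m_1+m_2+n_2+\delta_{i,0}}\binom{q}{m_2}(vu)_{[i,i]}(n_1,q)z^{q-m_1-m_2-n_2-1-\delta_{i,0}}.$$ Each copy is a conformal algebra (odd part zero), and the subspaces $R^{\dagger}_{k\times k,1}$, $R^{\dagger}_{k\times k,2}$ of the claim are closed under $\partial$ and $Y^+$,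 hence are conformal algebras with the restricted structure. (They are spanned by the elements $u_{[1,1]}(m,n)-\sigma_2(u)_{[1,1]}(n,m)$, respectively $u_{[0,0]}(m,n)+\sigma_2(u)_{[0,0]}(n,m)$, $u\in\mathcal{A}$, where $\sigma_2$ is the involutive anti-automorphism $\sigma_2\begin{pmatrix} A_{11} & A_{12} \\ A_{21} & A_{22} \end{pmatrix}=\begin{pmatrix} A_{22}^t & -A_{12}^t \\ -A_{21}^t & A_{11}^t \end{pmatrix}$ with $k_1\times k_1$ blocks.) The weight of $u_{[0,0]}(m,n)$ is $m+n+2$ and the weight of $u_{[1,1]}(m,n)$ is $m+n+1$; a superscript $(w)$ denotes the subspace of elements of weight $w$. *)

theory Defs
  imports Complex_Main "HOL-Library.Poly_Mapping" "HOL-Library.Groups_Big_Fun"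
    "HOL-Library.Function_Algebras"
begin

section \<open>Conformal superalgebras\<close>

text \<open>
  A formal distribution in one variable \<open>z\<close> with coefficients in \<open>'v\<close> is given by its coefficient
  function \<^typ>\<open>int \<Rightarrow> 'v\<close>: \<open>f a\<close> is the coefficient of \<open>z\<^sup>a\<close>. Thus \<open>Y u v a\<close> below is the coefficient
  of \<open>z\<^sup>a\<close> in \<open>Y\<^sup>+(u,z)v\<close>. Infinite sums over exponents that come from the binomial expansions
  have only finitely many nonzero terms, and are written with \<^const>\<open>Sum_any\<close>.
\<close>

text \<open>Coefficient of \<open>z\<^sup>a x\<^sup>b\<close> in \<open>(z - x)\<^sup>e\<close>, expanded in nonnegative powers of \<open>x\<close>.\<close>

definition binexp :: "int \<Rightarrow> int \<Rightarrow> int \<Rightarrow> 'f::field_char_0" where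
  "binexp e a b =
     (if b \<ge> 0 \<and> a + b = e then (- 1) ^ nat b * (of_int e gchoose nat b) else 0)"

text \<open>\<open>f(-x)\<close>, \<open>df/dx\<close> and \<open>e\<^bsup>x\<partial>\<^esup> f(x)\<close>.\<close>

definition fd_neg :: "('f::field \<Rightarrow> 'v \<Rightarrow> 'v) \<Rightarrow> (int \<Rightarrow> 'v) \<Rightarrow> int \<Rightarrow> 'v" where
  "fd_neg scale f a = scale ((- 1) powi a) (f a)"

definition fd_deriv :: "('f::field \<Rightarrow> 'v \<Rightarrow> 'v) \<Rightarrow> (int \<Rightarrow> 'v) \<Rightarrow> int \<Rightarrow> 'v" where
  "fd_deriv scale f a = scale (of_int (a + 1)) (f (a + 1))"

definition fd_exp ::
  "('f::field_char_0 \<Rightarrow> 'v \<Rightarrow> 'v::ab_group_add) \<Rightarrow> ('v \<Rightarrow> 'v) \<Rightarrow> (int \<Rightarrow> 'v) \<Rightarrow> int \<Rightarrow> 'v" where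
  "fd_exp scale D f a = Sum_any (\<lambda>j::nat. scale (1 / fact j) ((D ^^ j) (f (a - int j))))"

text \<open>
  \<open>Res\<^sub>x f(x)/(z - x)\<close>, coefficient of \<open>z\<^sup>a\<close>; and, for \<open>P(n,w)\<close> the coefficient of \<open>y\<^sup>n x\<^sup>w\<close> in
  \<open>P(y,x)\<close>, the coefficient of \<open>z\<^sub>1\<^sup>a z\<^sub>2\<^sup>b\<close> in \<open>Res\<^sub>x P(z\<^sub>1 - x, x)/(z\<^sub>2 - x)\<close>: the term
  \<open>P n w (z\<^sub>1 - x)\<^sup>n x\<^sup>w\<close> contributes when the powers \<open>x\<^sup>c\<close> of \<open>(z\<^sub>1 - x)\<^sup>n\<close> and \<open>x\<^sup>d\<close> of
  \<open>(z\<^sub>2 - x)\<^bsup>-1\<^esup>\<close> satisfy \<open>c + d + w = -1\<close>.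
\<close>

definition res1 :: "('f::field_char_0 \<Rightarrow> 'v \<Rightarrow> 'v::ab_group_add) \<Rightarrow> (int \<Rightarrow> 'v) \<Rightarrow> int \<Rightarrow> 'v" where
  "res1 scale f a = Sum_any (\<lambda>d. scale (binexp (- 1) a d) (f (- 1 - d)))"

definition res2 ::
  "('f::field_char_0 \<Rightarrow> 'v \<Rightarrow> 'v::ab_group_add) \<Rightarrow> (int \<Rightarrow> int \<Rightarrow> 'v) \<Rightarrow> int \<Rightarrow> int \<Rightarrow> 'v" where
  "res2 scale P a b =
     Sum_any (\<lambda>(n, c, d). scale (binexp n a c * binexp (- 1) b d) (P n (- 1 - c - d)))"

definition linear_on_subspace ::
  "('f::field \<Rightarrow> 'v \<Rightarrow> 'v::ab_group_add) \<Rightarrow> 'v set \<Rightarrow> ('v \<Rightarrow> 'v) \<Rightarrow> bool" where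
  "linear_on_subspace scale R f \<longleftrightarrow>
     (\<forall>x\<in>R. \<forall>y\<in>R. f (x + y) = f x + f y) \<and> (\<forall>c. \<forall>x\<in>R. f (scale c x) = scale c (f x))"

text \<open>
  The underlying space \<open>R = R\<^sub>0 \<oplus> R\<^sub>1\<close> is a subspace of an ambient vector space. The homogeneous
  components are indexed by natural numbers read modulo 2.
\<close>

definition super_space :: "'v::ab_group_add set \<Rightarrow> 'v set \<Rightarrow> 'v set" where
  "super_space R0 R1 = {x + y | x y. x \<in> R0 \<and> y \<in> R1}"

definition super_part :: "'v set \<Rightarrow> 'v set \<Rightarrow> nat \<Rightarrow> 'v set" where
  "super_part R0 R1 i = (if even i then R0 else R1)"

locale conformal_superalgebra = vector_space scale
  for scale :: "'f::field_char_0 \<Rightarrow> 'v::ab_group_add \<Rightarrow> 'v" +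
  fixes R0 R1 :: "'v set" and D :: "'v \<Rightarrow> 'v" and Y :: "'v \<Rightarrow> 'v \<Rightarrow> int \<Rightarrow> 'v"
  assumes subspaces: "subspace R0" "subspace R1"
    and direct: "R0 \<inter> R1 = {0}"
    and D_linear: "linear_on_subspace scale (super_space R0 R1) D"
    and D_graded: "u \<in> super_part R0 R1 i \<Longrightarrow> D u \<in> super_part R0 R1 i"
    and Y_linear_left: "v \<in> super_space R0 R1 \<Longrightarrow>
      linear_on_subspace scale (super_space R0 R1) (\<lambda>u. Y u v a)"
    and Y_linear_right: "u \<in> super_space R0 R1 \<Longrightarrow>
      linear_on_subspace scale (super_space R0 R1) (\<lambda>v. Y u v a)"
    and Y_graded: "u \<in> super_part R0 R1 i \<Longrightarrow> v \<in> super_part R0 R1 j \<Longrightarrow>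
      Y u v a \<in> super_part R0 R1 (i + j)"
    and Y_singular: "u \<in> super_space R0 R1 \<Longrightarrow> v \<in> super_space R0 R1 \<Longrightarrow>
      a \<ge> 0 \<Longrightarrow> Y u v a = 0"
    and Y_finite: "u \<in> super_space R0 R1 \<Longrightarrow> v \<in> super_space R0 R1 \<Longrightarrow>
      finite {a. Y u v a \<noteq> 0}"
    and translation: "u \<in> super_space R0 R1 \<Longrightarrow> v \<in> super_space R0 R1 \<Longrightarrow>
      Y (D u) v = fd_deriv scale (Y u v)"
    and skew_symmetry: "u \<in> super_part R0 R1 i \<Longrightarrow> v \<in> super_part R0 R1 j \<Longrightarrow>
      Y u v a = scale ((- 1) ^ (i * j)) (res1 scale (fd_exp scale D (fd_neg scale (Y v u))) a)"
    and commutator: "u \<in> super_part R0 R1 i \<Longrightarrow> v \<in> super_part R0 R1 j \<Longrightarrow>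
      w \<in> super_space R0 R1 \<Longrightarrow>
      Y u (Y v w b) a - scale ((- 1) ^ (i * j)) (Y v (Y u w a) b)
        = res2 scale (\<lambda>n. Y (Y u v n) w) a b"

definition conformal_algebra ::
  "('f::field_char_0 \<Rightarrow> 'v \<Rightarrow> 'v::ab_group_add) \<Rightarrow> 'v set \<Rightarrow> ('v \<Rightarrow> 'v) \<Rightarrow>
   ('v \<Rightarrow> 'v \<Rightarrow> int \<Rightarrow> 'v) \<Rightarrow> bool" where
  "conformal_algebra scale R D Y \<longleftrightarrow> conformal_superalgebra scale R {0} D Y"

definition conformal_ideal ::
  "('f::field_char_0 \<Rightarrow> 'v \<Rightarrow> 'v::ab_group_add) \<Rightarrow> 'v set \<Rightarrow> ('v \<Rightarrow> 'v) \<Rightarrow>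
   ('v \<Rightarrow> 'v \<Rightarrow> int \<Rightarrow> 'v) \<Rightarrow> 'v set \<Rightarrow> bool" where
  "conformal_ideal scale R D Y I \<longleftrightarrow>
     module.subspace scale I \<and> I \<subseteq> R \<and> D ` I \<subseteq> I \<and> (\<forall>u\<in>R. \<forall>v\<in>I. \<forall>a. Y u v a \<in> I)"

definition simple_conformal_algebra ::
  "('f::field_char_0 \<Rightarrow> 'v \<Rightarrow> 'v::ab_group_add) \<Rightarrow> 'v set \<Rightarrow> ('v \<Rightarrow> 'v) \<Rightarrow>
   ('v \<Rightarrow> 'v \<Rightarrow> int \<Rightarrow> 'v) \<Rightarrow> bool" where
  "simple_conformal_algebra scale R D Y \<longleftrightarrow>
     conformal_algebra scale R D Y \<and> (\<forall>I. conformal_ideal scale R D Y I \<longrightarrow> I = {0} \<or> I = R)"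

text \<open>\<open>u\<^sub>m v\<close>, where \<open>Y\<^sup>+(u,z) = \<Sum>\<^sub>m u\<^sub>m z\<^bsup>-m-1\<^esup>\<close>.\<close>

definition nth_prod :: "('v \<Rightarrow> 'v \<Rightarrow> int \<Rightarrow> 'v) \<Rightarrow> 'v \<Rightarrow> nat \<Rightarrow> 'v \<Rightarrow> 'v" where
  "nth_prod Y u m v = Y u v (- int m - 1)"

text \<open>The elements \<open>u\<^sup>1\<^bsub>m1\<^esub> \<dots> u\<^sup>p\<^bsub>mp\<^esub> v\<close> with \<open>u\<^sup>1, \<dots>, u\<^sup>p, v \<in> S\<close>.\<close>

inductive_set conformal_words :: "('v \<Rightarrow> 'v \<Rightarrow> int \<Rightarrow> 'v) \<Rightarrow> 'v set \<Rightarrow> 'v set"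
  for Y :: "'v \<Rightarrow> 'v \<Rightarrow> int \<Rightarrow> 'v" and S :: "'v set" where
  base: "v \<in> S \<Longrightarrow> v \<in> conformal_words Y S"
| step: "u \<in> S \<Longrightarrow> w \<in> conformal_words Y S \<Longrightarrow> nth_prod Y u m w \<in> conformal_words Y S"

definition conformal_generated_by ::
  "('f::field_char_0 \<Rightarrow> 'v \<Rightarrow> 'v::ab_group_add) \<Rightarrow> ('v \<Rightarrow> 'v \<Rightarrow> int \<Rightarrow> 'v) \<Rightarrow>
   'v set \<Rightarrow> 'v set \<Rightarrow> bool" where
  "conformal_generated_by scale Y R S \<longleftrightarrow> R = module.span scale (conformal_words Y S)"

section \<open>Matrices and the space \<open>M\<^bsub>k\<times>k\<^esub>(F) \<otimes> F[t\<^sub>1,t\<^sub>2]\<close>\<close>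

text \<open>
  A \<open>k \<times> k\<close> matrix is a function of two indices (counted from 1) that vanishes outside
  \<open>{1..k} \<times> {1..k}\<close>. Addition is pointwise; the matrix product is \<open>mat_mul k\<close> (not the pointwise
  product of the imported function instances).
\<close>

type_synonym 'f fmat = "nat \<Rightarrow> nat \<Rightarrow> 'f"

definition mat_mul :: "nat \<Rightarrow> 'f::field fmat \<Rightarrow> 'f fmat \<Rightarrow> 'f fmat" where
  "mat_mul k u v = (\<lambda>p q. \<Sum>r = 1..k. u p r * v r q)"

definition mat_unit :: "nat \<Rightarrow> nat \<Rightarrow> 'f::field fmat" where
  "mat_unit p q = (\<lambda>i j. if i = p \<and> j = q then 1 else 0)"

definition mat_id :: "nat \<Rightarrow> 'f::field fmat" where
  "mat_id k = (\<lambda>i j. if i = j \<and> i \<in> {1..k} then 1 else 0)"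

text \<open>
  An element \<open>\<Sum> u\<^bsub>m,n\<^esub> \<otimes> t\<^sub>1\<^sup>m t\<^sub>2\<^sup>n\<close> is the finitely supported family of its matrix coefficients.
  Both copies (\<open>i = 0, 1\<close>) use this space, so \<open>elt u m n\<close> stands for \<open>u\<^bsub>[i,i]\<^esub>(m,n)\<close>; the index \<open>i\<close>
  is an argument of the operations that depend on it.
\<close>

type_synonym 'f tmat = "(nat \<times> nat) \<Rightarrow>\<^sub>0 'f fmat"

definition elt :: "'f::field fmat \<Rightarrow> nat \<Rightarrow> nat \<Rightarrow> 'f tmat" where
  "elt u m n = Poly_Mapping.single (m, n) u"

definition tscale :: "'f::field \<Rightarrow> 'f tmat \<Rightarrow> 'f tmat" where
  "tscale c x = Poly_Mapping.map (\<lambda>u p q. c * u p q) x"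

lemma lookup_tscale: "Poly_Mapping.lookup (tscale c x) mn p q = c * Poly_Mapping.lookup x mn p q"
  by (auto simp: tscale_def Poly_Mapping.map.rep_eq when_def)

interpretation tmat: vector_space "tscale :: 'f::field \<Rightarrow> 'f tmat \<Rightarrow> 'f tmat"
  by unfold_locales
    (auto intro!: poly_mapping_eqI simp: lookup_tscale lookup_add fun_eq_iff algebra_simps)

definition dlt :: "nat \<Rightarrow> nat \<Rightarrow> nat" where
  "dlt i j = (if i = j then 1 else 0)"

definition tD :: "'f::field_char_0 tmat \<Rightarrow> 'f tmat" where
  "tD x = (\<Sum>(m, n) \<in> Poly_Mapping.keys x.
     tscale (of_nat (m + 1)) (elt (Poly_Mapping.lookup x (m, n)) (m + 1) n) +
     tscale (of_nat (n + 1)) (elt (Poly_Mapping.lookup x (m, n)) m (n + 1)))"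

text \<open>The distribution \<open>v z\<^sup>e\<close>.\<close>

definition zmon :: "'v::zero \<Rightarrow> int \<Rightarrow> int \<Rightarrow> 'v" where
  "zmon v e a = (if a = e then v else 0)"

text \<open>\<open>Y\<^sup>+(u\<^bsub>[i,i]\<^esub>(m\<^sub>1,m\<^sub>2),z) v\<^bsub>[i,i]\<^esub>(n\<^sub>1,n\<^sub>2)\<close>, and its biadditive extension.\<close>

definition tY_elt :: "nat \<Rightarrow> nat \<Rightarrow> 'f::field_char_0 fmat \<Rightarrow> nat \<Rightarrow> nat \<Rightarrow> 'f fmat \<Rightarrow> nat \<Rightarrow> nat \<Rightarrow>
    int \<Rightarrow> 'f tmat" where
  "tY_elt k i u m1 m2 v n1 n2 a =
     tscale (of_nat (n1 * dlt i 0 + 1) * (of_int (- int n1 - 1 - int (dlt i 0)) gchoose m2))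
       (\<Sum>p = 0..m1 + m2 + n1 + dlt i 0. tscale (of_nat (p choose m1))
          (zmon (elt (mat_mul k u v) p n2)
             (int p - int m1 - int m2 - int n1 - 1 - int (dlt i 0)) a))
   - tscale (of_int (int (dlt i 1) - int ((n2 + 1) * dlt i 0))
              * (of_int (- int n2 - 1 - int (dlt i 0)) gchoose m1))
       (\<Sum>q = 0..m1 + m2 + n2 + dlt i 0. tscale (of_nat (q choose m2))
          (zmon (elt (mat_mul k v u) n1 q)
             (int q - int m1 - int m2 - int n2 - 1 - int (dlt i 0)) a))"

definition tY :: "nat \<Rightarrow> nat \<Rightarrow> 'f::field_char_0 tmat \<Rightarrow> 'f tmat \<Rightarrow> int \<Rightarrow> 'f tmat" where
  "tY k i x y a = (\<Sum>(m1, m2) \<in> Poly_Mapping.keys x. \<Sum>(n1, n2) \<in> Poly_Mapping.keys y.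
     tY_elt k i (Poly_Mapping.lookup x (m1, m2)) m1 m2 (Poly_Mapping.lookup y (n1, n2)) n1 n2 a)"

lemma tD_elt:
  "tD (elt u m n) =
     tscale (of_nat (m + 1)) (elt u (m + 1) n) + tscale (of_nat (n + 1)) (elt u m (n + 1))"
  by (cases "u = 0") (simp_all add: tD_def elt_def)

lemma tY_elt:
  "tY k i (elt u m1 m2) (elt v n1 n2) a = tY_elt k i u m1 m2 v n1 n2 a"
proof (cases "u = 0 \<or> v = 0")
  case True
  then have "mat_mul k u v = 0" "mat_mul k v u = 0"
    by (auto simp: mat_mul_def fun_eq_iff)
  with True show ?thesis
    by (auto simp: tY_def tY_elt_def elt_def zmon_def)
next
  case False
  then show ?thesis
    by (simp add: tY_def elt_def)
qed

text \<open>The elements of \<open>R\<close> of weight \<open>w\<close>, in copy \<open>i\<close>.\<close>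

definition weight_part :: "nat \<Rightarrow> nat \<Rightarrow> 'f::field tmat set \<Rightarrow> 'f tmat set" where
  "weight_part i w R = {x \<in> R. \<forall>(m, n) \<in> Poly_Mapping.keys x. m + n + 1 + dlt i 0 = w}"

definition Rdag1 :: "nat \<Rightarrow> 'f::field_char_0 tmat set" where
  "Rdag1 k1 = tmat.span
     ({elt (mat_unit p q) m n - elt (mat_unit (k1 + q) (k1 + p)) n m
         | p q m n. p \<in> {1..k1} \<and> q \<in> {1..k1}}
    \<union> {elt (mat_unit p (k1 + q)) m n + elt (mat_unit q (k1 + p)) n m
         | p q m n. p \<in> {1..k1} \<and> q \<in> {1..k1}}
    \<union> {elt (mat_unit (k1 + p) q) m n + elt (mat_unit (k1 + q) p) n m
         | p q m n. p \<in> {1..k1} \<and> q \<in> {1..k1}})"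

definition Rdag2 :: "nat \<Rightarrow> 'f::field_char_0 tmat set" where
  "Rdag2 k1 = tmat.span
     ({elt (mat_unit p q) m n + elt (mat_unit (k1 + q) (k1 + p)) n m
         | p q m n. p \<in> {1..k1} \<and> q \<in> {1..k1}}
    \<union> {elt (mat_unit p (k1 + q)) m n - elt (mat_unit q (k1 + p)) n m
         | p q m n. p \<in> {1..k1} \<and> q \<in> {1..k1}}
    \<union> {elt (mat_unit (k1 + p) q) m n - elt (mat_unit (k1 + q) p) n m
         | p q m n. p \<in> {1..k1} \<and> q \<in> {1..k1}})"

end

theory Submission
  imports Defs "HOL-Computational_Algebra.Polynomial"
begin

text \<open>
  Encode \<open>u\<^bsub>[i,i]\<^esub>(m,n)\<close> as the matrix polynomial \<open>u a\<^sup>m b\<^sup>n / (m! n!)\<close>. Then \<open>\<partial>\<close> is multiplication by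
  \<open>a + b\<close>, and with \<open>e = \<delta>\<^bsub>i,0\<^esub>\<close>, \<open>s = (-1)\<^sup>e\<close> the generating function \<open>\<Sum>\<^sub>n \<lambda>\<^sup>n/n! F\<^sub>n G\<close> of the products is
  \<open>(a + \<lambda>)\<^sup>e F(a, -a-\<lambda>) G(a+\<lambda>, b) - s (b + \<lambda>)\<^sup>e G(a, b+\<lambda>) F(-b-\<lambda>, b)\<close>,
  for which skew-symmetry and the Jacobi identity are direct substitutions. The two algebras are the
  fixed spaces \<open>F(b,a) = -s \<sigma>\<^sub>2(F(a,b))\<close>, closed under the bracket as \<open>\<sigma>\<^sub>2\<close> is an anti-automorphism.

  For simplicity, a nonzero element of an ideal is moved to the corner spanned by one matrix unit
  \<open>E\<^bsub>q,q*\<^esub>\<close>, lowered there to minimal degree, and raised to the elements whose sum is the Virasoro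
  element \<open>\<omega>\<close>; since \<open>\<omega>\<^sub>1\<close> multiplies by a nonzero multiple of the weight, the ideal is everything.
  Generation follows from the structure constants on \<open>E\<^bsub>p,q\<^esub>(m,n) - s \<sigma>\<^sub>2(E\<^bsub>p,q\<^esub>)(n,m)\<close>.
\<close>

section \<open>Linear extension from monomials\<close>

text \<open>A field of characteristic 0 is infinite, so polynomials may be replaced by their values:
  a substitution such as \<open>- a - l\<close> becomes a function application, and identities
  between products come back by comparing coefficients. The cost lies in truncation: all sums over
  product indices are finite, and nested products need bounds that are uniform in the inner index.
  The obstacle to simplicity is that every element of the fixed space has two mirror summands and
  that a product multiplies from both sides. Two devices isolate one term: a multiplier that
  vanishes exactly where the right factor is evaluated, and a matrix unit \<open>E\<close> with
  \<open>E E = 0\<close>, for which acting twice leaves only a multiple of \<open>E v E\<close>. In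
  the generation part, an index outside \<open>p\<close> and \<open>p*\<close> separates the mirror
  summands. For one symplectic pair no such index exists; the argument there works degree by degree
  modulo multiples of \<open>a + b\<close>, and the sign of the two surviving terms has to be
  controlled so that they do not cancel.\<close>

definition mat_scale :: "'f::field \<Rightarrow> 'f fmat \<Rightarrow> 'f fmat" where
  "mat_scale c u = (\<lambda>p q. c * u p q)"

lemma elt_add: "elt (u + v) m n = elt u m n + elt v m n"
  by (simp add: elt_def single_add)

lemma elt_zero [simp]: "elt 0 m n = 0"
  by (simp add: elt_def)

lemma lookup_elt: "Poly_Mapping.lookup (elt u m n) (i, j) = (if i = m \<and> j = n then u else 0)"
  by (auto simp: elt_def lookup_single when_def)

lemma lookup_tscale_mat:
  "Poly_Mapping.lookup (tscale c x) mn = mat_scale c (Poly_Mapping.lookup x mn)"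
  by (simp add: fun_eq_iff lookup_tscale mat_scale_def)

lemma tscale_elt: "tscale c (elt u m n) = elt (mat_scale c u) m n"
  by (rule poly_mapping_eqI) (auto simp: lookup_tscale_mat lookup_elt mat_scale_def fun_eq_iff)

lemma tmat_eqI:
  "(\<And>m n p q. Poly_Mapping.lookup x (m, n) p q = Poly_Mapping.lookup y (m, n) p q) \<Longrightarrow> x = y"
  by (rule poly_mapping_eqI) (auto simp: fun_eq_iff)

lemma tmat_sum_elt:
  "x = (\<Sum>(m, n)\<in>Poly_Mapping.keys x. elt (Poly_Mapping.lookup x (m, n)) m n)"
proof -
  have "(\<Sum>(m, n)\<in>Poly_Mapping.keys x. elt (Poly_Mapping.lookup x (m, n)) m n)
      = (\<Sum>k\<in>Poly_Mapping.keys x. Poly_Mapping.single k (Poly_Mapping.lookup x k))"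
    by (rule sum.cong) (auto simp: elt_def)
  then show ?thesis
    by (intro poly_mapping_eqI)
      (simp add: lookup_sum lookup_single when_def in_keys_iff del: not_in_keys_iff_lookup_eq_zero)
qed

lemma tmat_induct [case_names zero elt add]:
  assumes "P 0" "\<And>u m n. P (elt u m n)" "\<And>x y. P x \<Longrightarrow> P y \<Longrightarrow> P (x + y)"
  shows "P x"
proof -
  have "P (\<Sum>(m, n)\<in>K. elt (Poly_Mapping.lookup x (m, n)) m n)" if "finite K" for K
    using that by induction (use assms in \<open>auto split: prod.splits\<close>)
  from this[of "Poly_Mapping.keys x"] show ?thesis
    by (simp flip: tmat_sum_elt)
qed

definition lin_ext :: "(nat \<Rightarrow> nat \<Rightarrow> 'f fmat \<Rightarrow> 'b) \<Rightarrow> 'f::field tmat \<Rightarrow> 'b::ab_group_add" where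
  "lin_ext f x = (\<Sum>(m, n)\<in>Poly_Mapping.keys x. f m n (Poly_Mapping.lookup x (m, n)))"

lemma lin_ext_zero [simp]: "lin_ext f 0 = 0"
  by (simp add: lin_ext_def)

lemma lin_ext_add:
  assumes "\<And>m n u v. f m n (u + v) = f m n u + f m n v"
  shows "lin_ext f (x + y) = lin_ext f x + lin_ext f y"
proof -
  have "f m n 0 = 0" for m n
    using assms[of m n 0 0] by simp
  then have "(\<Sum>k\<in>Poly_Mapping.keys (x + y). (\<lambda>k u. f (fst k) (snd k) u) k (Poly_Mapping.lookup (x + y) k))
    = (\<Sum>k\<in>Poly_Mapping.keys x. (\<lambda>k u. f (fst k) (snd k) u) k (Poly_Mapping.lookup x k))
    + (\<Sum>k\<in>Poly_Mapping.keys y. (\<lambda>k u. f (fst k) (snd k) u) k (Poly_Mapping.lookup y k))"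
    by (intro setsum_keys_plus_distrib) (simp_all only: assms)
  then show ?thesis
    by (simp add: lin_ext_def case_prod_beta)
qed

lemma lin_ext_elt: "f m n 0 = 0 \<Longrightarrow> lin_ext f (elt u m n) = f m n u"
  by (cases "u = 0") (simp_all add: lin_ext_def elt_def)

text \<open>Here \<open>h\<close> stands for multiplication by \<open>c\<close> in whatever space
  the values lie, so one induction serves maps with values in \<open>tmat\<close> as well as in
  matrices.\<close>

lemma tmat_linear_scale:
  fixes g :: "'f::field tmat \<Rightarrow> 'b::ab_group_add"
  assumes "g 0 = 0" "\<And>x y. g (x + y) = g x + g y" "\<And>u m n. g (elt (mat_scale c u) m n) = h (g (elt u m n))"
    and "h 0 = 0" "\<And>x y. h (x + y) = h x + h y"
  shows "g (tscale c x) = h (g x)"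
  by (induction x rule: tmat_induct) (simp_all add: assms tscale_elt tmat.scale_right_distrib)

section \<open>Matrices\<close>

lemma mat_mul_add_left: "mat_mul k (u + v) w = mat_mul k u w + mat_mul k v w"
  and mat_mul_add_right: "mat_mul k w (u + v) = mat_mul k w u + mat_mul k w v"
  by (simp_all add: mat_mul_def fun_eq_iff distrib_left distrib_right sum.distrib)

lemma mat_mul_zero [simp]: "mat_mul k 0 w = 0" "mat_mul k w 0 = 0"
  by (simp_all add: mat_mul_def fun_eq_iff)

lemma mat_mul_scale_left: "mat_mul k (mat_scale c u) v = mat_scale c (mat_mul k u v)"
  and mat_mul_scale_right: "mat_mul k u (mat_scale c v) = mat_scale c (mat_mul k u v)"
  by (simp_all add: mat_mul_def mat_scale_def fun_eq_iff sum_distrib_left mult_ac)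

lemma mat_mul_minus_left: "mat_mul k (u - v) w = mat_mul k u w - mat_mul k v w"
  and mat_mul_minus_right: "mat_mul k w (u - v) = mat_mul k w u - mat_mul k w v"
  by (simp_all add: mat_mul_def fun_eq_iff left_diff_distrib right_diff_distrib sum_subtractf)

lemma mat_mul_assoc: "mat_mul k (mat_mul k u v) w = mat_mul k u (mat_mul k v w)"
proof (intro ext)
  fix p q
  show "mat_mul k (mat_mul k u v) w p q = mat_mul k u (mat_mul k v w) p q"
    unfolding mat_mul_def sum_distrib_left sum_distrib_right
    by (subst sum.swap) (simp add: mult.assoc)
qed

lemma mat_scale_add: "mat_scale c (u + v) = mat_scale c u + mat_scale c v"
  and mat_scale_diff: "mat_scale c (u - v) = mat_scale c u - mat_scale c v"
  and mat_scale_scale: "mat_scale c (mat_scale d u) = mat_scale (c * d) u"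
  and mat_scale_zero [simp]: "mat_scale c 0 = 0"
  by (simp_all add: mat_scale_def fun_eq_iff algebra_simps)

lemma mat_mul_unit:
  assumes "q \<in> {1..k}"
  shows "mat_mul k (mat_unit p q) (mat_unit r t) = (if q = r then mat_unit p t else (0::'f::field fmat))"
proof -
  have "(\<Sum>j = 1..k. (if i = p \<and> j = q then 1 else 0) * (if j = r \<and> l = t then 1 else 0))
      = (\<Sum>j = 1..k. if j = q then if i = p \<and> j = r \<and> l = t then 1 else 0 else (0::'f))" for i l
    by (rule sum.cong) auto
  then show ?thesis
    using assms by (auto simp: mat_mul_def mat_unit_def fun_eq_iff)
qed

section \<open>Structure constants on monomials\<close>

definition sgn1 :: "nat \<Rightarrow> 'f::field_char_0" where
  "sgn1 e = (- 1) ^ e"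

text \<open>In the coefficient of \<open>z\<close> to the power \<open>- n - 1\<close> the summation
  index is forced to be \<open>m1 + m2 + n1 + e - n\<close>, so each sum of the product collapses to
  one term. The second sum has the same coefficient with the two variables exchanged, up to the sign
  \<open>sgn1 e\<close>.\<close>

definition lcoef :: "nat \<Rightarrow> nat \<Rightarrow> nat \<Rightarrow> nat \<Rightarrow> nat \<Rightarrow> 'f::field_char_0" where
  "lcoef e m1 m2 n1 n = (if n \<le> m1 + m2 + n1 + e then
     of_nat (n1 * e + 1) * (of_int (- int n1 - 1 - int e) gchoose m2) * of_nat ((m1 + m2 + n1 + e - n) choose m1)
     else 0)"

lemma sum_single_index:
  fixes f :: "nat \<Rightarrow> 'b::comm_monoid_add"
  assumes "\<And>p. p \<noteq> P \<Longrightarrow> f p = 0"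
  shows "(\<Sum>p = 0..M. f p) = (if P \<le> M then f P else 0)"
proof -
  have "(\<Sum>p = 0..M. f p) = (\<Sum>p = 0..M. if p = P then f P else 0)"
    using assms by (intro sum.cong) auto
  then show ?thesis by simp
qed

lemma tY_elt_nth:
  fixes u v :: "'f::field_char_0 fmat"
  assumes i: "i < 2"
  shows "tY_elt k i u m1 m2 v n1 n2 (- int n - 1) =
     tscale (lcoef (dlt i 0) m1 m2 n1 n) (elt (mat_mul k u v) (m1 + m2 + n1 + dlt i 0 - n) n2)
   - tscale (sgn1 (dlt i 0) * lcoef (dlt i 0) m2 m1 n2 n) (elt (mat_mul k v u) n1 (m1 + m2 + n2 + dlt i 0 - n))"
proof -
  have *: "(\<Sum>p = 0..M + e. tscale (g p) (zmon (f p) (int p - x1 - x2 - x3 - 1 - int e) (- int n - 1)))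
     = (if n \<le> M + e then tscale (g (M + e - n)) (f (M + e - n)) else 0)"
    if "int M = x1 + x2 + x3" for M g x1 x2 x3 e and f :: "nat \<Rightarrow> 'f tmat"
  proof (cases "n \<le> M + e")
    case True
    then show ?thesis
      using that by (subst sum_single_index[where P = "M + e - n"]) (auto simp: zmon_def)
  next
    case False
    then show ?thesis
      using that by (auto simp: zmon_def)
  qed
  have s: "of_int (int (dlt i 1) - int ((n2 + 1) * dlt i 0)) = (sgn1 (dlt i 0) * of_nat (n2 * dlt i 0 + 1) :: 'f)"
    using i by (auto simp: dlt_def sgn1_def)
  show ?thesis
    unfolding tY_elt_def s
    by (subst (1 2) *) (auto simp: lcoef_def mult_ac add_ac)
qed

lemma tY_elt_nonneg: "a \<ge> 0 \<Longrightarrow> tY_elt k i u m1 m2 v n1 n2 a = 0"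
  by (simp add: tY_elt_def zmon_def)

lemma int_exponent_cases [case_names nonneg neg]:
  fixes a :: int
  obtains "a \<ge> 0" | n where "a = - int n - 1"
proof (cases "a \<ge> 0")
  case False
  then have "a = - int (nat (- a - 1)) - 1" by simp
  then show ?thesis using that by blast
qed (use that in blast)

lemma tY_elt_add_left:
  assumes "i < 2"
  shows "tY_elt k i (u + u') m1 m2 v n1 n2 a = tY_elt k i u m1 m2 v n1 n2 a + tY_elt k i u' m1 m2 v n1 n2 a"
  by (cases a rule: int_exponent_cases)
    (simp_all only: tY_elt_nonneg tY_elt_nth[OF assms] mat_mul_add_left mat_mul_add_right elt_add
      tmat.scale_right_distrib add_diff_add add_0)

lemma tY_elt_add_right:
  assumes "i < 2"
  shows "tY_elt k i u m1 m2 (v + v') n1 n2 a = tY_elt k i u m1 m2 v n1 n2 a + tY_elt k i u m1 m2 v' n1 n2 a"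
  by (cases a rule: int_exponent_cases)
    (simp_all only: tY_elt_nonneg tY_elt_nth[OF assms] mat_mul_add_left mat_mul_add_right elt_add
      tmat.scale_right_distrib add_diff_add add_0)

lemma tY_ext:
  "tY k i x y a = lin_ext (\<lambda>m1 m2 u. lin_ext (\<lambda>n1 n2 v. tY_elt k i u m1 m2 v n1 n2 a) y) x"
  by (simp add: tY_def lin_ext_def)

lemma tY_add_right:
  assumes "i < 2"
  shows "tY k i x (y + y') a = tY k i x y a + tY k i x y' a"
  unfolding tY_ext
  by (simp add: lin_ext_add tY_elt_add_right[OF assms]) (simp add: lin_ext_def sum.distrib case_prod_beta)

lemma tY_add_left:
  assumes "i < 2"
  shows "tY k i (x + x') y a = tY k i x y a + tY k i x' y a"
  unfolding tY_ext
  by (rule lin_ext_add) (simp add: lin_ext_def tY_elt_add_left[OF assms] sum.distrib case_prod_beta)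

lemma tY_zero [simp]: "tY k i 0 y a = 0" "tY k i x 0 a = 0"
  by (simp_all add: tY_def)

lemma tY_nonneg:
  assumes "a \<ge> 0"
  shows "tY k i x y a = 0"
  using assms by (simp add: tY_def tY_elt_nonneg)

lemma tY_elt_nth':
  assumes "i < 2"
  shows "tY k i (elt u m1 m2) (elt v n1 n2) (- int n - 1) =
     tscale (lcoef (dlt i 0) m1 m2 n1 n) (elt (mat_mul k u v) (m1 + m2 + n1 + dlt i 0 - n) n2)
   - tscale (sgn1 (dlt i 0) * lcoef (dlt i 0) m2 m1 n2 n) (elt (mat_mul k v u) n1 (m1 + m2 + n2 + dlt i 0 - n))"
  by (simp only: tY_elt tY_elt_nth[OF assms])

lemma tY_elt_scale:
  assumes "i < 2"
  shows "tY k i (elt (mat_scale c u) m1 m2) (elt v n1 n2) a = tscale c (tY k i (elt u m1 m2) (elt v n1 n2) a)"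
    and "tY k i (elt u m1 m2) (elt (mat_scale c v) n1 n2) a = tscale c (tY k i (elt u m1 m2) (elt v n1 n2) a)"
proof -
  have *: "tscale c (tscale d (elt w m n)) = tscale d (elt (mat_scale c w) m n)" for c d w m n
    by (simp add: tscale_elt mat_scale_scale mult.commute)
  show "tY k i (elt (mat_scale c u) m1 m2) (elt v n1 n2) a = tscale c (tY k i (elt u m1 m2) (elt v n1 n2) a)"
    "tY k i (elt u m1 m2) (elt (mat_scale c v) n1 n2) a = tscale c (tY k i (elt u m1 m2) (elt v n1 n2) a)"
    by (cases a rule: int_exponent_cases;
        simp only: tY_nonneg tmat.scale_zero_right tY_elt_nth'[OF assms] mat_mul_scale_left mat_mul_scale_right
          tmat.scale_right_diff_distrib *)+
qed

lemma tY_scale_right: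
  assumes "i < 2"
  shows "tY k i x (tscale c y) a = tscale c (tY k i x y a)"
proof (induction x rule: tmat_induct)
  case (elt u m n)
  show ?case
    by (rule tmat_linear_scale[where g = "\<lambda>y. tY k i (elt u m n) y a"])
      (simp_all add: tY_add_right assms tY_elt_scale tmat.scale_right_distrib)
qed (simp_all add: tY_add_left assms tmat.scale_right_distrib)

lemma tY_scale_left:
  assumes "i < 2"
  shows "tY k i (tscale c x) y a = tscale c (tY k i x y a)"
proof (induction y rule: tmat_induct)
  case (elt u m n)
  show ?case
    by (rule tmat_linear_scale[where g = "\<lambda>x. tY k i x (elt u m n) a"])
      (simp_all add: tY_add_left assms tY_elt_scale tmat.scale_right_distrib)
qed (simp_all add: tY_add_right assms tmat.scale_right_distrib)

lemma tD_ext: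
  "tD x = lin_ext (\<lambda>m n u. tscale (of_nat (m + 1)) (elt u (m + 1) n) + tscale (of_nat (n + 1)) (elt u m (n + 1))) x"
  by (simp add: tD_def lin_ext_def)

lemma tD_add: "tD (x + y) = tD x + tD y"
  unfolding tD_ext by (rule lin_ext_add) (simp add: elt_add tmat.scale_right_distrib add_ac)

lemma tD_zero [simp]: "tD 0 = 0"
  by (simp add: tD_ext)

lemma tD_scale: "tD (tscale c x) = tscale c (tD x)"
  by (rule tmat_linear_scale)
    (simp_all add: tD_add tD_elt tscale_elt mat_scale_scale tmat.scale_right_distrib mult.commute)

section \<open>Generating functions\<close>

text \<open>Applied inside eta-expanded matrices, these rules turn \<open>u + v\<close> into a \<open>\<lambda>\<close>-term that no other rule matches.\<close>

declare plus_fun_apply [simp del] zero_fun_apply [simp del] minus_apply [simp del]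

definition fnprod :: "nat \<Rightarrow> nat \<Rightarrow> 'f::field_char_0 tmat \<Rightarrow> nat \<Rightarrow> 'f tmat \<Rightarrow> 'f tmat" where
  "fnprod k i x n y = tY k i x y (- int n - 1)"

text \<open>The matrix polynomial of \<open>x\<close>, evaluated at scalars \<open>a\<close> and
  \<open>b\<close>. The factorials turn \<open>tD\<close> into multiplication by
  \<open>a + b\<close> and binomial convolutions into powers of sums.\<close>

definition Phi :: "'f::field_char_0 tmat \<Rightarrow> 'f \<Rightarrow> 'f \<Rightarrow> 'f fmat" where
  "Phi x a b = (\<lambda>p q. lin_ext (\<lambda>m n u. u p q * (a ^ m / fact m) * (b ^ n / fact n)) x)"

lemma Phi_elt: "Phi (elt u m n) a b = mat_scale ((a ^ m / fact m) * (b ^ n / fact n)) u"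
  by (simp add: Phi_def lin_ext_elt mat_scale_def fun_eq_iff zero_fun_apply)

lemma Phi_zero [simp]: "Phi 0 a b = 0"
  by (simp add: Phi_def fun_eq_iff zero_fun_apply)

lemma Phi_add: "Phi (x + y) a b = Phi x a b + Phi y a b"
  unfolding Phi_def
  by (intro HOL.ext, simp only: plus_fun_apply, rule lin_ext_add) (simp add: algebra_simps plus_fun_apply add_divide_distrib)

lemma Phi_scale: "Phi (tscale c x) a b = mat_scale c (Phi x a b)"
  by (rule tmat_linear_scale[where g = "\<lambda>x. Phi x a b" and h = "mat_scale c"])
    (simp_all add: Phi_add Phi_elt mat_scale_add mat_scale_scale mult_ac)

lemma Phi_diff: "Phi (x - y) a b = Phi x a b - Phi y a b"
  by (metis Phi_add add_diff_cancel_right' diff_add_cancel)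

lemma Phi_D: "Phi (tD x) a b = mat_scale (a + b) (Phi x a b)"
proof (induction x rule: tmat_induct)
  case (elt u m n)
  have *: "of_nat (Suc j) * (c ^ Suc j / fact (Suc j)) = c * (c ^ j / fact j)" for c :: 'a and j
    by (simp add: field_simps del: of_nat_Suc)
  have 1: "of_nat (Suc m) * (a ^ Suc m / fact (Suc m) * (b ^ n / fact n)) = a * (a ^ m / fact m * (b ^ n / fact n))"
    by (simp only: mult.assoc[symmetric] *)
  have 2: "of_nat (Suc n) * (a ^ m / fact m * (b ^ Suc n / fact (Suc n))) = b * (a ^ m / fact m * (b ^ n / fact n))"
    by (simp only: mult.left_commute[of _ "a ^ m / fact m"] *)
  have "mat_scale c u + mat_scale d u = mat_scale (c + d) u" for c d
    by (simp add: mat_scale_def fun_eq_iff distrib_right plus_fun_apply)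
  then show ?case
    unfolding tD_elt Phi_add Phi_scale Phi_elt mat_scale_scale
    by (simp only: Suc_eq_plus1[symmetric] 1 2 distrib_right)
qed (simp_all add: tD_add Phi_add mat_scale_add)

section \<open>Recovering an element from the values of its polynomial\<close>

lemma poly_coeffs_eq_0:
  fixes c :: "nat \<Rightarrow> 'f::field_char_0"
  assumes "finite S" and "\<And>l. l \<notin> S \<Longrightarrow> (\<Sum>n<N. l ^ n * c n) = 0" and "n < N"
  shows "c n = 0"
proof -
  define p where "p = (\<Sum>n<N. monom (c n) n)"
  have "UNIV \<subseteq> {x. poly p x = 0} \<union> S"
    using assms(2) by (auto simp: p_def poly_sum poly_monom mult.commute)
  then have "\<not> finite {x. poly p x = 0}"
    using assms(1) infinite_UNIV_char_0[where ?'a = 'f] by (meson finite_Un finite_subset)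
  then have "p = 0"
    using poly_roots_finite by blast
  then have "coeff p n = 0" by simp
  then show ?thesis
    using assms(3) by (simp add: p_def coeff_sum)
qed

text \<open>The nested form, a polynomial in \<open>a\<close> whose coefficients are polynomials in
  \<open>b\<close>, reduces vanishing in two variables to two applications of the one-variable
  criterion.\<close>

lemma Phi_expand:
  assumes "\<forall>(m, n)\<in>Poly_Mapping.keys x. m < N \<and> n < N"
  shows "Phi x a b p q = (\<Sum>m<N. a ^ m * ((\<Sum>n<N. b ^ n * (Poly_Mapping.lookup x (m, n) p q / fact n)) / fact m))"
proof -
  have "Phi x a b p q = (\<Sum>(m, n)\<in>{..<N} \<times> {..<N}.
      Poly_Mapping.lookup x (m, n) p q * (a ^ m / fact m) * (b ^ n / fact n))"
    unfolding Phi_def lin_ext_def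
  proof (rule sum.mono_neutral_left)
    show "Poly_Mapping.keys x \<subseteq> {..<N} \<times> {..<N}"
      using assms by fast
    show "\<forall>k\<in>{..<N} \<times> {..<N} - Poly_Mapping.keys x. (case k of (m, n) \<Rightarrow>
        Poly_Mapping.lookup x (m, n) p q * (a ^ m / fact m) * (b ^ n / fact n)) = 0"
      by (auto simp: in_keys_iff zero_fun_apply)
  qed simp
  also have "\<dots> = (\<Sum>m<N. \<Sum>n<N. Poly_Mapping.lookup x (m, n) p q * (a ^ m / fact m) * (b ^ n / fact n))"
    by (simp add: sum.cartesian_product)
  finally show ?thesis
    by (simp add: sum_distrib_left sum_divide_distrib mult_ac)
qed

lemma keys_bound: "\<exists>N. \<forall>(m, n)\<in>Poly_Mapping.keys x. m < N \<and> n < N"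
  for x :: "'f::field tmat"
proof (induction x rule: tmat_induct)
  case (elt u m n)
  show ?case
    by (rule exI[of _ "Suc (max m n)"]) (auto simp: elt_def)
next
  case (add x y)
  then obtain N N' where "\<forall>(m, n)\<in>Poly_Mapping.keys x. m < N \<and> n < N"
    "\<forall>(m, n)\<in>Poly_Mapping.keys y. m < N' \<and> n < N'" by blast
  then show ?case
    using keys_add[of x y] by (intro exI[of _ "max N N'"]) fastforce
qed simp

text \<open>Finitely many exceptional values are allowed, those of \<open>a\<close> depending on
  \<open>b\<close>, because a polynomial vanishing off a finite subset of an infinite field is zero.
  Read backwards, a nonzero entry stays nonzero at some point that avoids prescribed bad
  values.\<close>

lemma Phi_entry_eq_0:
  assumes "finite B" "\<And>b. finite (A b)"
    and "\<And>a b. b \<notin> B \<Longrightarrow> a \<notin> A b \<Longrightarrow> Phi x a b p q = 0"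
  shows "Poly_Mapping.lookup x (m, n) p q = 0"
proof -
  obtain N where N: "\<forall>(m, n)\<in>Poly_Mapping.keys x. m < N \<and> n < N"
    using keys_bound by blast
  show ?thesis
  proof (cases "(m, n) \<in> Poly_Mapping.keys x")
    case True
    with N have mn: "m < N" "n < N" by auto
    have "(\<Sum>n<N. b ^ n * (Poly_Mapping.lookup x (m, n) p q / fact n)) / fact m = 0" if "b \<notin> B" for b
      by (rule poly_coeffs_eq_0[OF assms(2)[of b] _ mn(1), where c = "\<lambda>m. (\<Sum>n<N. b ^ n * (Poly_Mapping.lookup x (m, n) p q / fact n)) / fact m"])
        (simp only: Phi_expand[OF N, symmetric], rule assms(3)[OF that])
    then have "(\<Sum>n<N. b ^ n * (Poly_Mapping.lookup x (m, n) p q / fact n)) = 0" if "b \<notin> B" for b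
      using that by (simp only: divide_eq_0_iff fact_nonzero simp_thms)
    from poly_coeffs_eq_0[where c = "\<lambda>n. Poly_Mapping.lookup x (m, n) p q / fact n", OF assms(1) this mn(2)] show ?thesis
      by simp
  qed (simp add: in_keys_iff zero_fun_apply)
qed

lemma Phi_eq_0: "(\<And>a b. Phi x a b = 0) \<Longrightarrow> x = 0"
  by (rule tmat_eqI) (simp add: Phi_entry_eq_0[where A = "\<lambda>_. {}" and B = "{}"] zero_fun_apply)

lemma Phi_inject: "(\<And>a b. Phi x a b = Phi y a b) \<Longrightarrow> x = y"
  using Phi_eq_0[of "x - y"] by (simp add: Phi_diff)

lemma fnprod_elt:
  assumes "i < 2"
  shows "fnprod k i (elt u m1 m2) n (elt v n1 n2) =
     tscale (lcoef (dlt i 0) m1 m2 n1 n) (elt (mat_mul k u v) (m1 + m2 + n1 + dlt i 0 - n) n2)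
   - tscale (sgn1 (dlt i 0) * lcoef (dlt i 0) m2 m1 n2 n) (elt (mat_mul k v u) n1 (m1 + m2 + n2 + dlt i 0 - n))"
  unfolding fnprod_def by (rule tY_elt_nth'[OF assms])

lemma fnprod_linear:
  assumes "i < 2"
  shows "fnprod k i (x + x') n y = fnprod k i x n y + fnprod k i x' n y"
    "fnprod k i x n (y + y') = fnprod k i x n y + fnprod k i x n y'"
    "fnprod k i (tscale c x) n y = tscale c (fnprod k i x n y)"
    "fnprod k i x n (tscale c y) = tscale c (fnprod k i x n y)"
  by (simp_all add: fnprod_def tY_add_left tY_add_right tY_scale_left tY_scale_right assms)

lemma fnprod_zero [simp]: "fnprod k i 0 n y = 0" "fnprod k i x n 0 = 0"
  by (simp_all add: fnprod_def)

lemma eventually_fnprod_zero: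
  assumes "i < 2"
  shows "\<forall>\<^sub>F n in sequentially. fnprod k i x n y = 0"
proof (induction x rule: tmat_induct)
  case (elt u m1 m2)
  show ?case
  proof (induction y rule: tmat_induct)
    case (elt v n1 n2)
    show ?case
      unfolding fnprod_elt[OF assms] lcoef_def
      by (rule eventually_sequentiallyI[of "m1 + m2 + n1 + n2 + 2"]) (auto simp: dlt_def)
  next
    case (add x y)
    then show ?case
      by eventually_elim (simp add: fnprod_linear assms)
  qed simp
next
  case (add x y)
  then show ?case
    by eventually_elim (simp add: fnprod_linear assms)
qed simp

section \<open>Exponential generating functions of the structure constants\<close>

lemma exp_product:
  fixes a b :: "'f::field_char_0"
  shows "(\<Sum>n\<le>K. a ^ n / fact n * (b ^ (K - n) / fact (K - n))) = (a + b) ^ K / fact K"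
proof -
  have "(a + b) ^ K / fact K = (\<Sum>n\<le>K. of_nat (K choose n) * a ^ n * b ^ (K - n) / fact K)"
    by (simp add: binomial_ring sum_divide_distrib)
  also have "\<dots> = (\<Sum>n\<le>K. a ^ n / fact n * (b ^ (K - n) / fact (K - n)))"
    by (rule sum.cong) (simp_all add: binomial_fact)
  finally show ?thesis ..
qed

text \<open>For \<open>e \<le> 1\<close> the normalising factor \<open>n1 * e + 1\<close> is the
  quotient of \<open>fact (n1 + e)\<close> by \<open>fact n1\<close>, and negating the upper index
  of the binomial yields \<open>(n1 + e + m2) choose m2\<close>; the factorials then cancel.\<close>

lemma lcoef_constant:
  assumes "e \<le> 1"
  shows "of_nat (n1 * e + 1) * (of_int (- int n1 - 1 - int e) gchoose m2) / fact (m2 + n1 + e)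
     = ((- 1) ^ m2 / (fact m2 * fact n1) :: 'f::field_char_0)"
proof -
  have g: "(of_int (- int n1 - 1 - int e) gchoose m2) = ((- 1) ^ m2 * of_nat ((n1 + e + m2) choose m2) :: 'f)"
  proof -
    have "(of_int (- int n1 - 1 - int e) :: 'f) = - of_nat (n1 + e + 1)" by simp
    then have "(of_int (- int n1 - 1 - int e) gchoose m2) = ((- 1) ^ m2 * ((of_nat (n1 + e + 1) + of_nat m2 - 1) gchoose m2) :: 'f)"
      by (simp only: gbinomial_minus)
    also have "(of_nat (n1 + e + 1) + of_nat m2 - 1 :: 'f) = of_nat (n1 + e + m2)" by simp
    finally show ?thesis by (simp only: binomial_gbinomial)
  qed
  have f: "fact (n1 + e) = (of_nat (n1 * e + 1) * fact n1 :: 'f)"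
    using assms by (cases e) auto
  have nz: "of_nat (n1 * e + 1) \<noteq> (0 :: 'f)"
    by (metis Suc_eq_plus1 of_nat_neq_0)
  have "of_nat ((n1 + e + m2) choose m2) = (fact (m2 + n1 + e) / (fact m2 * fact (n1 + e)) :: 'f)"
    by (subst binomial_fact) (simp_all add: add_ac)
  then show ?thesis
    unfolding g f using nz by simp
qed

lemma lcoef_generating:
  fixes a l :: "'f::field_char_0"
  assumes "e \<le> 1" and "N > m1 + m2 + n1 + e"
  shows "(\<Sum>n<N. l ^ n / fact n * (lcoef e m1 m2 n1 n * (a ^ (m1 + m2 + n1 + e - n) / fact (m1 + m2 + n1 + e - n))))
    = (a + l) ^ e * (a ^ m1 / fact m1) * ((- a - l) ^ m2 / fact m2) * ((a + l) ^ n1 / fact n1)"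
proof -
  define K where "K = m2 + n1 + e"
  define c :: 'f where "c = of_nat (n1 * e + 1) * (of_int (- int n1 - 1 - int e) gchoose m2)"
  \<comment> \<open>The guard in \<open>lcoef\<close> admits \<open>n\<close> up to
    \<open>m1 + K\<close>, but beyond \<open>K\<close> the factor
    \<open>(m1 + K - n) choose m1\<close> vanishes. Below \<open>K\<close> the power
    \<open>a ^ m1\<close> splits off and the rest is the expansion of
    \<open>(a + l) ^ K\<close>.\<close>
  have "(\<Sum>n<N. l ^ n / fact n * (lcoef e m1 m2 n1 n * (a ^ (m1 + m2 + n1 + e - n) / fact (m1 + m2 + n1 + e - n))))
      = (\<Sum>n\<le>K. c * (a ^ m1 / fact m1) * (l ^ n / fact n * (a ^ (K - n) / fact (K - n))))"
  proof (rule sum.mono_neutral_cong_right)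
    show "{..K} \<subseteq> {..<N}"
      using assms(2) by (auto simp: K_def)
    show "\<forall>n\<in>{..<N} - {..K}. l ^ n / fact n * (lcoef e m1 m2 n1 n * (a ^ (m1 + m2 + n1 + e - n) / fact (m1 + m2 + n1 + e - n))) = 0"
      by (auto simp: lcoef_def K_def)
  next
    fix n assume "n \<in> {..K}"
    then have n: "n \<le> K" "m1 + m2 + n1 + e - n = m1 + (K - n)"
      by (auto simp: K_def)
    have "of_nat ((m1 + (K - n)) choose m1) / fact (m1 + (K - n)) = (1 / (fact m1 * fact (K - n)) :: 'f)"
      by (subst binomial_fact) simp_all
    moreover have "lcoef e m1 m2 n1 n = c * of_nat ((m1 + (K - n)) choose m1)"
      using n by (simp add: lcoef_def c_def K_def)
    ultimately show "l ^ n / fact n * (lcoef e m1 m2 n1 n * (a ^ (m1 + m2 + n1 + e - n) / fact (m1 + m2 + n1 + e - n)))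
      = c * (a ^ m1 / fact m1) * (l ^ n / fact n * (a ^ (K - n) / fact (K - n)))"
      unfolding n(2) by (simp add: power_add field_simps)
  qed simp_all
  also have "\<dots> = c * (a ^ m1 / fact m1) * ((a + l) ^ K / fact K)"
    by (simp only: exp_product sum_distrib_left[symmetric] add.commute[of l a])
  also have "\<dots> = (c / fact K) * (a ^ m1 / fact m1) * (a + l) ^ K"
    by simp
  also have "c / fact K = (- 1) ^ m2 / (fact m2 * fact n1)"
    unfolding c_def K_def by (rule lcoef_constant[OF assms(1)])
  also have "(- 1) ^ m2 / (fact m2 * fact n1) * (a ^ m1 / fact m1) * (a + l) ^ K
      = (a + l) ^ e * (a ^ m1 / fact m1) * ((- (a + l)) ^ m2 / fact m2) * ((a + l) ^ n1 / fact n1)"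
    by (simp only: power_minus[of "a + l"]) (simp add: K_def power_add mult_ac)
  also have "- (a + l) = - a - l" by simp
  finally show ?thesis .
qed

text \<open>The lambda-bracket, with \<open>l\<close> in the role of lambda. It is defined for
  arbitrary matrix-valued functions, not only those of the form \<open>Phi x\<close>, so that
  brackets can be nested at fixed parameters.\<close>

definition lbr :: "nat \<Rightarrow> nat \<Rightarrow> ('f \<Rightarrow> 'f \<Rightarrow> 'f fmat) \<Rightarrow> ('f \<Rightarrow> 'f \<Rightarrow> 'f fmat) \<Rightarrow> 'f \<Rightarrow> 'f::field_char_0 \<Rightarrow> 'f \<Rightarrow> 'f fmat" where
  "lbr k e F G l a b = mat_scale ((a + l) ^ e) (mat_mul k (F a (- a - l)) (G (a + l) b))
     - mat_scale (sgn1 e * (b + l) ^ e) (mat_mul k (G a (b + l)) (F (- b - l) b))"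

lemma sum_fun_apply: "(\<Sum>n\<in>A. f n) p q = (\<Sum>n\<in>A. f n p q :: 'b::comm_monoid_add)"
  by (induction A rule: infinite_finite_induct) (auto simp: plus_fun_apply zero_fun_apply)

lemma dlt_le_1: "dlt i j \<le> 1"
  by (simp add: dlt_def)

text \<open>On monomials each of the two sums is an instance of \<open>lcoef_generating\<close>; the
  rest is bilinearity. An eventual statement in \<open>N\<close> lets the bounds for two summands
  combine without being named.\<close>

lemma lbr_generating:
  fixes x y :: "'f::field_char_0 tmat"
  assumes "i < 2"
  shows "\<forall>\<^sub>F N in sequentially. \<forall>l a b. (\<Sum>n<N. mat_scale (l ^ n / fact n) (Phi (fnprod k i x n y) a b))
    = lbr k (dlt i 0) (Phi x) (Phi y) l a b"
proof (induction x rule: tmat_induct)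
  case (elt u m1 m2)
  show ?case
  proof (induction y rule: tmat_induct)
    case (elt v n1 n2)
    define e where "e = dlt i 0"
    show ?case
    proof (rule eventually_sequentiallyI[of "m1 + m2 + n1 + n2 + e + 1"], intro allI)
      fix N and l a b :: 'f
      assume N: "m1 + m2 + n1 + n2 + e + 1 \<le> N"
      have 1: "(\<Sum>n<N. l ^ n / fact n * (lcoef e m1 m2 n1 n * (a ^ (m1 + m2 + n1 + e - n) / fact (m1 + m2 + n1 + e - n))))
        = (a + l) ^ e * (a ^ m1 / fact m1) * ((- a - l) ^ m2 / fact m2) * ((a + l) ^ n1 / fact n1)"
        using N by (intro lcoef_generating) (use dlt_le_1[of i 0] in \<open>auto simp: e_def\<close>)
      have 2: "(\<Sum>n<N. l ^ n / fact n * (lcoef e m2 m1 n2 n * (b ^ (m1 + m2 + n2 + e - n) / fact (m1 + m2 + n2 + e - n))))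
        = (b + l) ^ e * (b ^ m2 / fact m2) * ((- b - l) ^ m1 / fact m1) * ((b + l) ^ n2 / fact n2)"
        using N lcoef_generating[of e m2 m1 n2 N l b] dlt_le_1[of i 0] by (simp add: e_def add.commute)
      have "(\<Sum>n<N. mat_scale (l ^ n / fact n) (Phi (fnprod k i (elt u m1 m2) n (elt v n1 n2)) a b)) p q
        = (\<Sum>n<N. l ^ n / fact n * (lcoef e m1 m2 n1 n * (a ^ (m1 + m2 + n1 + e - n) / fact (m1 + m2 + n1 + e - n))))
            * (b ^ n2 / fact n2 * mat_mul k u v p q)
        - sgn1 e * (\<Sum>n<N. l ^ n / fact n * (lcoef e m2 m1 n2 n * (b ^ (m1 + m2 + n2 + e - n) / fact (m1 + m2 + n2 + e - n))))
            * (a ^ n1 / fact n1 * mat_mul k v u p q)" for p q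
        unfolding sum_fun_apply fnprod_elt[OF assms] sum_distrib_left sum_distrib_right e_def
          sum_subtractf[symmetric] Phi_diff Phi_scale Phi_elt mat_scale_def minus_apply
        by (intro sum.cong refl) (simp add: algebra_simps)
      also have "\<dots> p q = lbr k e (Phi (elt u m1 m2)) (Phi (elt v n1 n2)) l a b p q" for p q
        unfolding 1 2 lbr_def Phi_elt mat_mul_scale_left mat_mul_scale_right
        by (simp add: mat_scale_def minus_apply mult_ac)
      finally show "(\<Sum>n<N. mat_scale (l ^ n / fact n) (Phi (fnprod k i (elt u m1 m2) n (elt v n1 n2)) a b))
        = lbr k (dlt i 0) (Phi (elt u m1 m2)) (Phi (elt v n1 n2)) l a b"
        by (intro HOL.ext) (simp only: e_def)
    qed
  next
    case (add y y')
    then show ?case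
      by eventually_elim (simp add: fnprod_linear assms Phi_add mat_scale_add sum.distrib lbr_def mat_mul_add_left mat_mul_add_right)
  qed (simp add: lbr_def)
next
  case (add x x')
  then show ?case
    by eventually_elim (simp add: fnprod_linear assms Phi_add mat_scale_add sum.distrib lbr_def mat_mul_add_left mat_mul_add_right)
qed (simp add: lbr_def)

section \<open>Conformal algebra axioms\<close>

lemma mat_coeffs_eq:
  fixes c d :: "nat \<Rightarrow> 'f::field_char_0 fmat"
  assumes "\<And>l. (\<Sum>n<N. mat_scale (l ^ n / fact n) (c n)) = (\<Sum>n<N. mat_scale (l ^ n / fact n) (d n))" and "n < N"
  shows "c n = d n"
proof (intro HOL.ext)
  fix p q
  have "(\<Sum>n<N. l ^ n * ((c n p q - d n p q) / fact n)) = 0" for l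
    using fun_cong[OF fun_cong[OF assms(1)[of l]], of p q]
    by (simp add: sum_fun_apply mat_scale_def algebra_simps diff_divide_distrib sum_subtractf)
  from poly_coeffs_eq_0[where c = "\<lambda>n. (c n p q - d n p q) / fact n", OF finite.emptyI this assms(2)]
  show "c n p q = d n p q" by simp
qed

lemma mat_scale_sum: "mat_scale c (\<Sum>n\<in>A. f n) = (\<Sum>n\<in>A. mat_scale c (f n))"
  by (induction A rule: infinite_finite_induct) (simp_all add: mat_scale_add)

lemma mat_scale_sum_left: "mat_scale (\<Sum>n\<in>A. c n) u = (\<Sum>n\<in>A. mat_scale (c n) u)"
  by (simp add: fun_eq_iff sum_fun_apply mat_scale_def sum_distrib_right)

lemma Phi_sum: "Phi (\<Sum>n\<in>A. f n) a b = (\<Sum>n\<in>A. Phi (f n) a b)"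
  by (induction A rule: infinite_finite_induct) (simp_all add: Phi_add)

text \<open>A truncated form of the rule that the exponentials with parameters \<open>l\<close> and
  \<open>c\<close> multiply to the one with parameter \<open>l + c\<close>. Vanishing of
  \<open>g\<close> from \<open>N\<close> on makes the square of pairs \<open>(n, j)\<close> and the
  triangle \<open>n + j < N\<close> give the same sum.\<close>

lemma exp_shift:
  fixes g :: "nat \<Rightarrow> 'f::field_char_0 fmat"
  assumes "\<And>n. n \<ge> N \<Longrightarrow> g n = 0"
  shows "(\<Sum>n<N. \<Sum>j<N. mat_scale (l ^ n / fact n * (c ^ j / fact j)) (g (n + j)))
    = (\<Sum>m<N. mat_scale ((l + c) ^ m / fact m) (g m))"
proof -
  have "(\<Sum>m<N. mat_scale ((l + c) ^ m / fact m) (g m))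
      = (\<Sum>m<N. \<Sum>n\<le>m. mat_scale (l ^ n / fact n * (c ^ (m - n) / fact (m - n))) (g m))"
    by (simp only: exp_product[symmetric] mat_scale_sum_left)
  also have "\<dots> = (\<Sum>(m, n)\<in>(SIGMA m:{..<N}. {..m}). mat_scale (l ^ n / fact n * (c ^ (m - n) / fact (m - n))) (g m))"
    by (rule sum.Sigma) auto
  also have "\<dots> = (\<Sum>(n, j)\<in>{..<N} \<times> {..<N}. mat_scale (l ^ n / fact n * (c ^ j / fact j)) (g (n + j)))"
    by (rule sum.reindex_bij_witness_not_neutral[where S' = "{}" and T' = "{(n, j)\<in>{..<N} \<times> {..<N}. n + j \<ge> N}"
          and i = "\<lambda>(n, j). (n + j, n)" and j = "\<lambda>(m, n). (n, m - n)"])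
      (auto simp: assms intro: finite_subset[of _ "{..<N} \<times> {..<N}"])
  also have "\<dots> = (\<Sum>n<N. \<Sum>j<N. mat_scale (l ^ n / fact n * (c ^ j / fact j)) (g (n + j)))"
    by (rule sum.cartesian_product[symmetric])
  finally show ?thesis by simp
qed

lemma sgn1_power: "e \<le> 1 \<Longrightarrow> (- c) ^ e = sgn1 e * c ^ e"
  by (cases e) (auto simp: sgn1_def)

lemma sgn1_square [simp]: "sgn1 e * sgn1 e = 1" "sgn1 e * (sgn1 e * x) = x"
  by (simp_all add: sgn1_def minus_one_power_iff)

text \<open>Since \<open>a + b\<close> represents the derivation, the new parameter is minus lambda
  minus the derivation. It turns \<open>a + l\<close> into \<open>- (b + l)\<close> and conversely,
  so the two terms of the bracket change places and the powers contribute
  \<open>sgn1 e\<close>.\<close>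

lemma lbr_skew:
  assumes "e \<le> 1"
  shows "lbr k e F G l a b = mat_scale (- 1) (lbr k e G F (- l - (a + b)) a b)"
proof -
  have 1: "(b + (- l - (a + b))) ^ e = sgn1 e * (a + l) ^ e"
    and 2: "(a + (- l - (a + b))) ^ e = sgn1 e * (b + l) ^ e"
    using sgn1_power[OF assms, of "a + l"] sgn1_power[OF assms, of "b + l"] by (simp_all add: algebra_simps)
  have 3: "a + (- l - (a + b)) = - b - l" "- b - (- l - (a + b)) = a + l"
    "- a - (- l - (a + b)) = b + l" "b + (- l - (a + b)) = - a - l"
    by simp_all
  show ?thesis
    unfolding lbr_def 1 2 unfolding 3 mat_scale_diff mat_scale_scale mult.assoc[symmetric] sgn1_square
    by (simp add: mat_scale_def fun_eq_iff minus_apply)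
qed

text \<open>As for commutators in an associative algebra: the terms with \<open>H\<close> between
  \<open>F\<close> and \<open>G\<close> cancel on the left. What has to be checked is that the
  arguments and the signs of the powers agree after substitution.\<close>

lemma lbr_jacobi:
  assumes "e \<le> 1"
  shows "lbr k e F (lbr k e G H m) l a b - lbr k e G (lbr k e F H l) m a b = lbr k e (lbr k e F G l) H (l + m) a b"
proof -
  have 1: "(- a - m) ^ e = sgn1 e * (a + m) ^ e" "(- b - m) ^ e = sgn1 e * (b + m) ^ e" for a b
    using sgn1_power[OF assms, of "a + m"] sgn1_power[OF assms, of "b + m"] by (simp_all add: algebra_simps)
  have 2: "- a - (l + m) + l = - a - m" "- (- a - (l + m)) - l = a + m" "- (a + l) - m = - a - (l + m)"
     "a + l + m = a + (l + m)" "a + m + l = a + (l + m)" "- (a + m) - l = - a - (l + m)" for a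
    by simp_all
  show ?thesis
    unfolding lbr_def mat_mul_minus_left mat_mul_minus_right mat_mul_scale_left mat_mul_scale_right
      mat_scale_diff mat_scale_scale 2 unfolding 1 mat_mul_assoc
    by (intro HOL.ext) (simp add: mat_scale_def minus_apply algebra_simps)
qed

text \<open>Coefficients of powers of \<open>l\<close> in \<open>lbr_skew\<close>;
  \<open>exp_shift\<close> expands the shifted parameter, and the powers of \<open>a + b\<close>
  become powers of \<open>tD\<close>.\<close>

lemma Phi_fnprod_skew:
  fixes x y :: "'f::field_char_0 tmat"
  assumes i: "i < 2" and N: "\<And>n. n \<ge> N \<Longrightarrow> fnprod k i y n x = 0" 
    "\<And>n. n \<ge> N \<Longrightarrow> fnprod k i x n y = 0" "n < N"
    "\<And>l a b. (\<Sum>n<N. mat_scale (l ^ n / fact n) (Phi (fnprod k i x n y) a b)) = lbr k (dlt i 0) (Phi x) (Phi y) l a b"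
    "\<And>l a b. (\<Sum>n<N. mat_scale (l ^ n / fact n) (Phi (fnprod k i y n x) a b)) = lbr k (dlt i 0) (Phi y) (Phi x) l a b"
  shows "fnprod k i x n y = (\<Sum>j<N. tscale ((- 1) ^ (n + j + 1) / fact j) ((tD ^^ j) (fnprod k i y (n + j) x)))"
proof (rule Phi_inject)
  fix a b
  have D: "Phi ((tD ^^ j) z) a b = mat_scale ((a + b) ^ j) (Phi z a b)" for j and z :: "'f tmat"
    by (induction j) (simp_all add: Phi_D mat_scale_scale, simp add: mat_scale_def)
  have "(\<Sum>n<N. mat_scale (l ^ n / fact n) (Phi (fnprod k i x n y) a b))
     = (\<Sum>n<N. mat_scale (l ^ n / fact n) (\<Sum>j<N. mat_scale ((- 1) ^ (n + j + 1) / fact j) (mat_scale ((a + b) ^ j) (Phi (fnprod k i y (n + j) x) a b))))" for l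
  proof -
    have "(\<Sum>n<N. mat_scale (l ^ n / fact n) (Phi (fnprod k i x n y) a b))
      = mat_scale (- 1) (\<Sum>n<N. mat_scale ((- l - (a + b)) ^ n / fact n) (Phi (fnprod k i y n x) a b))"
      unfolding N(4,5) by (rule lbr_skew[OF dlt_le_1])
    also have "(\<Sum>n<N. mat_scale ((- l - (a + b)) ^ n / fact n) (Phi (fnprod k i y n x) a b))
       = (\<Sum>n<N. \<Sum>j<N. mat_scale ((- l) ^ n / fact n * ((- (a + b)) ^ j / fact j)) (Phi (fnprod k i y (n + j) x) a b))"
      by (subst exp_shift) (simp_all only: N(1) Phi_zero diff_conv_add_uminus)
    also have "mat_scale (- 1) \<dots> = (\<Sum>n<N. \<Sum>j<N. mat_scale (l ^ n / fact n) (mat_scale ((- 1) ^ (n + j + 1) / fact j) (mat_scale ((a + b) ^ j) (Phi (fnprod k i y (n + j) x) a b))))"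
      unfolding mat_scale_sum mat_scale_scale
      by (intro sum.cong refl arg_cong2[where f = mat_scale])
        (simp only: power_minus[of l] power_minus[of "a + b"], simp add: power_add)
    finally show ?thesis
      by (simp only: mat_scale_sum)
  qed
  then have "Phi (fnprod k i x n y) a b
    = (\<Sum>j<N. mat_scale ((- 1) ^ (n + j + 1) / fact j) (mat_scale ((a + b) ^ j) (Phi (fnprod k i y (n + j) x) a b)))"
    by (rule mat_coeffs_eq) (rule N(3))
  then show "Phi (fnprod k i x n y) a b
    = Phi (\<Sum>j<N. tscale ((- 1) ^ (n + j + 1) / fact j) ((tD ^^ j) (fnprod k i y (n + j) x))) a b"
    by (simp only: Phi_sum Phi_scale D)
qed

section \<open>From the bracket identities back to the Jacobi identity for products\<close>

lemma mat_mul_sum_right: "mat_mul k u (\<Sum>n\<in>A. f n) = (\<Sum>n\<in>A. mat_mul k u (f n))"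
  by (induction A rule: infinite_finite_induct) (simp_all add: mat_mul_add_right)

lemma mat_mul_sum_left: "mat_mul k (\<Sum>n\<in>A. f n) u = (\<Sum>n\<in>A. mat_mul k (f n) u)"
  by (induction A rule: infinite_finite_induct) (simp_all add: mat_mul_add_left)

lemma lbr_sum_right:
  fixes F :: "'f::field_char_0 \<Rightarrow> 'f \<Rightarrow> 'f fmat" and A :: "'b set"
  shows "lbr k e F (\<lambda>a b. \<Sum>n\<in>A. mat_scale (c n) (G n a b)) l a b = (\<Sum>n\<in>A. mat_scale (c n) (lbr k e F (G n) l a b))"
  and lbr_sum_left:
  "lbr k e (\<lambda>a b. \<Sum>n\<in>A. mat_scale (c n) (G n a b)) F l a b = (\<Sum>n\<in>A. mat_scale (c n) (lbr k e (G n) F l a b))"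
proof -
  show "lbr k e F (\<lambda>a b. \<Sum>n\<in>A. mat_scale (c n) (G n a b)) l a b = (\<Sum>n\<in>A. mat_scale (c n) (lbr k e F (G n) l a b))"
    "lbr k e (\<lambda>a b. \<Sum>n\<in>A. mat_scale (c n) (G n a b)) F l a b = (\<Sum>n\<in>A. mat_scale (c n) (lbr k e (G n) F l a b))"
    unfolding lbr_def mat_mul_sum_left mat_mul_sum_right mat_mul_scale_left mat_mul_scale_right mat_scale_diff sum_subtractf mat_scale_sum mat_scale_scale
    by (simp_all add: mult_ac)
qed

text \<open>Quantifying over all \<open>M\<close> above \<open>N\<close> makes the bound monotone,
  so several bounds can be merged by taking any larger number.\<close>

definition gen_bound :: "nat \<Rightarrow> nat \<Rightarrow> 'f::field_char_0 tmat \<Rightarrow> 'f tmat \<Rightarrow> nat \<Rightarrow> bool" where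
  "gen_bound k i x y N \<longleftrightarrow> (\<forall>M\<ge>N. fnprod k i x M y = 0 \<and>
    (\<forall>l a b. (\<Sum>n<M. mat_scale (l ^ n / fact n) (Phi (fnprod k i x n y) a b))
      = lbr k (dlt i 0) (Phi x) (Phi y) l a b))"

lemma gen_bound_zero: "gen_bound k i x y N \<Longrightarrow> n \<ge> N \<Longrightarrow> fnprod k i x n y = 0"
  by (simp add: gen_bound_def)

lemma gen_bound_mono: "gen_bound k i x y N \<Longrightarrow> N \<le> M \<Longrightarrow> gen_bound k i x y M"
  by (auto simp: gen_bound_def)

lemma gen_bound_ex: "i < 2 \<Longrightarrow> \<exists>N. gen_bound k i x y N"
  using eventually_conj[OF eventually_fnprod_zero lbr_generating]
  unfolding gen_bound_def eventually_sequentially by blast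

text \<open>A nested product has an inner product as argument, one for each inner index. Only
  finitely many of these are nonzero, so a single bound serves them all; where an argument is zero,
  every bound works.\<close>

lemma gen_bound_family:
  fixes N1 :: nat
  assumes "i < 2" and "\<And>n. n \<ge> N1 \<Longrightarrow> f n = 0 \<or> g n = 0"
  shows "\<exists>N. \<forall>n. gen_bound k i (f n) (g n) N"
proof -
  have "\<exists>N. \<forall>n<M. gen_bound k i (f n) (g n) N" for M
  proof (induction M)
    case (Suc M)
    then obtain N where N: "\<forall>n<M. gen_bound k i (f n) (g n) N" by blast
    obtain N' where N': "gen_bound k i (f M) (g M) N'"
      using gen_bound_ex[OF assms(1)] by blast
    show ?case
      by (rule exI[of _ "max N N'"]) (use N N' in \<open>auto simp: less_Suc_eq intro: gen_bound_mono\<close>)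
  qed simp
  then obtain N where N: "\<forall>n<N1. gen_bound k i (f n) (g n) N" by blast
  have "gen_bound k i (f n) (g n) N" for n
    using N assms(2)[of n] by (cases "n < N1") (auto simp: gen_bound_def lbr_def)
  then show ?thesis by blast
qed

lemma fnprod_jacobi:
  fixes x y z :: "'f::field_char_0 tmat"
  assumes i: "i < 2"
  shows "fnprod k i x m (fnprod k i y n z) - fnprod k i y n (fnprod k i x m z)
    = (\<Sum>c\<le>m. tscale (of_nat (m choose c)) (fnprod k i (fnprod k i x (m - c) y) (n + c) z))"
proof -
  define e where "e = dlt i 0"
  obtain Na where Na: "gen_bound k i y z Na" using gen_bound_ex[OF i] by blast
  obtain Nb where Nb: "gen_bound k i x z Nb" using gen_bound_ex[OF i] by blast
  obtain Nc where Nc: "gen_bound k i x y Nc" using gen_bound_ex[OF i] by blast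
  define N1 where "N1 = Na + Nb + Nc"
  have 1: "gen_bound k i y z N1" "gen_bound k i x z N1" "gen_bound k i x y N1"
    by (rule gen_bound_mono[OF Na], simp add: N1_def, rule gen_bound_mono[OF Nb], simp add: N1_def,
        rule gen_bound_mono[OF Nc], simp add: N1_def)
  have "\<exists>N. \<forall>n. gen_bound k i x (fnprod k i y n z) N"
    by (rule gen_bound_family[OF i, of N1]) (simp add: gen_bound_zero[OF 1(1)])
  then obtain N2 where 2: "\<And>n. gen_bound k i x (fnprod k i y n z) N2" by blast
  have "\<exists>N. \<forall>n. gen_bound k i y (fnprod k i x n z) N"
    by (rule gen_bound_family[OF i, of N1]) (simp add: gen_bound_zero[OF 1(2)])
  then obtain N3 where 3: "\<And>n. gen_bound k i y (fnprod k i x n z) N3" by blast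
  have "\<exists>N. \<forall>n. gen_bound k i (fnprod k i x n y) z N"
    by (rule gen_bound_family[OF i, of N1]) (simp add: gen_bound_zero[OF 1(3)])
  then obtain N4 where 4: "\<And>n. gen_bound k i (fnprod k i x n y) z N4" by blast
  define N where "N = N1 + N2 + N3 + N4 + m + n + 1"
  \<comment> \<open>Doubling ensures that a pair of indices with sum at least \<open>K\<close> has a
    member at least \<open>N\<close>, and such terms vanish.\<close>
  define K where "K = 2 * N"
  have le: "N1 \<le> N" "N2 \<le> N" "N3 \<le> N" "N4 \<le> N" "m < K" "n < K" "N \<le> K"
    by (auto simp: N_def K_def)
  have gen: "(\<Sum>n<K. mat_scale (l ^ n / fact n) (Phi (fnprod k i u n v) a b)) = lbr k e (Phi u) (Phi v) l a b"
    and zero: "\<And>n. n \<ge> N \<Longrightarrow> fnprod k i u n v = 0"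
    if "gen_bound k i u v N" for u v :: "'f tmat" and l a b :: 'f
    using that le(7) unfolding gen_bound_def e_def by auto
  have B: "gen_bound k i y z N" "gen_bound k i x z N" "gen_bound k i x y N"
     "gen_bound k i x (fnprod k i y n z) N" "gen_bound k i y (fnprod k i x n z) N"
     "gen_bound k i (fnprod k i x n y) z N" for n
    by (rule gen_bound_mono[OF _ le(1)] gen_bound_mono[OF _ le(2)] gen_bound_mono[OF _ le(3)] gen_bound_mono[OF _ le(4)], rule 1 2 3 4)+
  define g where "g = (\<lambda>a b i' l. Phi (fnprod k i (fnprod k i x i' y) l z) a b)"
  have g0: "g a b i' l = 0" if "i' \<ge> N \<or> l \<ge> N" for a b i' l
    using that zero[OF B(3)] zero[OF B(6)] by (auto simp: g_def)
  have L1: "(\<Sum>m<K. mat_scale (l ^ m / fact m) (\<Sum>n<K. mat_scale (c ^ n / fact n) (Phi (fnprod k i x m (fnprod k i y n z)) a b)))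
      = lbr k e (Phi x) (lbr k e (Phi y) (Phi z) c) l a b" for l c a b
  proof -
    \<comment> \<open>The outer factor is summed first: the bracket with \<open>x\<close> is taken
      for each inner product separately, and only then is the inner sum collected. Hence the
      exchange of summations.\<close>
    have "(\<Sum>m<K. mat_scale (l ^ m / fact m) (\<Sum>n<K. mat_scale (c ^ n / fact n) (Phi (fnprod k i x m (fnprod k i y n z)) a b)))
      = (\<Sum>n<K. mat_scale (c ^ n / fact n) (\<Sum>m<K. mat_scale (l ^ m / fact m) (Phi (fnprod k i x m (fnprod k i y n z)) a b)))"
      unfolding mat_scale_sum mat_scale_scale by (subst sum.swap) (simp only: mult.commute)
    also have "\<dots> = lbr k e (Phi x) (lbr k e (Phi y) (Phi z) c) l a b"
      unfolding gen[OF B(4)] lbr_sum_right[symmetric] gen[OF B(1)] ..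
    finally show ?thesis .
  qed
  have L2: "(\<Sum>m<K. mat_scale (l ^ m / fact m) (\<Sum>n<K. mat_scale (c ^ n / fact n) (Phi (fnprod k i y n (fnprod k i x m z)) a b)))
      = lbr k e (Phi y) (lbr k e (Phi x) (Phi z) l) c a b" for l c a b
    unfolding gen[OF B(5)] lbr_sum_right[symmetric] gen[OF B(2)] ..
  have R: "(\<Sum>m<K. mat_scale (l ^ m / fact m) (\<Sum>n<K. mat_scale (c ^ n / fact n) (\<Sum>j\<le>m. mat_scale (of_nat (m choose j)) (g a b (m - j) (n + j)))))
      = lbr k e (lbr k e (Phi x) (Phi y) l) (Phi z) (l + c) a b" for l c a b
  proof -
    \<comment> \<open>The binomial coefficient distributes the power \<open>l ^ m\<close> over the
      two indices \<open>m - j\<close> and \<open>j\<close>. The second part then merges with the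
      powers of \<open>c\<close> to produce the parameter \<open>l + c\<close>.\<close>
    define F where "F = (\<lambda>i' j. mat_scale (l ^ i' / fact i' * (l ^ j / fact j)) (\<Sum>n<K. mat_scale (c ^ n / fact n) (g a b i' (n + j))))"
    have "mat_scale (l ^ m / fact m) (\<Sum>n<K. mat_scale (c ^ n / fact n) (\<Sum>j\<le>m. mat_scale (of_nat (m choose j)) (g a b (m - j) (n + j))))
       = (\<Sum>j\<le>m. F (m - j) j)" for m
    proof -
      have "mat_scale (l ^ m / fact m) (\<Sum>n<K. mat_scale (c ^ n / fact n) (\<Sum>j\<le>m. mat_scale (of_nat (m choose j)) (g a b (m - j) (n + j))))
        = (\<Sum>j\<le>m. mat_scale (l ^ m / fact m * of_nat (m choose j)) (\<Sum>n<K. mat_scale (c ^ n / fact n) (g a b (m - j) (n + j))))"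
        unfolding mat_scale_sum mat_scale_scale by (subst sum.swap) (simp only: mult_ac)
      also have "\<dots> = (\<Sum>j\<le>m. F (m - j) j)"
      proof (rule sum.cong)
        fix j assume "j \<in> {..m}"
        then have "l ^ m / fact m * of_nat (m choose j) = l ^ (m - j) / fact (m - j) * (l ^ j / fact j)"
          by (simp add: binomial_fact power_add[symmetric])
        then show "mat_scale (l ^ m / fact m * of_nat (m choose j)) (\<Sum>n<K. mat_scale (c ^ n / fact n) (g a b (m - j) (n + j))) = F (m - j) j"
          by (simp only: F_def)
      qed simp
      finally show ?thesis .
    qed
    then have "(\<Sum>m<K. mat_scale (l ^ m / fact m) (\<Sum>n<K. mat_scale (c ^ n / fact n) (\<Sum>j\<le>m. mat_scale (of_nat (m choose j)) (g a b (m - j) (n + j)))))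
      = (\<Sum>m<K. \<Sum>j\<le>m. F (m - j) j)" by simp
    also have "\<dots> = (\<Sum>(m, j)\<in>(SIGMA m:{..<K}. {..m}). F (m - j) j)"
      by (rule sum.Sigma) auto
    also have "\<dots> = (\<Sum>(i', j)\<in>{..<K} \<times> {..<K}. F i' j)"
    proof (rule sum.reindex_bij_witness_not_neutral[where S' = "{}" and T' = "{(i', j)\<in>{..<K} \<times> {..<K}. i' + j \<ge> K}"
          and i = "\<lambda>(i', j). (i' + j, j)" and j = "\<lambda>(m, j). (m - j, j)"])
      fix p assume p: "p \<in> {(i', j)\<in>{..<K} \<times> {..<K}. i' + j \<ge> K}"
      obtain i' j where "p = (i', j)" by fastforce
      moreover have "i' \<ge> N \<or> j \<ge> N"
        using p calculation by (auto simp: K_def)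
      ultimately show "(case p of (i', j) \<Rightarrow> F i' j) = 0"
        by (auto simp: F_def g0)
    qed (auto intro: finite_subset[of _ "{..<K} \<times> {..<K}"])
    also have "\<dots> = (\<Sum>i'<K. \<Sum>j<K. F i' j)"
      by (rule sum.cartesian_product[symmetric])
    also have "\<dots> = (\<Sum>i'<K. mat_scale (l ^ i' / fact i') (\<Sum>j<K. \<Sum>n<K. mat_scale (l ^ j / fact j * (c ^ n / fact n)) (g a b i' (j + n))))"
      unfolding F_def mat_scale_sum mat_scale_scale by (simp only: mult.assoc add.commute)
    also have "\<dots> = (\<Sum>i'<K. mat_scale (l ^ i' / fact i') (\<Sum>n<K. mat_scale ((l + c) ^ n / fact n) (g a b i' n)))"
      by (subst exp_shift) (use g0 le in auto)
    also have "\<dots> = lbr k e (lbr k e (Phi x) (Phi y) l) (Phi z) (l + c) a b"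
      unfolding g_def gen[OF B(6)] lbr_sum_left[symmetric] gen[OF B(3)] ..
    finally show ?thesis .
  qed
  show ?thesis
  proof (rule Phi_inject)
    fix a b
    define A where "A = (\<lambda>m n. Phi (fnprod k i x m (fnprod k i y n z)) a b - Phi (fnprod k i y n (fnprod k i x m z)) a b)"
    define C where "C = (\<lambda>m n. \<Sum>j\<le>m. mat_scale (of_nat (m choose j)) (g a b (m - j) (n + j)))"
    have "(\<Sum>m<K. mat_scale (l ^ m / fact m) (\<Sum>n<K. mat_scale (c ^ n / fact n) (A m n)))
       = (\<Sum>m<K. mat_scale (l ^ m / fact m) (\<Sum>n<K. mat_scale (c ^ n / fact n) (C m n)))" for l c
      unfolding A_def C_def mat_scale_diff sum_subtractf L1 L2 R e_def by (rule lbr_jacobi[OF dlt_le_1])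
    then have "(\<Sum>n<K. mat_scale (c ^ n / fact n) (A m n)) = (\<Sum>n<K. mat_scale (c ^ n / fact n) (C m n))" for c
      by (rule mat_coeffs_eq) (rule le)
    then have "A m n = C m n"
      by (rule mat_coeffs_eq) (rule le)
    then show "Phi (fnprod k i x m (fnprod k i y n z) - fnprod k i y n (fnprod k i x m z)) a b
      = Phi (\<Sum>c\<le>m. tscale (of_nat (m choose c)) (fnprod k i (fnprod k i x (m - c) y) (n + c) z)) a b"
      by (simp add: A_def C_def g_def Phi_diff Phi_sum Phi_scale)
  qed
qed

section \<open>Translating products into the residue form of the axioms\<close>

lemma gbinomial_neg_one: "((- 1) gchoose n) = ((- 1) ^ n :: 'f::field_char_0)"
  using gbinomial_minus[of "1 :: 'f" n] binomial_gbinomial[of n n, where ?'a = 'f] by simp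

lemma neg_one_powi: "(- 1 :: 'f::field) powi (- int m - 1) = (- 1) ^ (m + 1)"
proof -
  have "(- 1 :: 'f) powi (- int m - 1) = (- 1) powi (- int (m + 1))"
    by (rule arg_cong[where f = "\<lambda>x. (- 1) powi x"]) simp
  also have "\<dots> = inverse ((- 1) ^ (m + 1))"
    by (simp only: power_int_minus power_int_of_nat)
  also have "\<dots> = (- 1) ^ (m + 1)"
    by (simp add: power_inverse[symmetric])
  finally show ?thesis .
qed

text \<open>All coefficients of the expanded inverse of \<open>z - x\<close> are 1, so the residue
  merely discards the nonnegative powers.\<close>

lemma res1_neg: "res1 tscale f (- int n - 1) = f (- int n - 1)"
proof -
  have "res1 tscale f (- int n - 1)
      = (\<Sum>d\<in>{int n}. tscale (binexp (- 1) (- int n - 1) d) (f (- 1 - d)))"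
    unfolding res1_def by (rule Sum_any.expand_superset) (auto simp: binexp_def)
  also have "\<dots> = f (- 1 - int n)"
    by (simp add: binexp_def gbinomial_neg_one flip: power_mult_distrib)
  also have "- 1 - int n = - int n - 1" by simp
  finally show ?thesis .
qed

lemma binexp_nonneg: "a \<ge> 0 \<Longrightarrow> binexp (- 1) a d = 0"
  by (auto simp: binexp_def)

lemma res1_nonneg: "a \<ge> 0 \<Longrightarrow> res1 tscale f a = 0"
  unfolding res1_def by (simp add: binexp_nonneg)

lemma tD_funpow_scale: "(tD ^^ j) (tscale c x) = tscale c ((tD ^^ j) x)"
  by (induction j) (simp_all add: tD_scale)

lemma tD_funpow_zero [simp]: "(tD ^^ j) 0 = 0"
  by (induction j) simp_all

lemma tY_skew_symmetry:
  assumes i: "i < 2"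
  shows "tY k i x y a = res1 tscale (fd_exp tscale tD (fd_neg tscale (tY k i y x))) a"
proof (cases a rule: int_exponent_cases)
  case nonneg
  then show ?thesis
    by (simp add: tY_nonneg res1_nonneg)
next
  case (neg n)
  obtain N1 where 1: "gen_bound k i x y N1" using gen_bound_ex[OF i] by blast
  obtain N2 where 2: "gen_bound k i y x N2" using gen_bound_ex[OF i] by blast
  define N where "N = N1 + N2 + n + 1"
  have B: "gen_bound k i x y N" "gen_bound k i y x N"
    by (rule gen_bound_mono[OF 1] gen_bound_mono[OF 2]; simp add: N_def)+
  have e: "- int n - 1 - int j = - int (n + j) - 1" for j by simp
  have "res1 tscale (fd_exp tscale tD (fd_neg tscale (tY k i y x))) a
     = Sum_any (\<lambda>j. tscale ((- 1) ^ (n + j + 1) / fact j) ((tD ^^ j) (fnprod k i y (n + j) x)))"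
    unfolding neg res1_neg fd_exp_def fd_neg_def e neg_one_powi tD_funpow_scale tmat.scale_scale
    by (simp add: fnprod_def)
  also have "\<dots> = (\<Sum>j<N. tscale ((- 1) ^ (n + j + 1) / fact j) ((tD ^^ j) (fnprod k i y (n + j) x)))"
  proof (rule Sum_any.expand_superset)
    show "{j. tscale ((- 1) ^ (n + j + 1) / fact j) ((tD ^^ j) (fnprod k i y (n + j) x)) \<noteq> 0} \<subseteq> {..<N}"
    proof
      fix j assume "j \<in> {j. tscale ((- 1) ^ (n + j + 1) / fact j) ((tD ^^ j) (fnprod k i y (n + j) x)) \<noteq> 0}"
      then show "j \<in> {..<N}"
        using gen_bound_zero[OF B(2), of "n + j"] by (cases "j < N") auto
    qed
  qed simp
  also have "\<dots> = fnprod k i x n y"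
    by (rule Phi_fnprod_skew[symmetric, OF i])
      (use B in \<open>auto simp: gen_bound_def N_def\<close>)
  finally show ?thesis
    by (simp add: neg fnprod_def)
qed

lemma tY_commutator:
  assumes i: "i < 2"
  shows "tY k i x (tY k i y z b) a - tY k i y (tY k i x z a) b = res2 tscale (\<lambda>n. tY k i (tY k i x y n) z) a b"
proof (cases "a \<ge> 0 \<or> b \<ge> 0")
  case True
  \<comment> \<open>If \<open>b\<close> is nonnegative the second binomial factor vanishes. If
    \<open>a\<close> is nonnegative, the first one forces \<open>n = a + c\<close>, which is
    nonnegative, and there the inner product is zero.\<close>
  have "tscale (binexp n a c * binexp (- 1) b d) (tY k i (tY k i x y n) z (- 1 - c - d)) = 0" for n c d
  proof (cases "b \<ge> 0")
    case True
    then show ?thesis by (simp add: binexp_nonneg)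
  next
    case False
    with True show ?thesis
      by (cases "n \<ge> 0") (auto simp: binexp_def tY_nonneg)
  qed
  then have "(\<lambda>(n, c, d). tscale (binexp n a c * binexp (- 1) b d) (tY k i (tY k i x y n) z (- 1 - c - d))) = (\<lambda>_. 0)"
    by (simp only: fun_eq_iff split_paired_all prod.case) simp
  then have "res2 tscale (\<lambda>n. tY k i (tY k i x y n) z) a b = 0"
    by (simp only: res2_def Sum_any.neutral)
  moreover have "tY k i x (tY k i y z b) a - tY k i y (tY k i x z a) b = 0"
    using True by (auto simp: tY_nonneg)
  ultimately show ?thesis by simp
next
  case False
  then obtain m n where mn: "a = - int m - 1" "b = - int n - 1"
    by (metis int_exponent_cases)
  define T where "T = (\<lambda>(n', c, d). tscale (binexp n' a c * binexp (- 1) b d) (tY k i (tY k i x y n') z (- 1 - c - d)))"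
  have "res2 tscale (\<lambda>n. tY k i (tY k i x y n) z) a b = Sum_any T"
    by (simp add: res2_def T_def)
  \<comment> \<open>The binomial factors force \<open>d = n\<close> and tie the exponent to
    \<open>a + c\<close>; this exponent must be negative, which bounds \<open>c\<close> by
    \<open>m\<close>.\<close>
  also have "\<dots> = (\<Sum>p\<in>(\<lambda>c. (a + int c, int c, int n)) ` {..m}. T p)"
  proof (rule Sum_any.expand_superset)
    show "{p. T p \<noteq> 0} \<subseteq> (\<lambda>c. (a + int c, int c, int n)) ` {..m}"
    proof
      fix p assume "p \<in> {p. T p \<noteq> 0}"
      then obtain n' c d where p: "p = (n', c, d)" and nz: "T (n', c, d) \<noteq> 0"
        by (cases p) auto
      from nz have "tY k i (tY k i x y n') z (- 1 - c - d) \<noteq> 0" "binexp n' a c \<noteq> (0 :: 'a)" "binexp (- 1) b d \<noteq> (0 :: 'a)"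
        by (auto simp: T_def)
      then have "n' < 0" "c \<ge> 0" "a + c = n'" "d = int n"
        using tY_nonneg[of n' k i x y] by (auto simp: binexp_def mn not_le split: if_splits) (metis not_le tY_zero(1))
      then have "p = (a + int (nat c), int (nat c), int n) \<and> nat c \<in> {..m}"
        by (auto simp: p mn)
      then show "p \<in> (\<lambda>c. (a + int c, int c, int n)) ` {..m}" by blast
    qed
  qed simp
  also have "\<dots> = (\<Sum>c\<le>m. T (a + int c, int c, int n))"
    by (subst sum.reindex) (auto simp: inj_on_def)
  also have "\<dots> = (\<Sum>c\<le>m. tscale (of_nat (m choose c)) (fnprod k i (fnprod k i x (m - c) y) (n + c) z))"
  proof (rule sum.cong)
    fix c assume c: "c \<in> {..m}"
    have "(of_int (a + int c) :: 'a) = - of_nat (m - c + 1)"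
      using c by (simp add: mn of_nat_diff)
    then have "(of_int (a + int c) gchoose c) = ((- 1) ^ c * ((of_nat (m - c + 1) + of_nat c - 1) gchoose c) :: 'a)"
      by (simp only: gbinomial_minus)
    also have "(of_nat (m - c + 1) + of_nat c - 1 :: 'a) = of_nat m"
      using c by (simp add: of_nat_diff)
    finally have "(of_int (a + int c) gchoose c) = ((- 1) ^ c * of_nat (m choose c) :: 'a)"
      by (simp only: binomial_gbinomial)
    then have "binexp (a + int c) a (int c) = (of_nat (m choose c) :: 'a)"
      by (simp add: binexp_def flip: power_mult_distrib mult.assoc)
    moreover have "binexp (- 1) b (int n) = (1 :: 'a)"
      by (simp add: binexp_def mn gbinomial_neg_one flip: power_mult_distrib)
    moreover have "a + int c = - int (m - c) - 1" "- 1 - int c - int n = - int (n + c) - 1"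
      using c by (auto simp: mn)
    ultimately show "T (a + int c, int c, int n) = tscale (of_nat (m choose c)) (fnprod k i (fnprod k i x (m - c) y) (n + c) z)"
      by (simp only: T_def fnprod_def prod.case mult_1_right)
  qed simp
  also have "\<dots> = tY k i x (tY k i y z b) a - tY k i y (tY k i x z a) b"
    unfolding fnprod_jacobi[OF i, symmetric] by (simp add: mn fnprod_def)
  finally show ?thesis by simp
qed

lemma tY_translation:
  assumes i: "i < 2"
  shows "tY k i (tD x) y = fd_deriv tscale (tY k i x y)"
proof
  fix m
  obtain N1 where 1: "gen_bound k i x y N1" using gen_bound_ex[OF i] by blast
  obtain N2 where 2: "gen_bound k i (tD x) y N2" using gen_bound_ex[OF i] by blast
  show "tY k i (tD x) y m = fd_deriv tscale (tY k i x y) m"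
  proof (cases m rule: int_exponent_cases)
    case nonneg
    then show ?thesis by (simp add: fd_deriv_def tY_nonneg)
  next
    case (neg n)
    define N where "N = N1 + N2 + n"
    have B: "gen_bound k i x y N" "gen_bound k i (tD x) y (Suc N)"
      by (rule gen_bound_mono[OF 1] gen_bound_mono[OF 2]; simp add: N_def)+
    \<comment> \<open>For \<open>n = 0\<close> the truncated \<open>n - 1\<close> is harmless
      because its coefficient is zero.\<close>
    have "fnprod k i (tD x) n y = tscale (- of_nat n) (fnprod k i x (n - 1) y)"
    proof (rule Phi_inject)
      fix a b
      have "(\<Sum>n<Suc N. mat_scale (l ^ n / fact n) (Phi (fnprod k i (tD x) n y) a b))
        = (\<Sum>n<Suc N. mat_scale (l ^ n / fact n) (mat_scale (- of_nat n) (Phi (fnprod k i x (n - 1) y) a b)))" for l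
      proof -
        have "(\<Sum>n<Suc N. mat_scale (l ^ n / fact n) (Phi (fnprod k i (tD x) n y) a b))
          = lbr k (dlt i 0) (Phi (tD x)) (Phi y) l a b"
          using B(2) unfolding gen_bound_def by blast
        \<comment> \<open>The arguments of the first factor are \<open>a, - a - l\<close> or
          \<open>- b - l, b\<close>; in both cases they add up to \<open>- l\<close>. This shifts
          the power of \<open>l\<close> by one, whence the bound \<open>Suc N\<close>.\<close>
        also have "\<dots> = mat_scale (- l) (lbr k (dlt i 0) (Phi x) (Phi y) l a b)"
          unfolding lbr_def Phi_D mat_mul_scale_left mat_mul_scale_right mat_scale_diff mat_scale_scale
          by (simp add: mult_ac)
        also have "lbr k (dlt i 0) (Phi x) (Phi y) l a b = (\<Sum>n<N. mat_scale (l ^ n / fact n) (Phi (fnprod k i x n y) a b))"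
          using B(1) by (simp add: gen_bound_def)
        also have "mat_scale (- l) \<dots> = (\<Sum>n<N. mat_scale (l ^ Suc n / fact (Suc n)) (mat_scale (- of_nat (Suc n)) (Phi (fnprod k i x n y) a b)))"
        proof -
          have "- l * (l ^ n / fact n) = l ^ Suc n / fact (Suc n) * - of_nat (Suc n)" for n
            by (simp add: field_simps del: of_nat_Suc)
          then show ?thesis
            by (simp only: mat_scale_sum mat_scale_scale)
        qed
        also have "\<dots> = (\<Sum>n<Suc N. mat_scale (l ^ n / fact n) (mat_scale (- of_nat n) (Phi (fnprod k i x (n - 1) y) a b)))"
        proof -
          have "mat_scale (l ^ 0 / fact 0) (mat_scale (- of_nat 0) u) = 0" for u :: "'a fmat"
            by (simp add: mat_scale_def fun_eq_iff zero_fun_apply)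
          then show ?thesis
            by (subst sum.lessThan_Suc_shift) (simp only: diff_Suc_1 add_0)
        qed
        finally show ?thesis .
      qed
      then have "Phi (fnprod k i (tD x) n y) a b = mat_scale (- of_nat n) (Phi (fnprod k i x (n - 1) y) a b)"
        by (rule mat_coeffs_eq) (simp add: N_def)
      then show "Phi (fnprod k i (tD x) n y) a b = Phi (tscale (- of_nat n) (fnprod k i x (n - 1) y)) a b"
        by (simp only: Phi_scale)
    qed
    then have Y: "tY k i (tD x) y m = tscale (- of_nat n) (tY k i x y (- int (n - 1) - 1))"
      by (simp only: neg fnprod_def)
    have c: "of_int (m + 1) = (- of_nat n :: 'a)"
      by (simp add: neg)
    show ?thesis
    proof (cases "n = 0")
      case True
      then show ?thesis unfolding Y fd_deriv_def c by simp
    next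
      case False
      then have "m + 1 = - int (n - 1) - 1" by (simp add: neg)
      then show ?thesis unfolding Y fd_deriv_def c by (simp only:)
    qed
  qed
qed

lemma tY_finite:
  assumes i: "i < 2"
  shows "finite {a. tY k i x y a \<noteq> 0}"
proof -
  obtain N where N: "gen_bound k i x y N" using gen_bound_ex[OF i] by blast
  have "{a. tY k i x y a \<noteq> 0} \<subseteq> {- int N - 1..0}"
  proof
    fix a assume "a \<in> {a. tY k i x y a \<noteq> 0}"
    then have a: "tY k i x y a \<noteq> 0" by simp
    show "a \<in> {- int N - 1..0}"
    proof (cases a rule: int_exponent_cases)
      case nonneg
      with a show ?thesis by (simp add: tY_nonneg)
    next
      case (neg n)
      with a gen_bound_zero[OF N, of n] have "n < N"
        by (force simp: fnprod_def)
      with neg show ?thesis by simp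
    qed
  qed
  then show ?thesis
    by (rule finite_subset) simp
qed

lemma tmat_conformal_algebra:
  fixes R :: "'f::field_char_0 tmat set"
  assumes i: "i < 2" and R: "tmat.subspace R" and D: "\<And>x. x \<in> R \<Longrightarrow> tD x \<in> R"
    and Y: "\<And>x y a. x \<in> R \<Longrightarrow> y \<in> R \<Longrightarrow> tY k i x y a \<in> R"
  shows "conformal_algebra tscale R tD (tY k i)"
proof -
  have sp: "super_space R {0} = R"
    by (auto simp: super_space_def)
  have zero: "0 \<in> R"
    using R by (rule tmat.subspace_0)
  \<comment> \<open>The sign can differ from 1 only when both indices are odd, and the odd part is
    zero.\<close>
  have sgn: "(- 1 :: 'f) ^ (j * l) = 1 \<or> x = 0 \<and> y = 0"
    if "x \<in> super_part R {0} j" "y \<in> super_part R {0} l" for x y j l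
    using that by (auto simp: super_part_def split: if_splits)
  show ?thesis
    unfolding conformal_algebra_def
  proof (unfold_locales, unfold sp)
    show "tmat.subspace R" by (rule R)
    show "tmat.subspace {0}" by (rule tmat.subspace_single_0)
    show "R \<inter> {0} = {0}" using zero by auto
    show "linear_on_subspace tscale R tD"
      by (simp add: linear_on_subspace_def tD_add tD_scale)
    show "tD u \<in> super_part R {0} j" if "u \<in> super_part R {0} j" for u j
      using that D by (auto simp: super_part_def split: if_splits)
    show "linear_on_subspace tscale R (\<lambda>u. tY k i u v a)" for v a
      by (simp add: linear_on_subspace_def tY_add_left tY_scale_left i)
    show "linear_on_subspace tscale R (\<lambda>v. tY k i u v a)" for u a
      by (simp add: linear_on_subspace_def tY_add_right tY_scale_right i)
    show "tY k i u v a \<in> super_part R {0} (j + l)"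
      if "u \<in> super_part R {0} j" "v \<in> super_part R {0} l" for u v a j l
      using that Y zero by (auto simp: super_part_def split: if_splits)
    show "tY k i u v a = 0" if "a \<ge> 0" for u v a
      using that by (rule tY_nonneg)
    show "finite {a. tY k i u v a \<noteq> 0}" for u v
      by (rule tY_finite[OF i])
    show "tY k i (tD u) v = fd_deriv tscale (tY k i u v)" for u v
      by (rule tY_translation[OF i])
    show "tY k i u v a = tscale ((- 1) ^ (j * l)) (res1 tscale (fd_exp tscale tD (fd_neg tscale (tY k i v u))) a)"
      if "u \<in> super_part R {0} j" "v \<in> super_part R {0} l" for u v a j l
      using sgn[OF that] by (auto simp flip: tY_skew_symmetry[OF i])
    show "tY k i u (tY k i v w b) a - tscale ((- 1) ^ (j * l)) (tY k i v (tY k i u w a) b)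
        = res2 tscale (\<lambda>n. tY k i (tY k i u v n) w) a b"
      if "u \<in> super_part R {0} j" "v \<in> super_part R {0} l" for u v w a b j l
      using sgn[OF that] by (auto simp: tY_commutator[OF i, symmetric])
  qed
qed

section \<open>The involution and the algebras of its fixed points\<close>

definition idx :: "nat \<Rightarrow> nat set" where
  "idx k = {1..k}"

lemma finite_idx [simp]: "finite (idx k)"
  by (simp add: idx_def)

definition star :: "nat \<Rightarrow> nat \<Rightarrow> nat" where
  "star k1 p = (if p \<le> k1 then k1 + p else p - k1)"

definition eps :: "nat \<Rightarrow> nat \<Rightarrow> 'f::field_char_0" where
  "eps k1 p = (if p \<le> k1 then 1 else - 1)"

lemma eps_square [simp]: "eps k1 p * eps k1 p = 1" "eps k1 p * (eps k1 p * x) = x"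
  by (simp_all add: eps_def)

text \<open>
  \<open>sigma\<close> is the anti-automorphism \<open>\<sigma>\<^sub>2\<close>: \<open>\<sigma>\<^sub>2(E\<^bsub>p,q\<^esub>) = \<epsilon>\<^sub>p \<epsilon>\<^sub>q E\<^bsub>q*,p*\<^esub>\<close> with \<open>p* = p \<plusminus> k\<^sub>1\<close> and \<open>\<epsilon>\<^sub>p = \<plusminus>1\<close>.
\<close>

definition sigma :: "nat \<Rightarrow> nat \<Rightarrow> 'f::field_char_0 fmat \<Rightarrow> 'f fmat" where
  "sigma k1 k u = (\<lambda>p q. if p \<in> idx k \<and> q \<in> idx k then eps k1 p * eps k1 q * u (star k1 q) (star k1 p) else 0)"

text \<open>One formula for the three spanning families of both algebras: the product of the two
  \<open>eps\<close> values is \<open>-1\<close> exactly in the off-diagonal blocks, and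
  \<open>sgn1\<close> distinguishes the two algebras.\<close>

definition Telt :: "nat \<Rightarrow> nat \<Rightarrow> nat \<Rightarrow> nat \<Rightarrow> nat \<Rightarrow> nat \<Rightarrow> 'f::field_char_0 tmat" where
  "Telt k1 i p q m n = elt (mat_unit p q) m n
     - tscale (sgn1 (dlt i 0) * (eps k1 p * eps k1 q)) (elt (mat_unit (star k1 q) (star k1 p)) n m)"

text \<open>The equation also confines all matrix coefficients to the \<open>k \<times> k\<close>
  block, because \<open>sigma\<close> is zero outside it.\<close>

definition Rdag :: "nat \<Rightarrow> nat \<Rightarrow> nat \<Rightarrow> 'f::field_char_0 tmat set" where
  "Rdag k1 k i = {x. \<forall>m n. Poly_Mapping.lookup x (n, m)
      = mat_scale (- sgn1 (dlt i 0)) (sigma k1 k (Poly_Mapping.lookup x (m, n)))}"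

lemma mat_scale_one: "mat_scale 1 u = u"
  by (simp add: mat_scale_def)

lemma sigma_add: "sigma k1 k (u + v) = sigma k1 k u + sigma k1 k v"
  and sigma_scale: "sigma k1 k (mat_scale c u) = mat_scale c (sigma k1 k u)"
  and sigma_zero [simp]: "sigma k1 k 0 = 0"
  by (simp_all add: sigma_def mat_scale_def fun_eq_iff plus_fun_apply minus_apply zero_fun_apply algebra_simps)

lemma sigma_sum: "sigma k1 k (\<Sum>j\<in>A. f j) = (\<Sum>j\<in>A. sigma k1 k (f j))"
  by (induction A rule: infinite_finite_induct) (simp_all add: sigma_add)

lemma elt_sum: "elt (\<Sum>j\<in>A. f j) m n = (\<Sum>j\<in>A. elt (f j) m n)"
  by (induction A rule: infinite_finite_induct) (simp_all add: elt_add)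

lemma lookup_minus_tmat: "Poly_Mapping.lookup (x - y) mn = Poly_Mapping.lookup x mn - Poly_Mapping.lookup y mn"
  for x y :: "'f::field tmat"
  by (metis add_diff_cancel_right' diff_add_cancel lookup_add)

lemma fnprod_diff:
  assumes "i < 2"
  shows "fnprod k i (x - x') n y = fnprod k i x n y - fnprod k i x' n y"
    and "fnprod k i x n (y - y') = fnprod k i x n y - fnprod k i x n y'"
proof -
  show "fnprod k i (x - x') n y = fnprod k i x n y - fnprod k i x' n y"
    using fnprod_linear(1)[OF assms, of k "x - x'" x' n y] by simp
  show "fnprod k i x n (y - y') = fnprod k i x n y - fnprod k i x n y'"
    using fnprod_linear(2)[OF assms, of k x n "y - y'" y'] by simp
qed

lemma mat_decompose:
  fixes u :: "'f::field fmat"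
  assumes "\<And>p q. p \<notin> idx k \<or> q \<notin> idx k \<Longrightarrow> u p q = 0"
  shows "u = (\<Sum>p\<in>idx k. \<Sum>q\<in>idx k. mat_scale (u p q) (mat_unit p q))"
proof (intro HOL.ext)
  fix a b
  have "(\<Sum>p\<in>idx k. \<Sum>q\<in>idx k. mat_scale (u p q) (mat_unit p q)) a b
      = (\<Sum>p\<in>idx k. \<Sum>q\<in>idx k. if q = b then if p = a then u a b else 0 else 0)"
    unfolding sum_fun_apply by (intro sum.cong refl) (auto simp: mat_scale_def mat_unit_def)
  also have "\<dots> = u a b"
    using assms[of a b] by (cases "a \<in> idx k"; cases "b \<in> idx k") auto
  finally show "u a b = (\<Sum>p\<in>idx k. \<Sum>q\<in>idx k. mat_scale (u p q) (mat_unit p q)) a b" ..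
qed

lemma Rdag_subspace: "tmat.subspace (Rdag k1 k i)"
proof (rule tmat.subspaceI)
  show "0 \<in> Rdag k1 k i"
    by (simp add: Rdag_def)
next
  fix x y :: "'a tmat"
  assume xy: "x \<in> Rdag k1 k i" "y \<in> Rdag k1 k i"
  have "Poly_Mapping.lookup (x + y) (n, m)
      = mat_scale (- sgn1 (dlt i 0)) (sigma k1 k (Poly_Mapping.lookup (x + y) (m, n)))" for m n
    using xy[unfolded Rdag_def mem_Collect_eq, rule_format, of n m]
    by (simp only: lookup_add sigma_add mat_scale_add)
  then show "x + y \<in> Rdag k1 k i"
    unfolding Rdag_def mem_Collect_eq by blast
next
  fix c :: 'a and x :: "'a tmat"
  assume x: "x \<in> Rdag k1 k i"
  have "Poly_Mapping.lookup (tscale c x) (n, m)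
      = mat_scale (- sgn1 (dlt i 0)) (sigma k1 k (Poly_Mapping.lookup (tscale c x) (m, n)))" for m n
    using x[unfolded Rdag_def mem_Collect_eq, rule_format, of n m]
    by (simp only: lookup_tscale_mat sigma_scale mat_scale_scale mult.commute)
  then show "tscale c x \<in> Rdag k1 k i"
    unfolding Rdag_def mem_Collect_eq by blast
qed

text \<open>Treats both algebras at once: \<open>i = 1\<close> gives exponent \<open>e = 0\<close>
  and sign 1, while \<open>i = 0\<close> gives \<open>e = 1\<close> and sign \<open>-1\<close>. The
  involution is the adjoint for the standard alternating form, which explains the name.\<close>

locale symplectic =
  fixes k1 k i :: nat
  assumes k1: "k1 > 0" and k: "k = 2 * k1" and i: "i < 2"
begin

abbreviation T where "T \<equiv> Telt k1 i"
abbreviation st where "st \<equiv> star k1"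
abbreviation e where "e \<equiv> dlt i 0"
abbreviation prd where "prd \<equiv> fnprod k i"
abbreviation R where "R \<equiv> Rdag k1 k i"

lemma e_le: "e \<le> 1"
  by (rule dlt_le_1)

lemma star_in [simp, intro]: "p \<in> idx k \<Longrightarrow> st p \<in> idx k"
  using k by (auto simp: star_def idx_def)

lemma star_star [simp]: "p \<in> idx k \<Longrightarrow> st (st p) = p"
  using k by (auto simp: star_def idx_def)

lemma star_neq [simp]: "p \<in> idx k \<Longrightarrow> st p \<noteq> p" "p \<in> idx k \<Longrightarrow> p \<noteq> st p"
  using k1 by (auto simp: star_def idx_def)

lemma eps_star: "p \<in> idx k \<Longrightarrow> eps k1 (st p) = - eps k1 p"
  using k k1 by (auto simp: star_def eps_def idx_def)

lemma star_inj: "p \<in> idx k \<Longrightarrow> q \<in> idx k \<Longrightarrow> st p = st q \<longleftrightarrow> p = q"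
  by (metis star_star)

lemma star_eq: "p \<in> idx k \<Longrightarrow> q \<in> idx k \<Longrightarrow> st p = q \<longleftrightarrow> p = st q"
  by (metis star_star)

lemma sigma_unit:
  assumes "p \<in> idx k" "q \<in> idx k"
  shows "sigma k1 k (mat_unit p q) = mat_scale (eps k1 p * eps k1 q) (mat_unit (st q) (st p))"
proof (intro HOL.ext)
  fix a b
  show "sigma k1 k (mat_unit p q) a b = mat_scale (eps k1 p * eps k1 q) (mat_unit (st q) (st p)) a b"
  proof (cases "a \<in> idx k \<and> b \<in> idx k")
    case True
    then have "st b = p \<longleftrightarrow> b = st p" "st a = q \<longleftrightarrow> a = st q"
      using star_eq assms by blast+
    then have "sigma k1 k (mat_unit p q) a b = (if b = st p \<and> a = st q then eps k1 a * eps k1 b else 0)"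
      using True by (simp add: sigma_def mat_unit_def)
    also have "\<dots> = mat_scale (eps k1 p * eps k1 q) (mat_unit (st q) (st p)) a b"
      using assms by (simp add: mat_scale_def mat_unit_def eps_star mult.commute)
    finally show ?thesis .
  next
    case False
    then have "\<not> (a = st q \<and> b = st p)"
      using star_in assms by blast
    then show ?thesis
      using False by (auto simp: sigma_def mat_scale_def mat_unit_def)
  qed
qed

lemma T_alt: "p \<in> idx k \<Longrightarrow> q \<in> idx k \<Longrightarrow>
    T p q m n = elt (mat_unit p q) m n + elt (mat_scale (- sgn1 e) (sigma k1 k (mat_unit p q))) n m"
  by (simp add: Telt_def sigma_unit mat_scale_scale tscale_elt[symmetric])

lemma sigma_sigma_unit: "p \<in> idx k \<Longrightarrow> q \<in> idx k \<Longrightarrow> sigma k1 k (sigma k1 k (mat_unit p q)) = mat_unit p q"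
  by (simp add: sigma_unit sigma_scale eps_star mat_scale_scale mat_scale_one mult_ac)

lemma T_in: 
  assumes "p \<in> idx k" "q \<in> idx k"
  shows "T p q m n \<in> (R :: 'f::field_char_0 tmat set)"
proof -
  have *: "mat_scale (- sgn1 e) (mat_scale (- sgn1 e) u) = (u :: 'f fmat)" for u
    by (simp add: mat_scale_scale mat_scale_one)
  define u :: "'f fmat" where "u = mat_unit p q"
  define v where "v = mat_scale (- sgn1 e) (sigma k1 k u)"
  have T: "T p q m n = elt u m n + elt v n m"
    unfolding T_alt[OF assms] u_def v_def ..
  have v: "mat_scale (- sgn1 e) (sigma k1 k v) = u"
    by (simp only: v_def sigma_scale u_def sigma_sigma_unit[OF assms] *)
  have "Poly_Mapping.lookup (T p q m n :: 'f tmat) (b, a)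
      = mat_scale (- sgn1 e) (sigma k1 k (Poly_Mapping.lookup (T p q m n :: 'f tmat) (a, b)))" for a b
  proof -
    define f where "f = (\<lambda>w. mat_scale (- sgn1 e) (sigma k1 k (w :: 'f fmat)))"
    have f: "f (w + w') = f w + f w'" "f 0 = 0" "f u = v" "f v = u" for w w'
      using v by (simp_all add: f_def sigma_add mat_scale_add v_def)
    have 1: "f (if a = m \<and> b = n then u else 0) = (if b = n \<and> a = m then v else 0)"
      by (simp only: f(2,3) if_distrib[of f] conj_commute)
    have 2: "f (if a = n \<and> b = m then v else 0) = (if b = m \<and> a = n then u else 0)"
      by (simp only: f(2,4) if_distrib[of f] conj_commute)
    have "Poly_Mapping.lookup (T p q m n :: 'f tmat) (b, a) = f (Poly_Mapping.lookup (T p q m n :: 'f tmat) (a, b))"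
      unfolding T lookup_add lookup_elt f(1) 1 2 by (rule add.commute)
    then show ?thesis by (simp only: f_def)
  qed
  then show ?thesis
    unfolding Rdag_def mem_Collect_eq by blast
qed

text \<open>The symmetry defining the fixed space is an involution, so mirror labels describe the
  same element up to a sign.\<close>

lemma T_star:
  assumes "p \<in> idx k" "q \<in> idx k"
  shows "T (st q) (st p) n m = tscale (- sgn1 e * (eps k1 p * eps k1 q)) (T p q m n)"
  using assms by (simp add: Telt_def eps_star tmat.scale_right_diff_distrib mult_ac)

text \<open>The set of exponents is kept in the statement so that the same argument yields spanning
  sets of the weight spaces.\<close>

lemma R_span_keys:
  assumes x: "x \<in> R"
  shows "x \<in> tmat.span {T p q m n | p q m n. p \<in> idx k \<and> q \<in> idx k \<and> (m, n) \<in> Poly_Mapping.keys x}"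
    (is "x \<in> tmat.span ?B")
proof -
  let ?l = "Poly_Mapping.lookup x"
  have l: "?l (n, m) = mat_scale (- sgn1 e) (sigma k1 k (?l (m, n)))" for m n
    using x unfolding Rdag_def mem_Collect_eq by blast
  have supp: "?l (m, n) p q = 0" if "p \<notin> idx k \<or> q \<notin> idx k" for m n p q
    using that by (subst l) (auto simp: mat_scale_def sigma_def)
  have swap: "(m, n) \<in> Poly_Mapping.keys x \<longleftrightarrow> (n, m) \<in> Poly_Mapping.keys x" for m n
  proof -
    have "?l (n, m) = 0" if "?l (m, n) = 0" for m n
      using that by (subst l) simp
    then show ?thesis by (auto simp: in_keys_iff)
  qed
  have T: "(\<Sum>p\<in>idx k. \<Sum>q\<in>idx k. tscale (?l (m, n) p q) (T p q m n)) = elt (?l (m, n)) m n + elt (?l (n, m)) n m" for m n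
  proof -
    have dec: "?l (m, n) = (\<Sum>p\<in>idx k. \<Sum>q\<in>idx k. mat_scale (?l (m, n) p q) (mat_unit p q))"
      by (rule mat_decompose) (rule supp)
    have "(\<Sum>p\<in>idx k. \<Sum>q\<in>idx k. tscale (?l (m, n) p q) (T p q m n))
      = (\<Sum>p\<in>idx k. \<Sum>q\<in>idx k. elt (mat_scale (?l (m, n) p q) (mat_unit p q)) m n
          + elt (mat_scale (- sgn1 e) (sigma k1 k (mat_scale (?l (m, n) p q) (mat_unit p q)))) n m)"
      by (intro sum.cong refl)
        (simp add: T_alt tmat.scale_right_distrib tscale_elt sigma_scale mat_scale_scale mult.commute)
    also have "\<dots> = elt (\<Sum>p\<in>idx k. \<Sum>q\<in>idx k. mat_scale (?l (m, n) p q) (mat_unit p q)) m n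
        + elt (mat_scale (- sgn1 e) (sigma k1 k (\<Sum>p\<in>idx k. \<Sum>q\<in>idx k. mat_scale (?l (m, n) p q) (mat_unit p q)))) n m"
      by (simp only: elt_sum sigma_sum mat_scale_sum sum.distrib)
    finally show ?thesis
      unfolding dec[symmetric] l[symmetric] .
  qed
  \<comment> \<open>Each exponent contributes its own coefficient and, by the symmetry of
    \<open>x\<close>, that of its mirror image. The total is twice \<open>x\<close>, and
    characteristic 0 allows halving.\<close>
  have "(\<Sum>(m, n)\<in>Poly_Mapping.keys x. \<Sum>p\<in>idx k. \<Sum>q\<in>idx k. tscale (?l (m, n) p q) (T p q m n))
     = (\<Sum>(m, n)\<in>Poly_Mapping.keys x. elt (?l (m, n)) m n) + (\<Sum>(m, n)\<in>Poly_Mapping.keys x. elt (?l (n, m)) n m)"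
    unfolding T by (simp add: sum.distrib case_prod_beta)
  also have "(\<Sum>(m, n)\<in>Poly_Mapping.keys x. elt (?l (n, m)) n m) = (\<Sum>(m, n)\<in>Poly_Mapping.keys x. elt (?l (m, n)) m n)"
    by (rule sum.reindex_bij_witness[where i = prod.swap and j = prod.swap]) (auto simp: swap)
  also have "(\<Sum>(m, n)\<in>Poly_Mapping.keys x. elt (?l (m, n)) m n) + (\<Sum>(m, n)\<in>Poly_Mapping.keys x. elt (?l (m, n)) m n) = tscale 2 x"
    unfolding tmat_sum_elt[symmetric] by (rule tmat_eqI) (simp add: lookup_add lookup_tscale plus_fun_apply)
  finally have sum: "(\<Sum>(m, n)\<in>Poly_Mapping.keys x. \<Sum>p\<in>idx k. \<Sum>q\<in>idx k. tscale (?l (m, n) p q) (T p q m n)) = tscale 2 x" .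
  have "(\<Sum>p\<in>idx k. \<Sum>q\<in>idx k. tscale (?l (m, n) p q) (T p q m n)) \<in> tmat.span ?B"
    if "(m, n) \<in> Poly_Mapping.keys x" for m n
    by (intro tmat.span_sum tmat.span_scale tmat.span_base) (use that in blast)
  then have "(\<Sum>(m, n)\<in>Poly_Mapping.keys x. \<Sum>p\<in>idx k. \<Sum>q\<in>idx k. tscale (?l (m, n) p q) (T p q m n)) \<in> tmat.span ?B"
    by (intro tmat.span_sum) auto
  then have "tscale 2 x \<in> tmat.span ?B"
    unfolding sum .
  then have "tscale (1 / 2) (tscale 2 x) \<in> tmat.span ?B"
    by (rule tmat.span_scale)
  then show ?thesis by simp
qed

lemma R_eq_span: "R = tmat.span {T p q m n | p q m n. p \<in> idx k \<and> q \<in> idx k}"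
proof
  show "R \<subseteq> tmat.span {T p q m n | p q m n. p \<in> idx k \<and> q \<in> idx k}"
  proof
    fix x assume "x \<in> R"
    from R_span_keys[OF this] show "x \<in> tmat.span {T p q m n | p q m n. p \<in> idx k \<and> q \<in> idx k}"
      by (rule rev_subsetD) (intro tmat.span_mono, blast)
  qed
  show "tmat.span {T p q m n | p q m n. p \<in> idx k \<and> q \<in> idx k} \<subseteq> R"
    by (rule tmat.span_minimal[OF _ Rdag_subspace]) (use T_in in blast)
qed

lemma tD_T: "tD (T p q m n) = tscale (of_nat (m + 1)) (T p q (m + 1) n) + tscale (of_nat (n + 1)) (T p q m (n + 1))"
proof -
  have *: "tD (x - y) = tD x - tD y" for x y :: "'a tmat"
    using tD_add[of "x - y" y] by simp
  show ?thesis
    unfolding Telt_def * tD_scale tD_elt tmat.scale_right_distrib tmat.scale_right_diff_distrib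
    by (simp only: tmat.scale_scale mult.commute) (simp only: diff_conv_add_uminus add_ac minus_add)
qed

text \<open>Two summands in each factor and two terms in each product give eight monomials; these
  pair up under the mirror symmetry, leaving four elements \<open>T\<close>.\<close>

lemma prd_T:
  assumes pq: "p \<in> idx k" "q \<in> idx k" "r \<in> idx k" "t \<in> idx k"
  shows "prd (T p q m1 m2) n (T r t n1 n2) =
      (if q = r then tscale (lcoef e m1 m2 n1 n) (T p t (m1 + m2 + n1 + e - n) n2) else 0)
    - (if q = st t then tscale (sgn1 e * (eps k1 r * eps k1 t) * lcoef e m1 m2 n2 n) (T p (st r) (m1 + m2 + n2 + e - n) n1) else 0)
    - (if st p = r then tscale (sgn1 e * (eps k1 p * eps k1 q) * lcoef e m2 m1 n1 n) (T (st q) t (m1 + m2 + n1 + e - n) n2) else 0)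
    - (if p = t then tscale (sgn1 e * lcoef e m2 m1 n2 n) (T r q n1 (m1 + m2 + n2 + e - n)) else 0)"
proof -
  have c: "t = st q \<longleftrightarrow> q = st t" "st r = p \<longleftrightarrow> st p = r" "st p = st t \<longleftrightarrow> p = t" "st r = st q \<longleftrightarrow> q = r" "t = p \<longleftrightarrow> p = t"
    using pq star_inj star_star by auto
  note mm = mat_mul_unit[where k = k, folded idx_def]
  note mms = mm[OF pq(2)] mm[OF pq(4)] mm[OF star_in[OF pq(1)]] mm[OF star_in[OF pq(3)]]
  show ?thesis
    unfolding Telt_def fnprod_diff[OF i] fnprod_linear[OF i] fnprod_elt[OF i] mms c
    using pq by (cases "q = r"; cases "q = st t"; cases "st p = r"; cases "p = t")
      (auto simp: tmat.scale_right_diff_distrib tmat.scale_right_distrib eps_star star_inj algebra_simps)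
qed

end

section \<open>Structure constants of low degree and closure under the products\<close>

lemma lcoef_00: "lcoef e 0 0 n1 n = (if n \<le> n1 + e then of_nat (n1 * e + 1) else 0)"
  by (simp add: lcoef_def)

lemma lcoef_10: "lcoef e 1 0 n1 n = (if n \<le> 1 + n1 + e then of_nat (n1 * e + 1) * of_nat (1 + n1 + e - n) else 0)"
  by (simp add: lcoef_def)

lemma lcoef_01: "lcoef e 0 1 n1 n = (if n \<le> 1 + n1 + e then - (of_nat (n1 * e + 1) * of_nat (1 + n1 + e)) else 0)"
  by (simp add: lcoef_def algebra_simps)

lemma lcoef_20: "lcoef e 2 0 n1 n = (if n \<le> 2 + n1 + e then of_nat (n1 * e + 1) * of_nat ((2 + n1 + e - n) choose 2) else 0)"
  by (simp add: lcoef_def)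

lemma lcoef_11: "lcoef e 1 1 n1 n = (if n \<le> 2 + n1 + e then - (of_nat (n1 * e + 1) * of_nat (1 + n1 + e) * of_nat (2 + n1 + e - n)) else 0)"
  by (simp add: lcoef_def algebra_simps)

lemma subspace_scale_cancel:
  "tmat.subspace W \<Longrightarrow> c \<noteq> 0 \<Longrightarrow> tscale c x \<in> W \<longleftrightarrow> x \<in> W"
  using tmat.subspace_scale[of W x c] tmat.subspace_scale[of W "tscale c x" "inverse c"] by auto

lemma subspace_add_cancel:
  "tmat.subspace W \<Longrightarrow> x \<in> W \<Longrightarrow> x + y \<in> W \<longleftrightarrow> y \<in> W"
  using tmat.subspace_add[of W x y] tmat.subspace_diff[of W "x + y" x] by auto

lemma mat_mul_unit_entry:
  assumes "q \<in> idx k"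
  shows "mat_mul k (mat_unit p q) v a b = (if a = p then v q b else 0)"
proof -
  have "(\<Sum>r = 1..k. mat_unit p q a r * v r b) = (\<Sum>r = 1..k. if r = q then if a = p then v q b else 0 else 0)"
    by (rule sum.cong) (auto simp: mat_unit_def)
  then show ?thesis
    using assms by (simp add: mat_mul_def idx_def)
qed

context symplectic
begin

lemma prd_R:
  assumes "x \<in> R" "y \<in> R"
  shows "prd x n y \<in> R"
proof -
  let ?S = "{T p q m n | p q m n. p \<in> idx k \<and> q \<in> idx k} :: 'a tmat set"
  note sub = Rdag_subspace[of k1 k i]
  have TT: "prd (T p q m1 m2) n (T r t n1 n2) \<in> R"
    if "p \<in> idx k" "q \<in> idx k" "r \<in> idx k" "t \<in> idx k" for p q r t m1 m2 n1 n2
    unfolding prd_T[OF that]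
    using that by (intro tmat.subspace_diff[OF sub]) (auto intro!: tmat.subspace_scale[OF sub] T_in tmat.subspace_0[OF sub])
  have Ty: "prd u n y \<in> R" if "u \<in> ?S" "y \<in> tmat.span ?S" for u y
    using that(2)
  proof (induction rule: tmat.span_induct_alt)
    case base
    then show ?case by (simp add: tmat.subspace_0[OF sub])
  next
    case (step c v y)
    then have "prd u n v \<in> R"
      using TT that(1) by blast
    with step show ?case
      by (simp add: fnprod_linear i tmat.subspace_add[OF sub] tmat.subspace_scale[OF sub])
  qed
  have "x \<in> tmat.span ?S"
    using assms(1) R_eq_span by blast
  then show ?thesis
  proof (induction rule: tmat.span_induct_alt)
    case base
    then show ?case by (simp add: tmat.subspace_0[OF sub])
  next
    case (step c u x)
    then have "prd u n y \<in> R"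
      using Ty assms(2) R_eq_span by blast
    with step show ?case
      by (simp add: fnprod_linear i tmat.subspace_add[OF sub] tmat.subspace_scale[OF sub])
  qed
qed

lemma tY_R: "x \<in> R \<Longrightarrow> y \<in> R \<Longrightarrow> tY k i x y a \<in> R"
  using prd_R[of x y] tmat.subspace_0[OF Rdag_subspace]
  by (cases a rule: int_exponent_cases) (auto simp: tY_nonneg fnprod_def)

lemma tD_R:
  assumes "x \<in> R"
  shows "tD x \<in> R"
proof -
  note sub = Rdag_subspace[of k1 k i]
  have "x \<in> tmat.span {T p q m n | p q m n. p \<in> idx k \<and> q \<in> idx k}"
    using assms R_eq_span by blast
  then show ?thesis
  proof (induction rule: tmat.span_induct_alt)
    case base
    then show ?case by (simp add: tmat.subspace_0[OF sub])
  next
    case (step c u x)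
    then have "tD u \<in> R"
      by (auto simp: tD_T intro!: tmat.subspace_add[OF sub] tmat.subspace_scale[OF sub] T_in)
    with step show ?case
      by (simp add: tD_add tD_scale tmat.subspace_add[OF sub] tmat.subspace_scale[OF sub])
  qed
qed

lemma R_conformal: "conformal_algebra tscale R tD (tY k i)"
  by (rule tmat_conformal_algebra[OF i Rdag_subspace tD_R tY_R])

text \<open>At \<open>l = 0\<close> only the summand \<open>n = 0\<close> of the generating identity
  survives.\<close>

lemma Phi_prd0:
  "Phi (prd x 0 y) a b = mat_scale (a ^ e) (mat_mul k (Phi x a (- a)) (Phi y a b))
    - mat_scale (sgn1 e * b ^ e) (mat_mul k (Phi y a b) (Phi x (- b) b))"
proof -
  obtain N where N: "gen_bound k i x y N" using gen_bound_ex[OF i] by blast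
  have "(\<Sum>n<Suc N. mat_scale (0 ^ n / fact n) (Phi (prd x n y) a b)) = lbr k e (Phi x) (Phi y) 0 a b"
    using N le_SucI[OF order.refl[of N]] unfolding gen_bound_def by blast
  moreover have "(\<Sum>n<Suc N. mat_scale (0 ^ n / fact n) (Phi (prd x n y) a b)) = Phi (prd x 0 y) a b"
    by (subst sum.lessThan_Suc_shift) (simp add: mat_scale_def flip: zero_fun_def)
  ultimately show ?thesis
    by (simp add: lbr_def)
qed

lemma Phi_T:
  assumes "p \<in> idx k" "q \<in> idx k"
  shows "Phi (T p q m n) a b = mat_scale (a ^ m / fact m * (b ^ n / fact n)) (mat_unit p q)
    - mat_scale (sgn1 e * (eps k1 p * eps k1 q) * (a ^ n / fact n * (b ^ m / fact m))) (mat_unit (st q) (st p))"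
  by (simp add: Telt_def Phi_diff Phi_scale Phi_elt mat_scale_scale)

text \<open>Solves the exponent relation for the source: exponent \<open>a\<close> of the result
  comes from \<open>a + n - (m1 + m2 + e)\<close> in \<open>y\<close>. The guards keep truncated
  subtraction from producing a false source at 0.\<close>

lemma lookup_prd_elt:
  "Poly_Mapping.lookup (prd (elt u m1 m2) n y) (a, b) =
     (if m1 + m2 + e \<le> a + n then mat_scale (lcoef e m1 m2 (a + n - (m1 + m2 + e)) n)
        (mat_mul k u (Poly_Mapping.lookup y (a + n - (m1 + m2 + e), b))) else 0)
   - (if m1 + m2 + e \<le> b + n then mat_scale (sgn1 e * lcoef e m2 m1 (b + n - (m1 + m2 + e)) n)
        (mat_mul k (Poly_Mapping.lookup y (a, b + n - (m1 + m2 + e))) u) else 0)"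
proof (induction y rule: tmat_induct)
  case (elt v n1 n2)
  have 1: "Poly_Mapping.lookup (tscale (lcoef e m1 m2 n1 n) (elt w (m1 + m2 + n1 + e - n) n2)) (a, b)
    = (if m1 + m2 + e \<le> a + n then if a + n - (m1 + m2 + e) = n1 \<and> b = n2 then mat_scale (lcoef e m1 m2 n1 n) w else 0 else 0)" for w
    by (auto simp: lookup_tscale_mat lookup_elt lcoef_def mat_scale_def fun_eq_iff zero_fun_apply)
  have 2: "Poly_Mapping.lookup (tscale (sgn1 e * lcoef e m2 m1 n2 n) (elt w n1 (m1 + m2 + n2 + e - n))) (a, b)
    = (if m1 + m2 + e \<le> b + n then if a = n1 \<and> b + n - (m1 + m2 + e) = n2 then mat_scale (sgn1 e * lcoef e m2 m1 n2 n) w else 0 else 0)" for w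
    by (auto simp: lookup_tscale_mat lookup_elt lcoef_def mat_scale_def fun_eq_iff zero_fun_apply)
  show ?case
    unfolding fnprod_elt[OF i] lookup_minus_tmat 1 2 lookup_elt
    by (auto simp: add_ac)
next
  case (add x y)
  then show ?case
    by (simp add: fnprod_linear i lookup_add mat_mul_add_left mat_mul_add_right mat_scale_add)
qed simp

end

section \<open>Simplicity\<close>

lemma mat_scale_apply: "mat_scale c u p q = c * u p q"
  by (simp add: mat_scale_def)

lemma mat_unit_apply: "mat_unit p q a b = (if a = p \<and> b = q then 1 else 0)"
  by (simp add: mat_unit_def)

lemma mat_mul_unit_entry_right:
  assumes "p \<in> idx k"
  shows "mat_mul k v (mat_unit p q) a b = (if b = q then v a p else 0)"
proof -
  have "(\<Sum>r = 1..k. v a r * mat_unit p q r b) = (\<Sum>r = 1..k. if r = p then if b = q then v a p else 0 else 0)"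
    by (rule sum.cong) (auto simp: mat_unit_def)
  then show ?thesis
    using assms by (simp add: mat_mul_def idx_def)
qed

context symplectic
begin

lemma R_support:
  assumes "x \<in> R" "p \<notin> idx k \<or> q \<notin> idx k"
  shows "Poly_Mapping.lookup x (m, n) p q = 0"
proof -
  have "Poly_Mapping.lookup x (m, n) = mat_scale (- sgn1 e) (sigma k1 k (Poly_Mapping.lookup x (n, m)))"
    using assms(1) unfolding Rdag_def mem_Collect_eq by blast
  then show ?thesis
    using assms(2) by (auto simp: mat_scale_def sigma_def)
qed

lemma R_swap_entry:
  assumes "x \<in> R" "p \<in> idx k"
  shows "Poly_Mapping.lookup x (m, n) p (st p) = sgn1 e * Poly_Mapping.lookup x (n, m) p (st p)"
proof -
  have "Poly_Mapping.lookup x (m, n) = mat_scale (- sgn1 e) (sigma k1 k (Poly_Mapping.lookup x (n, m)))"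
    using assms(1) unfolding Rdag_def mem_Collect_eq by blast
  then show ?thesis
    using assms(2) by (simp add: mat_scale_def sigma_def eps_star)
qed

lemma sgn1_power_e: "(- c) ^ e = sgn1 e * c ^ e"
  by (rule sgn1_power[OF e_le])

text \<open>A nonzero entry at \<open>(p, q)\<close> is moved to \<open>(st q, q)\<close> by a
  suitable \<open>u\<close>. Then the unit \<open>E\<close> at \<open>(q, st q)\<close> is applied
  twice; as \<open>E\<close> squares to zero, only \<open>E v E\<close> remains, which is the entry
  of \<open>v\<close> at \<open>(st q, q)\<close> times \<open>E\<close>.\<close>

lemma ideal_offdiagonal:
  fixes I :: "'f::field_char_0 tmat set"
  assumes IR: "I \<subseteq> R" and act: "\<And>x y n. x \<in> R \<Longrightarrow> y \<in> I \<Longrightarrow> prd x n y \<in> I"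
    and F: "F \<in> I" "F \<noteq> 0"
  shows "\<exists>q\<in>idx k. \<exists>w\<in>I. w \<noteq> 0 \<and> (\<forall>m n. Poly_Mapping.lookup w (m, n)
    = mat_scale (Poly_Mapping.lookup w (m, n) q (st q)) (mat_unit q (st q)))"
proof -
  note sub = Rdag_subspace[of k1 k i]
  obtain m0 n0 p q where nz: "Poly_Mapping.lookup F (m0, n0) p q \<noteq> 0"
    using F(2) tmat_eqI[of F 0] by (auto simp: zero_fun_apply)
  then have p: "p \<in> idx k" and q: "q \<in> idx k"
    using R_support F(1) IR by blast+
  have sq: "st q \<in> idx k" using q by simp
  \<comment> \<open>The excluded values are exactly those at which the multiplier \<open>f\<close>
    chosen next, or the powers of \<open>a\<close> and \<open>b\<close> that appear later, could
    vanish.\<close>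
  have "\<exists>a b. b \<noteq> 0 \<and> a \<notin> {0, b, - b} \<and> Phi F a b p q \<noteq> 0"
    using Phi_entry_eq_0[where B = "{0}" and A = "\<lambda>b. {0, b, - b}" and x = F and p = p and q = q and m = m0 and n = n0] nz
    by auto
  then obtain a b where ab: "b \<noteq> 0" "a \<noteq> 0" "a \<noteq> b" "a \<noteq> - b" and Fab: "Phi F a b p q \<noteq> 0"
    by auto
  \<comment> \<open>The roots at \<open>b\<close> and \<open>- b\<close> annihilate right
    multiplication at the chosen point, where \<open>u\<close> is evaluated at
    \<open>(- b, b)\<close>. The parity equals that of \<open>e\<close>, so that
    \<open>f (- a)\<close> and \<open>f a\<close> differ only by \<open>sgn1 e\<close>.\<close>
  define f where "f = (\<lambda>x :: 'f. x ^ (e + 2) - b\<^sup>2 * x ^ e)"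
  have fb: "f b = 0" "f (- b) = 0"
    by (simp_all add: f_def power_add power2_eq_square)
  have fa: "f (- a) = sgn1 e * f a"
    by (simp add: f_def power_add sgn1_power_e algebra_simps)
  have fa0: "f a \<noteq> 0"
  proof -
    have "f a = a ^ e * ((a - b) * (a + b))"
      by (simp add: f_def power_add power2_eq_square algebra_simps)
    moreover have "a + b \<noteq> 0"
      using ab(4) by (simp add: eq_neg_iff_add_eq_0)
    ultimately show ?thesis using ab by simp
  qed
  define u where "u = tscale (fact (e + 2)) (T (st q) p (e + 2) 0) - tscale (b\<^sup>2 * fact e) (T (st q) p e 0)"
  have uR: "u \<in> R"
    unfolding u_def by (intro tmat.subspace_diff[OF sub] tmat.subspace_scale[OF sub] T_in sq p)
  have Phi_u: "Phi u x y = mat_scale (f x) (mat_unit (st q) p)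
      - mat_scale (sgn1 e * (eps k1 (st q) * eps k1 p) * f y) (mat_unit (st p) q)" for x y
  proof -
    have "fact (e + 2) \<noteq> (0 :: 'f)" "fact e \<noteq> (0 :: 'f)"
      by (rule fact_nonzero)+
    then show ?thesis
      unfolding u_def Phi_diff Phi_scale Phi_T[OF sq p]
      by (intro HOL.ext)
        (simp add: q minus_apply mat_scale_def f_def right_diff_distrib left_diff_distrib mult_ac del: fact_Suc add_2_eq_Suc')
  qed
  define F1 where "F1 = prd u 0 F"
  have F1I: "F1 \<in> I"
    unfolding F1_def by (rule act[OF uR F(1)])
  have F1: "Phi F1 a b (st q) q \<noteq> 0"
  proof -
    have "Phi u (- b) b = 0"
      by (intro HOL.ext) (simp add: Phi_u fb mat_scale_def minus_apply zero_fun_apply)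
    then have "Phi F1 a b = mat_scale (a ^ e) (mat_mul k (Phi u a (- a)) (Phi F a b))"
      unfolding F1_def Phi_prd0 by simp
    then have "Phi F1 a b (st q) q = a ^ e * (f a * Phi F a b p q
        - sgn1 e * (eps k1 (st q) * eps k1 p) * f (- a) * (if st q = st p then Phi F a b q q else 0))"
      by (simp add: Phi_u mat_mul_minus_left mat_mul_scale_left mat_scale_apply minus_apply mat_mul_unit_entry p q)
    \<comment> \<open>When \<open>p = q\<close>, the mirror summand of \<open>u\<close> reaches the
      same entry; the parity of \<open>f\<close> and the sign of \<open>eps\<close> make the two
      contributions add instead of cancel.\<close>
    also have "\<dots> = (if p = q then 2 else 1) * (a ^ e * f a * Phi F a b p q)"
      using p q by (auto simp: star_inj fa eps_star)
    finally show ?thesis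
      using ab fa0 Fab by simp
  qed
  define E :: "'f fmat" where "E = mat_unit q (st q)"
  define x :: "'f tmat" where "x = T q (st q) e 0"
  have xR: "x \<in> R"
    unfolding x_def by (rule T_in[OF q sq])
  have fe: "fact e = (1 :: 'f)"
    using e_le by (cases e) auto
  have Phi_x: "Phi x c d = mat_scale (c ^ e + sgn1 e * d ^ e) E" for c d
    unfolding x_def Phi_T[OF q sq] E_def
    using q by (intro HOL.ext) (simp add: fe eps_star minus_apply mat_scale_def distrib_right)
  have EE: "mat_mul k E E = 0"
    unfolding E_def using q sq by (simp add: mat_mul_unit[of "st q" k, folded idx_def])
  have x0: "Phi (prd x 0 y) c d = mat_scale (2 * c ^ (2 * e)) (mat_mul k E (Phi y c d))
      - mat_scale (2 * d ^ (2 * e)) (mat_mul k (Phi y c d) E)" for y c d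
  proof -
    have "c ^ e + sgn1 e * (- c) ^ e = 2 * c ^ e" "(- d) ^ e + sgn1 e * d ^ e = 2 * sgn1 e * d ^ e"
      by (simp_all add: sgn1_power_e)
    moreover have "c ^ (2 * e) = c ^ e * c ^ e" "d ^ (2 * e) = d ^ e * d ^ e"
      by (simp_all only: mult_2 power_add)
    ultimately show ?thesis
      unfolding Phi_prd0 Phi_x mat_mul_scale_left mat_mul_scale_right mat_scale_scale
      by (simp add: mult_ac)
  qed
  define w where "w = prd x 0 (prd x 0 F1)"
  have wI: "w \<in> I"
    unfolding w_def by (intro act xR F1I)
  have Phi_w: "Phi w c d = mat_scale (- 8 * c ^ (2 * e) * d ^ (2 * e) * Phi F1 c d (st q) q) E" for c d
  proof -
    have "mat_mul k (mat_mul k E E) v = 0" for v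
      by (simp add: EE)
    moreover have "mat_mul k (mat_mul k v E) E = 0" for v
      by (simp add: mat_mul_assoc EE)
    moreover have "mat_mul k (mat_mul k E v) E = mat_scale (v (st q) q) E" for v
      using q sq by (intro HOL.ext) (simp add: E_def mat_mul_unit_entry mat_mul_unit_entry_right mat_scale_apply mat_unit_apply)
    ultimately show ?thesis
      unfolding w_def x0 mat_mul_minus_left mat_mul_minus_right mat_mul_scale_left mat_mul_scale_right
        mat_scale_diff mat_scale_scale mat_mul_assoc[symmetric]
      by (intro HOL.ext) (simp add: mat_scale_apply minus_apply zero_fun_apply)
  qed
  have "w \<noteq> 0"
  proof
    assume "w = 0"
    then have "Phi w a b q (st q) = 0" by (simp add: zero_fun_apply)
    then show False
      using F1 ab by (simp add: Phi_w mat_scale_apply E_def mat_unit_apply)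
  qed
  moreover have "Poly_Mapping.lookup w (m, n) = mat_scale (Poly_Mapping.lookup w (m, n) q (st q)) (mat_unit q (st q))" for m n
  proof (intro HOL.ext)
    fix p' q'
    show "Poly_Mapping.lookup w (m, n) p' q'
        = mat_scale (Poly_Mapping.lookup w (m, n) q (st q)) (mat_unit q (st q)) p' q'"
    proof (cases "p' = q \<and> q' = st q")
      case False
      then have "Poly_Mapping.lookup w (m, n) p' q' = 0"
        by (intro Phi_entry_eq_0[where A = "\<lambda>_. {}" and B = "{}"]) (auto simp: Phi_w mat_scale_apply E_def mat_unit_apply)
      with False show ?thesis by (auto simp: mat_scale_apply mat_unit_apply)
    qed (simp add: mat_scale_apply mat_unit_apply)
  qed
  ultimately show ?thesis
    using q wI by blast
qed

text \<open>The element found in the corner is lowered by two products with one \<open>x\<close> of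
  least degree in the opposite corner. The product indices are taken from extremal exponents, so
  almost all coefficients fall outside the support.\<close>

lemma ideal_primary:
  fixes I :: "'f::field_char_0 tmat set"
  assumes sub: "tmat.subspace I" and IR: "I \<subseteq> R" and act: "\<And>x y n. x \<in> R \<Longrightarrow> y \<in> I \<Longrightarrow> prd x n y \<in> I"
    and F: "F \<in> I" "F \<noteq> 0"
  shows "\<exists>q\<in>idx k. T (st q) q e 0 \<in> I"
proof -
  obtain q w where q: "q \<in> idx k" and wI: "w \<in> I" and w0: "w \<noteq> 0"
    and wE: "\<And>m n. Poly_Mapping.lookup w (m, n) = mat_scale (Poly_Mapping.lookup w (m, n) q (st q)) (mat_unit q (st q))"
    using ideal_offdiagonal[OF IR act F] by blast
  have sq: "st q \<in> idx k" using q by simp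
  define c where "c m n = Poly_Mapping.lookup w (m, n) q (st q)" for m n
  have csym: "c m n = sgn1 e * c n m" for m n
    unfolding c_def by (rule R_swap_entry) (use wI IR q in auto)
  define K where "K = Poly_Mapping.keys w"
  have K: "(m, n) \<in> K \<longleftrightarrow> c m n \<noteq> 0" for m n
  proof -
    have "Poly_Mapping.lookup w (m, n) = 0" if "c m n = 0"
      using that by (subst wE) (simp add: c_def mat_scale_apply fun_eq_iff zero_fun_apply)
    then have "Poly_Mapping.lookup w (m, n) = 0 \<longleftrightarrow> c m n = 0"
      by (auto simp: c_def zero_fun_apply)
    then show ?thesis by (simp add: K_def in_keys_iff)
  qed
  have finK: "finite K" and "K \<noteq> {}"
    using w0 by (simp_all add: K_def)
  define N where "N = Max (fst ` K)"
  have N: "m \<le> N" if "c m n \<noteq> 0" for m n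
    unfolding N_def using that K finK by (intro Max_ge) force+
  have "N \<in> fst ` K"
    unfolding N_def using finK \<open>K \<noteq> {}\<close> by (intro Max_in) auto
  then have ex: "\<exists>j. c N j \<noteq> 0"
    using K by force
  have N': "n \<le> N" if "c m n \<noteq> 0" for m n
    using that csym[of m n] N[of n m] by auto
  \<comment> \<open>\<open>N\<close> is the top exponent of the first variable and, by symmetry,
    also a bound for the second; \<open>M\<close> is the largest partner of \<open>N\<close>, so
    \<open>c N M\<close> is an extremal nonzero coefficient.\<close>
  define M where "M = Max {j. c N j \<noteq> 0}"
  have finM: "finite {j. c N j \<noteq> 0}"
    by (rule finite_subset[of _ "{..N}"]) (auto dest: N')
  have M: "j \<le> M" if "c N j \<noteq> 0" for j
    unfolding M_def using that finM by (intro Max_ge) auto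
  have cNM: "c N M \<noteq> 0"
    using Max_in[OF finM] ex by (auto simp: M_def)
  define E :: "'f fmat" where "E = mat_unit (st q) q"
  define x :: "'f tmat" where "x = T (st q) q e 0"
  have xR: "x \<in> R"
    unfolding x_def by (rule T_in[OF sq q])
  have x: "x = elt E e 0 + tscale (sgn1 e) (elt E 0 e)"
    unfolding x_def E_def Telt_def using q by (simp add: eps_star)
  \<comment> \<open>The two summands of \<open>x\<close> act on a power of one variable through this
    one scalar. Their contributions have the same sign, which gives the nonvanishing in
    \<open>g0\<close>.\<close>
  define g where "g a n = (lcoef e e 0 a n + sgn1 e * lcoef e 0 e a n :: 'f)" for a n
  have g0: "g a n \<noteq> 0" if "n \<le> a + 2 * e" for a n
  proof -
    have "e = 0 \<or> e = 1" using e_le by auto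
    then show ?thesis
    proof
      assume "e = 0"
      then show ?thesis using that by (simp add: g_def lcoef_00 sgn1_def)
    next
      assume "e = 1"
      then have "n \<le> a + 2" using that by simp
      then obtain d where "a + 2 = n + d"
        using le_Suc_ex by blast
      with \<open>e = 1\<close> have "1 + a + e - n = d" "n \<le> 1 + a + e" by auto
      then have "g a n = of_nat ((a + 1) * (d + (2 + a)))"
        using \<open>e = 1\<close> unfolding g_def by (simp only: lcoef_10 lcoef_01) (simp add: sgn1_def algebra_simps)
      also have "\<dots> \<noteq> 0"
        unfolding of_nat_eq_0_iff by simp
      finally show ?thesis .
    qed
  qed
  have lx: "Poly_Mapping.lookup (prd x n y) (a, b) =
     (if 2 * e \<le> a + n then mat_scale (g (a + n - 2 * e) n) (mat_mul k E (Poly_Mapping.lookup y (a + n - 2 * e, b))) else 0)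
   - (if 2 * e \<le> b + n then mat_scale (g (b + n - 2 * e) n) (mat_mul k (Poly_Mapping.lookup y (a, b + n - 2 * e)) E) else 0)"
    for n y a b
  proof -
    have *: "e + 0 + e = 2 * e" "0 + e + e = 2 * e" by simp_all
    show ?thesis
      unfolding x fnprod_linear[OF i] lookup_add lookup_tscale_mat lookup_prd_elt g_def *
      by (intro HOL.ext)
        (auto simp: mat_scale_apply minus_apply plus_fun_apply zero_fun_apply algebra_simps)
  qed
  define E1 E2 :: "'f fmat" where "E1 = mat_unit (st q) (st q)" and "E2 = mat_unit q q"
  have mm: "mat_mul k E (mat_unit q (st q)) = E1" "mat_mul k (mat_unit q (st q)) E = E2"
    "mat_mul k E E1 = 0" "mat_mul k E1 E = E" "mat_mul k E E2 = E" "mat_mul k E2 E = 0"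
    using q sq by (auto simp: E_def E1_def E2_def mat_mul_unit[of _ k, folded idx_def])
  \<comment> \<open>This index shifts the acted-on exponent down by \<open>N\<close>, so only terms
    with exponent 0 in that variable can survive.\<close>
  define z1 where "z1 = prd x (N + 2 * e) w"
  have z1: "Poly_Mapping.lookup z1 (a, b) = mat_scale (g (a + N) (N + 2 * e) * c (a + N) b) E1
     - mat_scale (g (b + N) (N + 2 * e) * c a (b + N)) E2" for a b
    unfolding z1_def lx by (subst (1 2) wE)
      (simp add: mat_mul_scale_left mat_mul_scale_right mm mat_scale_scale c_def)
  \<comment> \<open>The index is \<open>M + e\<close>, not \<open>M + 2 * e\<close>: degree
    \<open>e\<close> has to remain, since for \<open>e = 1\<close> the skew symmetry of the
    coefficients leaves nothing in degree 0.\<close>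
  define z where "z = prd x (M + e) z1"
  have zI: "z \<in> I"
    unfolding z_def z1_def by (intro act xR wI)
  define h where "h a b = - (if e \<le> a + M then g (a + M - e) (M + e) * (g (b + N) (N + 2 * e) * c (a + M - e) (b + N)) else 0)
     - (if e \<le> b + M then g (b + M - e) (M + e) * (g (a + N) (N + 2 * e) * c (a + N) (b + M - e)) else 0)" for a b
  have z: "Poly_Mapping.lookup z (a, b) = mat_scale (h a b) E" for a b
  proof -
    have *: "2 * e \<le> a + (M + e) \<longleftrightarrow> e \<le> a + M" "a + (M + e) - 2 * e = a + M - e" for a
      by auto
    show ?thesis
      unfolding z_def lx * z1 mat_mul_minus_left mat_mul_minus_right mat_mul_scale_left mat_mul_scale_right mm h_def
      by (intro HOL.ext) (simp add: mat_scale_apply minus_apply zero_fun_apply left_diff_distrib mult.assoc)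
  qed
  have hsym: "h b a = sgn1 e * h a b" for a b
  proof -
    have "z \<in> R" using zI IR by blast
    from R_swap_entry[OF this sq, of b a] show ?thesis
      using q by (simp add: z mat_scale_apply E_def mat_unit_apply)
  qed
  have c0: "m > N \<Longrightarrow> c m n = 0" "n > N \<Longrightarrow> c m n = 0" "n > M \<Longrightarrow> c N n = 0" for m n
    using N[of m n] N'[of m n] M[of n] by (force simp: not_le[symmetric])+
  have h0: "h a b = 0" if "a \<noteq> 0" "b \<noteq> 0" for a b
    using that by (simp add: h_def c0)
  have h1: "h 0 b = 0" if "b > e" for b
    using that by (simp add: h_def c0)
  \<comment> \<open>For \<open>e = 0\<close> the two terms agree by symmetry of \<open>c\<close> and
    double; for \<open>e = 1\<close> the first term lies outside the support and the second is a
    multiple of \<open>c N M\<close>.\<close>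
  have he: "h 0 e \<noteq> 0"
  proof (cases "e = 0")
    case True
    have "c M N = c N M" using csym[of M N] by (simp add: True sgn1_def)
    then have "h 0 e = - 2 * (g M M * g N N * c N M)"
      using True by (simp add: h_def g_def lcoef_00 sgn1_def)
    then show ?thesis
      using cNM g0[of M M] g0[of N N] by simp
  next
    case False
    then have "c (M - e) (e + N) = 0"
      by (simp add: c0)
    then have "h 0 e = - (g M (M + e) * (g N (N + 2 * e) * c N M))"
      by (simp add: h_def)
    then show ?thesis
      using cNM g0[of "M + e" M] g0[of "N + 2 * e" N] by simp
  qed
  \<comment> \<open>Only the exponents \<open>(0, e)\<close> and \<open>(e, 0)\<close> are left.
    They coincide when \<open>e = 0\<close>, where \<open>x\<close> is twice a monomial; hence the
    half.\<close>
  have "z = tscale (if e = 0 then h 0 e / 2 else h e 0) x"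
  proof (rule tmat_eqI)
    fix m n p' q'
    have hx: "h m n = (if e = 0 then h 0 e / 2 else h e 0) * ((if m = e \<and> n = 0 then 1 else 0) + sgn1 e * (if m = 0 \<and> n = e then 1 else 0))"
    proof (cases "e = 0")
      case True
      then show ?thesis
        using h0[of m n] h1[of n] h1[of m] hsym[of m 0] by (cases "m = 0"; cases "n = 0") (auto simp: sgn1_def)
    next
      case False
      then have e: "e = 1" using e_le by simp
      have "h 0 0 = 0" using hsym[of 0 0] by (simp add: e sgn1_def eq_neg_iff_add_eq_0)
      moreover have "h 0 (Suc 0) = - h (Suc 0) 0" using hsym[of 0 1] by (simp add: e sgn1_def)
      ultimately show ?thesis
        using e h0[of m n] h1[of n] h1[of m] hsym[of m 0]
        by (cases "m = 0"; cases "n = 0"; cases "m = 1"; cases "n = 1") (auto simp: sgn1_def)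
    qed
    show "Poly_Mapping.lookup z (m, n) p' q' = Poly_Mapping.lookup (tscale (if e = 0 then h 0 e / 2 else h e 0) x) (m, n) p' q'"
      unfolding z hx lookup_tscale x lookup_add lookup_elt plus_fun_apply
      by (auto simp: mat_scale_def lookup_elt lookup_tscale zero_fun_apply algebra_simps)
  qed
  moreover have "(if e = 0 then h 0 e / 2 else h e 0) \<noteq> 0"
    using he hsym[of e 0] by (auto simp: sgn1_def)
  ultimately have "x \<in> I"
    using zI subspace_scale_cancel[OF sub] by metis
  then show ?thesis
    using q x_def by blast
qed

lemma prd_skew:
  "\<exists>N. prd x n y = (\<Sum>j<N. tscale ((- 1) ^ (n + j + 1) / fact j) ((tD ^^ j) (prd y (n + j) x)))"
proof -
  obtain N1 where 1: "gen_bound k i x y N1" using gen_bound_ex[OF i] by blast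
  obtain N2 where 2: "gen_bound k i y x N2" using gen_bound_ex[OF i] by blast
  define N where "N = N1 + N2 + n + 1"
  have B: "gen_bound k i x y N" "gen_bound k i y x N"
    by (rule gen_bound_mono[OF 1] gen_bound_mono[OF 2]; simp add: N_def)+
  have "fnprod k i x n y = (\<Sum>j<N. tscale ((- 1) ^ (n + j + 1) / fact j) ((tD ^^ j) (fnprod k i y (n + j) x)))"
    by (rule Phi_fnprod_skew[OF i]) (use B in \<open>auto simp: gen_bound_def N_def\<close>)
  then show ?thesis by blast
qed

lemmas lcoef_small = lcoef_00 lcoef_10[simplified] lcoef_01[simplified] lcoef_11[simplified]

text \<open>The targets have weight 2 and sum to a multiple of the Virasoro element. A product with
  the opposite corner reaches the diagonal at \<open>r\<close>; for any other \<open>p\<close>,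
  passing through \<open>T p r 0 0\<close> yields the sum of the diagonal elements at
  \<open>r\<close> and \<open>p\<close>.\<close>

lemma ideal_diagonal:
  fixes I :: "'f::field_char_0 tmat set"
  assumes sub: "tmat.subspace I" and act: "\<And>x y n. x \<in> R \<Longrightarrow> y \<in> I \<Longrightarrow> prd x n y \<in> I"
    and D: "\<And>x. x \<in> I \<Longrightarrow> tD x \<in> I"
    and r: "r \<in> idx k" "T (st r) r e 0 \<in> I" and p: "p \<in> idx k"
  shows "T p p 0 (1 - e) \<in> I"
proof -
  have sr: "st r \<in> idx k" using r by simp
  have ss: "T (st r) (st r) n m = tscale (- sgn1 e) (T r r m n)" for m n
    using T_star[OF r(1) r(1)] by simp
  have four: "tscale 4 x = x + x + x + x" "tscale 2 x = x + x" for x :: "'f tmat"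
    by (rule tmat_eqI; simp add: lookup_tscale lookup_add plus_fun_apply)+
  have e: "e = 0 \<or> e = 1" using e_le by auto
  have pos: "tscale c x \<in> I \<Longrightarrow> c \<noteq> 0 \<Longrightarrow> x \<in> I" for c x
    using subspace_scale_cancel[OF sub] by blast
  have rr00: "T r r 0 0 \<in> I"
    using e
  proof
    assume e: "e = 0"
    have "prd (T r (st r) 0 0) 0 (T (st r) r e 0) = tscale 4 (T r r 0 0 :: 'f tmat)"
      using r by (simp add: prd_T sr e lcoef_00 eps_star ss four sgn1_def)
    then have "tscale 4 (T r r 0 0) \<in> I"
      using act[OF T_in[OF r(1) sr] r(2)] by metis
    then show ?thesis by (rule pos) simp
  next
    assume e: "e = 1"
    have "prd (T r (st r) 1 0) 3 (T (st r) r e 0) = tscale 6 (T r r 0 0 :: 'f tmat)"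
      using r by (simp add: prd_T sr e lcoef_small eps_star ss sgn1_def)
    then have "tscale 6 (T r r 0 0) \<in> I"
      using act[OF T_in[OF r(1) sr] r(2)] by metis
    then show ?thesis by (rule pos) simp
  qed
  \<comment> \<open>For \<open>e = 0\<close> the derivative of \<open>T r r 0 0\<close> gives only a
    sum of two weight-2 elements. This one separates them, and by mirror symmetry it also covers
    \<open>st r\<close>.\<close>
  have rr10: "T r r 1 0 \<in> I" if e: "e = 0"
  proof -
    have "prd (T r (st r) 1 1) 1 (T (st r) r e 0) = tscale (- 4) (T r r 1 0 :: 'f tmat)"
      using r by (simp add: prd_T sr e lcoef_small eps_star ss four(1) sgn1_def)
    then have "tscale (- 4) (T r r 1 0) \<in> I"
      using act[OF T_in[OF r(1) sr] r(2)] by metis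
    then show ?thesis by (rule pos) simp
  qed
  show ?thesis
  proof (cases "p = r \<or> p = st r")
    case True
    show ?thesis
      using e
    proof
      assume e: "e = 0"
      have "T r r 1 0 + T r r 0 1 \<in> I"
        using D[OF rr00] by (simp add: tD_T)
      then have "T r r 0 1 \<in> I"
        using rr10[OF e] subspace_add_cancel[OF sub] by blast
      moreover have "T (st r) (st r) 0 1 \<in> I"
        unfolding ss by (rule tmat.subspace_scale[OF sub rr10[OF e]])
      ultimately show ?thesis
        using True by (auto simp: e)
    next
      assume e: "e = 1"
      have "T (st r) (st r) 0 0 \<in> I"
        unfolding ss by (rule tmat.subspace_scale[OF sub rr00])
      then show ?thesis
        using True rr00 by (auto simp: e)
    qed
  next
    case False
    then have neq: "p \<noteq> r" "p \<noteq> st r" "r \<noteq> p" "st r \<noteq> p" "st p \<noteq> r" "st p \<noteq> st r" "r \<noteq> st p" "st r \<noteq> st p"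
      using p r star_inj star_eq by auto
    have pr: "T p r 0 0 \<in> I"
      using e
    proof
      assume e: "e = 0"
      have "prd (T p (st r) 0 0) 0 (T (st r) r e 0) = tscale 2 (T p r 0 0 :: 'f tmat)"
        using r p neq by (simp add: prd_T sr e lcoef_00 eps_star four(2) sgn1_def)
      then have "tscale 2 (T p r 0 0) \<in> I"
        using act[OF T_in[OF p sr] r(2)] by metis
      then show ?thesis by (rule pos) simp
    next
      assume e: "e = 1"
      have "prd (T p (st r) 0 0) 2 (T (st r) r e 0) = tscale 2 (T p r 0 0 :: 'f tmat)"
        using r p neq by (simp add: prd_T sr e lcoef_00 eps_star sgn1_def)
      then have "tscale 2 (T p r 0 0) \<in> I"
        using act[OF T_in[OF p sr] r(2)] by metis
      then show ?thesis by (rule pos) simp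
    qed
    show ?thesis
      using e
    proof
      assume e: "e = 0"
      have "prd (T r p 1 0) 0 (T p r 0 0) = T r r 1 0 + (T p p 0 1 :: 'f tmat)"
        using r p neq by (simp add: prd_T e lcoef_small sgn1_def)
      then have "T r r 1 0 + T p p 0 1 \<in> I"
        using act[OF T_in[OF r(1) p] pr] by metis
      then show ?thesis
        using rr10[OF e] subspace_add_cancel[OF sub] e by auto
    next
      assume e: "e = 1"
      have "prd (T r p 0 0) 1 (T p r 0 0) = T r r 0 0 + (T p p 0 0 :: 'f tmat)"
        using r p neq by (simp add: prd_T e lcoef_small sgn1_def)
      then have "T r r 0 0 + T p p 0 0 \<in> I"
        using act[OF T_in[OF r(1) p] pr] by metis
      then show ?thesis
        using rr00 subspace_add_cancel[OF sub] e by auto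
    qed
  qed
qed

text \<open>Only \<open>r\<close> among \<open>p\<close>, \<open>q\<close> and their partners
  contributes, and mirror symmetry turns each contribution into a multiple of
  \<open>T p q m n\<close>. The four sums over \<open>r\<close> are evaluated separately, so
  coincidences among these indices need no case distinction.\<close>

lemma weight_element:
  fixes p q :: nat
  assumes pq: "p \<in> idx k" "q \<in> idx k"
  shows "(\<Sum>r\<in>idx k. prd (T r r 0 (1 - e)) 1 (T p q m n))
    = tscale ((if e = 0 then - 1 else 1) * of_nat (2 * (m + n + 1 + e))) (T p q m n :: 'f::field_char_0 tmat)"
proof -
  have e: "e = 0 \<or> e = 1" using e_le by auto
  define al where "al = (lcoef e 0 (1 - e) m 1 + lcoef e 0 (1 - e) n 1 - sgn1 e * lcoef e (1 - e) 0 m 1 - sgn1 e * lcoef e (1 - e) 0 n 1 :: 'f)"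
  have idx: "0 + (1 - e) + m + e - 1 = m" for m using e by auto
  have st2: "T (st q) (st p) n m = tscale (- sgn1 e * (eps k1 p * eps k1 q)) (T p q m n :: 'f tmat)"
    by (rule T_star[OF pq])
  have *: "prd (T r r 0 (1 - e)) 1 (T p q m n :: 'f tmat) =
      (if r = p then tscale (lcoef e 0 (1 - e) m 1) (T p q m n) else 0)
    - (if r = st q then tscale (- lcoef e 0 (1 - e) n 1) (T p q m n) else 0)
    - (if r = st p then tscale (sgn1 e * lcoef e (1 - e) 0 m 1) (T p q m n) else 0)
    - (if r = q then tscale (sgn1 e * lcoef e (1 - e) 0 n 1) (T p q m n) else 0)" if r: "r \<in> idx k" for r
    unfolding prd_T[OF r r pq] idx star_eq[OF r pq(1)]
  proof (intro arg_cong2[where f = minus])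
    show "(if r = st q then tscale (sgn1 e * (eps k1 p * eps k1 q) * lcoef e 0 (1 - e) n 1) (T r (st p) n m) else 0)
        = (if r = st q then tscale (- lcoef e 0 (1 - e) n 1) (T p q m n :: 'f tmat) else 0)"
    proof (cases "r = st q")
      case True
      have "tscale (sgn1 e * (eps k1 p * eps k1 q) * lcoef e 0 (1 - e) n 1) (T (st q) (st p) n m :: 'f tmat)
        = tscale (- lcoef e 0 (1 - e) n 1) (T p q m n)"
        unfolding st2 by (simp add: mult_ac)
      with True show ?thesis by simp
    qed simp
  qed (use pq in auto)
  have "(\<Sum>r\<in>idx k. prd (T r r 0 (1 - e)) 1 (T p q m n :: 'f tmat)) =
      tscale (lcoef e 0 (1 - e) m 1) (T p q m n) - tscale (- lcoef e 0 (1 - e) n 1) (T p q m n)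
    - tscale (sgn1 e * lcoef e (1 - e) 0 m 1) (T p q m n) - tscale (sgn1 e * lcoef e (1 - e) 0 n 1) (T p q m n)"
    using pq by (simp only: * sum_subtractf sum.delta finite_idx star_in if_True cong: sum.cong)
  also have "\<dots> = tscale al (T p q m n)"
    unfolding al_def by (simp add: tmat.scale_left_diff_distrib tmat.scale_left_distrib)
  also have "al = (if e = 0 then - 1 else 1) * of_nat (2 * (m + n + 1 + e))"
    using e by (auto simp: al_def lcoef_small sgn1_def)
  finally show ?thesis .
qed

lemma R_simple: "simple_conformal_algebra tscale (R :: 'f::field_char_0 tmat set) tD (tY k i)"
  unfolding simple_conformal_algebra_def
proof (intro conjI allI impI R_conformal)
  fix I :: "'f tmat set"
  assume I: "conformal_ideal tscale R tD (tY k i) I"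
  then have sub: "tmat.subspace I" and IR: "I \<subseteq> R" and D: "tD ` I \<subseteq> I"
    and act: "\<And>x y n. x \<in> R \<Longrightarrow> y \<in> I \<Longrightarrow> prd x n y \<in> I"
    by (auto simp: conformal_ideal_def fnprod_def)
  have D': "tD x \<in> I" if "x \<in> I" for x using D that by blast
  have Dj: "(tD ^^ j) x \<in> I" if "x \<in> I" for j x
    using that by (induction j) (auto simp: D')
  show "I = {0} \<or> I = R"
  proof (cases "I = {0}")
    case False
    then obtain F where F: "F \<in> I" "F \<noteq> 0"
      using tmat.subspace_0[OF sub] by blast
    obtain r where r: "r \<in> idx k" "T (st r) r e 0 \<in> I"
      using ideal_primary[OF sub IR act F] by blast
    \<comment> \<open>An ideal is defined through products acting on it from the left, while the
      Virasoro element must act as an element of the ideal; skew-symmetry supplies the other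
      side.\<close>
    have right: "prd x n y \<in> I" if "x \<in> I" "y \<in> R" for x y n
    proof -
      obtain N where N: "prd x n y = (\<Sum>j<N. tscale ((- 1) ^ (n + j + 1) / fact j) ((tD ^^ j) (prd y (n + j) x)))"
        using prd_skew by blast
      show ?thesis
        unfolding N by (intro tmat.subspace_sum[OF sub] tmat.subspace_scale[OF sub] Dj act that)
    qed
    have "T p q m n \<in> I" if pq: "p \<in> idx k" "q \<in> idx k" for p q m n
    proof -
      have "(\<Sum>r\<in>idx k. prd (T r r 0 (1 - e)) 1 (T p q m n)) \<in> I"
        by (intro tmat.subspace_sum[OF sub] right T_in pq) (rule ideal_diagonal[OF sub act D' r])
      then have "tscale ((if e = 0 then - 1 else 1) * of_nat (2 * (m + n + 1 + e))) (T p q m n) \<in> I"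
        unfolding weight_element[OF pq] .
      moreover have "of_nat (2 * (m + n + 1 + e)) \<noteq> (0 :: 'f)"
        by (subst of_nat_eq_0_iff) simp
      then have "(if e = 0 then - 1 else 1) * of_nat (2 * (m + n + 1 + e)) \<noteq> (0 :: 'f)"
        by (simp only: mult_eq_0_iff) simp
      ultimately show ?thesis
        using subspace_scale_cancel[OF sub] by blast
    qed
    then have "R \<subseteq> I"
      unfolding R_eq_span by (intro tmat.span_minimal[OF _ sub]) blast
    with IR show ?thesis by blast
  qed simp
qed

end

section \<open>Generators\<close>

lemma lcoef_02: "lcoef e 0 2 n1 n = (if n \<le> 2 + n1 + e then of_nat (n1 * e + 1) * of_nat ((2 + n1 + e) choose 2) else 0)"
proof -
  have "(of_int (- int n1 - 1 - int e) :: 'a) = - of_nat (n1 + 1 + e)" by simp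
  then have "(of_int (- int n1 - 1 - int e) gchoose 2) = ((- 1) ^ 2 * ((of_nat (n1 + 1 + e) + of_nat 2 - 1) gchoose 2) :: 'a)"
    by (simp only: gbinomial_minus)
  also have "(of_nat (n1 + 1 + e) + of_nat 2 - 1 :: 'a) = of_nat (2 + n1 + e)" by simp
  finally show ?thesis
    by (simp add: lcoef_def binomial_gbinomial)
qed

text \<open>
  If \<open>(a + b) f\<close> lies in \<open>W\<close> for all \<open>f\<close> of degree \<open>d\<close>, then modulo \<open>W\<close> a form \<open>f\<close> of degree \<open>d + 1\<close> is
  determined by \<open>f(-1,1)\<close>; so \<open>W\<close> contains all these forms as soon as it contains one with
  \<open>f(-1,1) \<noteq> 0\<close>. Here \<open>X m n\<close> stands for \<open>a\<^sup>m b\<^sup>n / (m! n!)\<close>.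
\<close>

lemma degree_complete:
  fixes X :: "nat \<Rightarrow> nat \<Rightarrow> 'f::field_char_0 tmat"
  assumes sub: "tmat.subspace W"
    and rel: "\<And>m n. m + n = d \<Longrightarrow> tscale (of_nat (m + 1)) (X (m + 1) n) + tscale (of_nat (n + 1)) (X m (n + 1)) \<in> W"
    and deg: "m1 + n1 = d + 1" "m2 + n2 = d + 1" "m + n = d + 1"
    and mem: "tscale (of_nat a1) (X m1 n1) + tscale ((- 1) ^ (m1 + m2) * of_nat a2) (X m2 n2) \<in> W" and a1: "a1 > 0"
  shows "X m n \<in> W"
proof -
  \<comment> \<open>In the quotient by \<open>W\<close>, \<open>y\<close> represents the power
    \<open>d + 1\<close> of the second variable, and \<open>c j n\<close> is the value of
    \<open>X j n\<close> at \<open>(-1, 1)\<close>.\<close>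
  define y where "y = tscale (fact (d + 1)) (X 0 (d + 1))"
  define c :: "nat \<Rightarrow> nat \<Rightarrow> 'f" where "c j n = (- 1) ^ j / (fact j * fact n)" for j n
  have y: "X j n - tscale (c j n) y \<in> W" if "j + n = d + 1" for j n
    using that
  proof (induction j arbitrary: n)
    case 0
    then show ?case
      using tmat.subspace_0[OF sub] by (simp add: y_def c_def del: fact_Suc)
  next
    case (Suc j)
    then have "X j (n + 1) - tscale (c j (n + 1)) y \<in> W" by simp
    from tmat.subspace_diff[OF sub rel[of j n] tmat.subspace_scale[OF sub this, of "of_nat (n + 1)"]]
    have *: "tscale (of_nat (j + 1)) (X (j + 1) n) + tscale (of_nat (n + 1) * c j (n + 1)) y \<in> W"
      using Suc.prems by (simp add: tmat.scale_right_diff_distrib)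
    have "of_nat (n + 1) * c j (n + 1) = - (of_nat (j + 1) * c (Suc j) n)"
      by (simp add: c_def field_simps del: of_nat_Suc)
    then have "tscale (of_nat (j + 1)) (X (Suc j) n - tscale (c (Suc j) n) y) \<in> W"
      using * by (simp add: tmat.scale_right_diff_distrib del: of_nat_Suc)
    then show ?case
      using subspace_scale_cancel[OF sub, of "of_nat (j + 1)"] by (simp del: of_nat_Suc)
  qed
  define b :: 'f where "b = of_nat a1 * c m1 n1 + (- 1) ^ (m1 + m2) * of_nat a2 * c m2 n2"
  have "tscale (of_nat a1) (X m1 n1 - tscale (c m1 n1) y)
      + tscale ((- 1) ^ (m1 + m2) * of_nat a2) (X m2 n2 - tscale (c m2 n2) y) \<in> W"
    by (intro tmat.subspace_add[OF sub] tmat.subspace_scale[OF sub] y deg)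
  from tmat.subspace_diff[OF sub mem this] have "tscale b y \<in> W"
    by (simp add: b_def tmat.scale_right_diff_distrib tmat.scale_left_distrib add.commute)
  moreover have "b \<noteq> 0"
  proof -
    have "b * (fact m1 * fact n1 * (fact m2 * fact n2)) = (- 1) ^ m1 * of_nat (a1 * (fact m2 * fact n2) + a2 * (fact m1 * fact n1))"
      by (simp add: b_def c_def field_simps power_add)
    moreover have "of_nat (a1 * (fact m2 * fact n2) + a2 * (fact m1 * fact n1)) \<noteq> (0 :: 'f)"
      using a1 by (subst of_nat_eq_0_iff) simp
    ultimately show ?thesis
      by auto
  qed
  ultimately have "y \<in> W"
    using subspace_scale_cancel[OF sub] by blast
  from tmat.subspace_add[OF sub y[OF deg(3)] tmat.subspace_scale[OF sub this, of "c m n"]]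
  show ?thesis by simp
qed

context symplectic
begin

text \<open>Reduces generation to a closure statement: any subspace that contains \<open>S\<close>
  and is stable under left products by \<open>S\<close> contains all spanning elements
  \<open>T\<close>. It is applied to the span of the words.\<close>

lemma generated_by:
  fixes S :: "'f::field_char_0 tmat set"
  assumes SR: "S \<subseteq> R"
    and gen: "\<And>W p q m n. tmat.subspace W \<Longrightarrow> S \<subseteq> W \<Longrightarrow> (\<And>x y n. x \<in> S \<Longrightarrow> y \<in> W \<Longrightarrow> prd x n y \<in> W)
      \<Longrightarrow> p \<in> idx k \<Longrightarrow> q \<in> idx k \<Longrightarrow> T p q m n \<in> W"
  shows "conformal_generated_by tscale (tY k i) R S"
proof -
  let ?W = "tmat.span (conformal_words (tY k i) S)"
  have "conformal_words (tY k i) S \<subseteq> R"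
  proof
    fix x assume "x \<in> conformal_words (tY k i) S"
    then show "x \<in> R"
      by induction (use SR in \<open>auto simp: nth_prod_def intro: tY_R\<close>)
  qed
  then have 1: "?W \<subseteq> R"
    by (rule tmat.span_minimal[OF _ Rdag_subspace])
  have act: "prd x n y \<in> ?W" if x: "x \<in> S" and "y \<in> ?W" for x y n
    using that(2)
  proof (induction rule: tmat.span_induct_alt)
    case base
    then show ?case by (simp add: tmat.span_zero)
  next
    case (step c w y)
    have "prd x n w \<in> conformal_words (tY k i) S"
      using conformal_words.step[OF x step(1), of n] by (simp add: fnprod_def nth_prod_def)
    with step(2) show ?case
      by (simp add: fnprod_linear i tmat.span_add tmat.span_scale tmat.span_base)
  qed
  have "S \<subseteq> ?W"
    by (auto intro: tmat.span_base conformal_words.base)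
  then have "T p q m n \<in> ?W" if "p \<in> idx k" "q \<in> idx k" for p q m n
    using that act by (intro gen[OF tmat.subspace_span]) auto
  then have "R \<subseteq> ?W"
    unfolding R_eq_span by (intro tmat.span_minimal[OF _ tmat.subspace_span]) blast
  with 1 show ?thesis
    unfolding conformal_generated_by_def by blast
qed

section \<open>Generation by weight 2 when an index outside \<open>p\<close> and \<open>st p\<close>
  exists\<close>

lemma ex_other:
  assumes "k1 > 1" "p \<in> idx k"
  shows "\<exists>q\<in>idx k. q \<noteq> p \<and> q \<noteq> st p"
  using assms k by (intro bexI[of _ "if p = 1 \<or> p = k1 + 1 then 2 else 1"]) (auto simp: idx_def star_def split: if_splits)

lemma neq_facts:
  assumes "p \<in> idx k" "q \<in> idx k" "q \<noteq> p" "q \<noteq> st p"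
  shows "p \<noteq> q" "p \<noteq> st q" "st p \<noteq> q" "st q \<noteq> p" "st p \<noteq> st q" "st q \<noteq> st p"
  using assms star_inj star_eq by auto

text \<open>For \<open>q\<close> outside \<open>p\<close> and \<open>st p\<close> the mirror
  summands do not interfere, so single products lower to degree 0 and raise each exponent
  separately. The positions \<open>(p, p)\<close> and \<open>(p, st p)\<close> are then reached
  through a third index \<open>r\<close>.\<close>

lemma generate_large_0:
  fixes W :: "'f::field_char_0 tmat set"
  assumes e: "e = 0" and k1: "k1 > 1" and sub: "tmat.subspace W"
    and W: "\<And>p q. p \<in> idx k \<Longrightarrow> q \<in> idx k \<Longrightarrow> T p q 1 0 \<in> W" "\<And>p q. p \<in> idx k \<Longrightarrow> q \<in> idx k \<Longrightarrow> T p q 0 1 \<in> W"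
    and act: "\<And>p q y n. p \<in> idx k \<Longrightarrow> q \<in> idx k \<Longrightarrow> y \<in> W \<Longrightarrow> prd (T p q 1 0) n y \<in> W"
       "\<And>p q y n. p \<in> idx k \<Longrightarrow> q \<in> idx k \<Longrightarrow> y \<in> W \<Longrightarrow> prd (T p q 0 1) n y \<in> W"
    and pq: "p \<in> idx k" "q \<in> idx k"
  shows "T p q m n \<in> W"
proof -
  have pos: "tscale c x \<in> W \<Longrightarrow> c \<noteq> 0 \<Longrightarrow> x \<in> W" for c x
    using subspace_scale_cancel[OF sub] by blast
  have off: "T p q m n \<in> W" if pq: "p \<in> idx k" "q \<in> idx k" and ne: "q \<noteq> p" "q \<noteq> st p" for p q m n
  proof -
    note nf = neq_facts[OF pq ne] ne
    have up1: "T p q (Suc m) n \<in> W" if "T p q m n \<in> W" for m n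
    proof -
      have "prd (T p p 1 0) 0 (T p q m n) = tscale (of_nat (Suc m)) (T p q (Suc m) n :: 'f tmat)"
        using pq nf by (simp add: prd_T e lcoef_small)
      then have "tscale (of_nat (Suc m)) (T p q (Suc m) n) \<in> W"
        using act(1)[OF pq(1,1) that] by metis
      then show ?thesis by (rule pos) (rule of_nat_neq_0)
    qed
    have up2: "T p q m (Suc n) \<in> W" if "T p q m n \<in> W" for m n
    proof -
      have "prd (T q q 0 1) 0 (T p q m n) = tscale (- of_nat (Suc n)) (T p q m (Suc n) :: 'f tmat)"
        using pq nf by (simp add: prd_T e lcoef_small sgn1_def tmat.scale_left_distrib tmat.scale_left_diff_distrib)
      then have "tscale (- of_nat (Suc n)) (T p q m (Suc n)) \<in> W"
        using act(2)[OF pq(2,2) that] by metis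
      then show ?thesis by (rule pos) (simp del: of_nat_Suc)
    qed
    have "prd (T p p 0 1) 2 (T p q 1 0) = tscale (- 2) (T p q 0 0 :: 'f tmat)"
      using pq nf by (simp add: prd_T e lcoef_small)
    then have "tscale (- 2) (T p q 0 0) \<in> W"
      using act(2)[OF pq(1,1) W(1)[OF pq]] by metis
    then have 00: "T p q 0 0 \<in> W" by (rule pos) simp
    have "T p q m 0 \<in> W" for m
      by (induction m) (use 00 up1 in auto)
    then show ?thesis
      by (induction n) (use up2 in auto)
  qed
  obtain r where r: "r \<in> idx k" and ne: "r \<noteq> p" "r \<noteq> st p"
    using ex_other[OF k1 pq(1)] by blast
  note nf = neq_facts[OF pq(1) r ne] ne
  consider "q = p" | "q = st p" | "q \<noteq> p" "q \<noteq> st p" by blast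
  then show ?thesis
  proof cases
    case 1
    have w: "T r p m n \<in> W"
      by (rule off) (use r pq nf in auto)
    have A: "prd (T p r 1 0) 1 (T r p m n) = tscale (of_nat m) (T p p m n) + tscale (of_nat (n + 1)) (T r r m n :: 'f tmat)"
      using r pq nf by (simp add: prd_T e lcoef_small sgn1_def tmat.scale_left_distrib tmat.scale_left_diff_distrib)
    have B: "prd (T p r 0 1) 1 (T r p m n) = - tscale (of_nat (m + 1)) (T p p m n) - tscale (of_nat n) (T r r m n :: 'f tmat)"
      using r pq nf by (simp add: prd_T e lcoef_small sgn1_def tmat.scale_left_distrib tmat.scale_left_diff_distrib)
    \<comment> \<open>The two products give independent combinations of the diagonal elements at
      \<open>p\<close> and \<open>r\<close>; these multipliers eliminate \<open>T r r m n\<close>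
      and leave the nonzero factor \<open>- (m + n + 1)\<close>.\<close>
    have "tscale (of_nat n) (tscale (of_nat m) (T p p m n) + tscale (of_nat (n + 1)) (T r r m n))
      + tscale (of_nat (n + 1)) (- tscale (of_nat (m + 1)) (T p p m n) - tscale (of_nat n) (T r r m n)) \<in> W"
      unfolding A[symmetric] B[symmetric]
      by (intro tmat.subspace_add[OF sub] tmat.subspace_scale[OF sub] act pq r w)
    also have "tscale (of_nat n) (tscale (of_nat m) (T p p m n) + tscale (of_nat (n + 1)) (T r r m n))
      + tscale (of_nat (n + 1)) (- tscale (of_nat (m + 1)) (T p p m n) - tscale (of_nat n) (T r r m n))
      = tscale (- of_nat (Suc (m + n))) (T p p m n :: 'f tmat)"
      by (simp add: tmat.scale_right_distrib tmat.scale_right_diff_distrib tmat.scale_left_distrib tmat.scale_left_diff_distrib algebra_simps)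
    finally have "T p p m n \<in> W"
      by (rule pos) (simp del: of_nat_Suc)
    with 1 show ?thesis by simp
  next
    case 2
    have w: "T r (st p) m n \<in> W"
      by (rule off) (use r pq nf in auto)
    have "prd (T p r 0 1) 1 (T r (st p) m n) = tscale (- of_nat (Suc m)) (T p (st p) m n :: 'f tmat)"
      using r pq nf by (simp add: prd_T e lcoef_small)
    then have "tscale (- of_nat (Suc m)) (T p (st p) m n) \<in> W"
      using act(2)[OF pq(1) r w] by metis
    then have "T p (st p) m n \<in> W"
      by (rule pos) (simp del: of_nat_Suc)
    with 2 show ?thesis by simp
  next
    case 3
    then show ?thesis using off pq by blast
  qed
qed

text \<open>The generators now have degree 0, so raising starts from them directly. The diagonal
  positions need an induction on the degree, since a product through \<open>r\<close> always mixes
  two different diagonals.\<close>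

lemma generate_large_1:
  fixes W :: "'f::field_char_0 tmat set"
  assumes e: "e = 1" and k1: "k1 > 1" and sub: "tmat.subspace W"
    and W: "\<And>p q. p \<in> idx k \<Longrightarrow> q \<in> idx k \<Longrightarrow> T p q 0 0 \<in> W"
    and act: "\<And>p q y n. p \<in> idx k \<Longrightarrow> q \<in> idx k \<Longrightarrow> y \<in> W \<Longrightarrow> prd (T p q 0 0) n y \<in> W"
    and pq: "p \<in> idx k" "q \<in> idx k"
  shows "T p q m n \<in> W"
proof -
  have pos: "tscale c x \<in> W \<Longrightarrow> c \<noteq> 0 \<Longrightarrow> x \<in> W" for c x
    using subspace_scale_cancel[OF sub] by blast
  have off: "T p q m n \<in> W" if pq: "p \<in> idx k" "q \<in> idx k" and ne: "q \<noteq> p" "q \<noteq> st p" for p q m n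
  proof -
    note nf = neq_facts[OF pq ne] ne
    have up1: "T p q (Suc m) n \<in> W" if "T p q m n \<in> W" for m n
    proof -
      have "prd (T p p 0 0) 0 (T p q m n) = tscale (of_nat (Suc m)) (T p q (Suc m) n :: 'f tmat)"
        using pq nf by (simp add: prd_T e lcoef_small add.commute)
      then have "tscale (of_nat (Suc m)) (T p q (Suc m) n) \<in> W"
        using act[OF pq(1,1) that] by metis
      then show ?thesis by (rule pos) (rule of_nat_neq_0)
    qed
    have up2: "T p q m (Suc n) \<in> W" if "T p q m n \<in> W" for m n
    proof -
      have "prd (T q q 0 0) 0 (T p q m n) = tscale (of_nat (Suc n)) (T p q m (Suc n) :: 'f tmat)"
        using pq nf by (simp add: prd_T e lcoef_small sgn1_def tmat.scale_left_distrib tmat.scale_left_diff_distrib)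
      then have "tscale (of_nat (Suc n)) (T p q m (Suc n)) \<in> W"
        using act[OF pq(2,2) that] by metis
      then show ?thesis by (rule pos) (rule of_nat_neq_0)
    qed
    have "T p q m 0 \<in> W" for m
      by (induction m) (use W[OF pq] up1 in auto)
    then show ?thesis
      by (induction n) (use up2 in auto)
  qed
  have diag: "\<forall>p\<in>idx k. \<forall>m n. m + n = d \<longrightarrow> T p p m n \<in> W" for d
  proof (induction d)
    case 0
    then show ?case using W by auto
  next
    case (Suc d)
    have AB: "T p p (Suc m) n \<in> W \<and> T p p m (Suc n) \<in> W" if p: "p \<in> idx k" and mn: "m + n = d" for p m n
    proof -
      obtain r where r: "r \<in> idx k" and ne: "r \<noteq> p" "r \<noteq> st p"
        using ex_other[OF k1 p] by blast
      note nf = neq_facts[OF p r ne] ne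
      have w: "T r p m n \<in> W" for m n
        by (rule off) (use r p nf in auto)
      \<comment> \<open>Three products give three relations in \<open>?A\<close>, \<open>?B\<close>
        and \<open>?C\<close>. Their determinant is, up to sign,
        \<open>(m + 1) * (n + 1) * (m + n + 3)\<close>, so all three unknowns are
        determined.\<close>
      let ?A = "T p p (Suc m) n :: 'f tmat" and ?B = "T p p m (Suc n) :: 'f tmat" and ?C = "T r r m (Suc n) :: 'f tmat"
      have "prd (T p p 0 0) 0 (T p p m n) = tscale (of_nat (Suc m)) ?A + tscale (of_nat (Suc n)) ?B"
        using p by (simp add: prd_T e lcoef_small sgn1_def tmat.scale_left_distrib tmat.scale_left_diff_distrib)
      moreover have "T p p m n \<in> W" using Suc p mn by blast
      ultimately have 1: "tscale (of_nat (Suc m)) ?A + tscale (of_nat (Suc n)) ?B \<in> W"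
        using act[OF p p] by metis
      have "prd (T p r 0 0) 0 (T r p m n) = tscale (of_nat (Suc m)) ?A + tscale (of_nat (Suc n)) ?C"
        using r p nf by (simp add: prd_T e lcoef_small sgn1_def tmat.scale_left_distrib tmat.scale_left_diff_distrib)
      then have 2: "tscale (of_nat (Suc m)) ?A + tscale (of_nat (Suc n)) ?C \<in> W"
        using act[OF p r w] by metis
      have "prd (T p r 0 0) 1 (T r p m (Suc n)) = tscale (of_nat (Suc m)) ?B + tscale (of_nat (Suc (Suc n))) ?C"
        using r p nf by (simp add: prd_T e lcoef_small sgn1_def tmat.scale_left_distrib tmat.scale_left_diff_distrib)
      then have 3: "tscale (of_nat (Suc m)) ?B + tscale (of_nat (Suc (Suc n))) ?C \<in> W"
        using act[OF p r w] by metis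
      have "tscale (of_nat (Suc n)) (?B - ?C) \<in> W"
        using tmat.subspace_diff[OF sub 1 2] by (simp add: tmat.scale_right_diff_distrib)
      then have "?B - ?C \<in> W"
        by (rule pos) (rule of_nat_neq_0)
      then have "tscale (of_nat (Suc m)) ?B + tscale (of_nat (Suc (Suc n))) ?C + tscale (of_nat (Suc (Suc n))) (?B - ?C) \<in> W"
        by (intro tmat.subspace_add[OF sub] tmat.subspace_scale[OF sub] 3)
      also have "tscale (of_nat (Suc m)) ?B + tscale (of_nat (Suc (Suc n))) ?C + tscale (of_nat (Suc (Suc n))) (?B - ?C)
         = tscale (of_nat (Suc m) + of_nat (Suc (Suc n))) ?B"
        unfolding tmat.scale_right_diff_distrib tmat.scale_left_distrib by simp
      also have "of_nat (Suc m) + of_nat (Suc (Suc n)) = (of_nat (Suc (m + Suc (Suc n))) :: 'f)" by simp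
      finally have B: "?B \<in> W"
        by (rule pos) (rule of_nat_neq_0)
      have "tscale (of_nat (Suc m)) ?A \<in> W"
        using tmat.subspace_diff[OF sub 1 tmat.subspace_scale[OF sub B, of "of_nat (Suc n)"]] by simp
      then have "?A \<in> W"
        by (rule pos) (rule of_nat_neq_0)
      with B show ?thesis by blast
    qed
    show ?case
    proof (intro ballI allI impI)
      fix p m n assume "p \<in> idx k" "m + n = Suc d"
      then show "T p p m n \<in> W"
        using AB[of p m "n - 1"] AB[of p "m - 1" n] by (cases n) auto
    qed
  qed
  consider "q = p" | "q = st p" | "q \<noteq> p" "q \<noteq> st p" by blast
  then show ?thesis
  proof cases
    case 1
    then show ?thesis using diag pq by blast
  next
    case 2
    obtain r where r: "r \<in> idx k" and ne: "r \<noteq> p" "r \<noteq> st p"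
      using ex_other[OF k1 pq(1)] by blast
    note nf = neq_facts[OF pq(1) r ne] ne
    have w: "T r (st p) m n \<in> W"
      by (rule off) (use r pq nf in auto)
    have "prd (T p r 0 0) 1 (T r (st p) m n) = tscale (of_nat (Suc m)) (T p (st p) m n :: 'f tmat)"
      using r pq nf by (simp add: prd_T e lcoef_small add.commute)
    then have "tscale (of_nat (Suc m)) (T p (st p) m n) \<in> W"
      using act[OF pq(1) r w] by metis
    then have "T p (st p) m n \<in> W"
      by (rule pos) (rule of_nat_neq_0)
    with 2 show ?thesis by simp
  next
    case 3
    then show ?thesis using off pq by blast
  qed
qed

text \<open>With the indices 1 and 2 only, everything reduces to \<open>T 1 1\<close>: position
  \<open>(2, 2)\<close> is its mirror, and \<open>(1, 2)\<close>, \<open>(2, 1)\<close> follow by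
  one product each. Each degree of \<open>T 1 1\<close> is completed from the previous ones by
  \<open>degree_complete\<close>.\<close>

lemma generate_small:
  fixes W :: "'f::field_char_0 tmat set"
  assumes k1: "k1 = 1" and sub: "tmat.subspace W"
    and W: "T 1 2 (2 - e) 0 \<in> W" "T 2 1 (2 - e) 0 \<in> W" "T 1 1 0 (1 - e) \<in> W"
    and act: "\<And>y n. y \<in> W \<Longrightarrow> prd (T 1 2 (2 - e) 0) n y \<in> W" "\<And>y n. y \<in> W \<Longrightarrow> prd (T 2 1 (2 - e) 0) n y \<in> W"
      "\<And>y n. y \<in> W \<Longrightarrow> prd (T 1 1 0 (1 - e)) n y \<in> W"
    and pq: "p \<in> idx k" "q \<in> idx k"
  shows "T p q m n \<in> W"
proof -
  have pos: "tscale c x \<in> W \<Longrightarrow> c \<noteq> 0 \<Longrightarrow> x \<in> W" for c x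
    using subspace_scale_cancel[OF sub] by blast
  have e: "e = 0 \<or> e = 1" using e_le by auto
  have idx: "1 \<in> idx k" "2 \<in> idx k"
    using k k1 by (auto simp: idx_def)
  have st: "st 1 = 2" "st 2 = 1" and ep: "eps k1 1 = (1 :: 'f)" "eps k1 2 = (- 1 :: 'f)"
    using k1 by (auto simp: star_def eps_def)
  have T22: "T 2 2 m n = tscale (- sgn1 e) (T 1 1 n m :: 'f tmat)" for m n
    using T_star[OF idx(1,1), of m n, where ?'a = 'f] by (simp only: st ep) simp
  have T12: "T 1 2 n m = tscale (sgn1 e) (T 1 2 m n :: 'f tmat)" for m n
    using T_star[OF idx(1,2), of n m, where ?'a = 'f] by (simp only: st ep) simp
  note prd_T_idx = prd_T[OF idx(1) idx(1) idx(1) idx(1)] prd_T[OF idx(1) idx(1) idx(2) idx(1)]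
    prd_T[OF idx(1) idx(2) idx(1) idx(1)] prd_T[OF idx(1) idx(2) idx(2) idx(1)] prd_T[OF idx(2) idx(1) idx(1) idx(1)]
  \<comment> \<open>The combined structure constant of a corner generator acting on one exponent.
    Positivity for \<open>n \<le> 2\<close> rules out every cancellation below.\<close>
  define g where "g m n = (if e = 0 then ((m + 2 - n) choose 2) + ((m + 2) choose 2) else (m + 1) * ((m + 2 - n) + (m + 2)))" for m n :: nat
  have g_pos: "g m n > 0" if "n \<le> 2" for m n
    using that by (auto simp: g_def)
  have A: "prd (T 1 2 (2 - e) 0) n (T 2 1 m m') = tscale (of_nat (g m n)) (T 1 1 (m + 2 - n) m')
      + tscale (sgn1 e * of_nat (g m' n)) (T 1 1 (m' + 2 - n) m :: 'f tmat)" if "n \<le> 2" for m m' n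
    using e
  proof
    assume e: "e = 0"
    have "n \<le> 2 + m" "n \<le> 2 + m'" using that by auto
    then show ?thesis
      unfolding prd_T_idx st ep g_def T22
      by (simp add: e lcoef_20[simplified] lcoef_02[simplified] sgn1_def tmat.scale_left_distrib add_ac)
  next
    assume e: "e = 1"
    have "n \<le> m + 2" "n \<le> m' + 2" using that by simp_all
    then obtain x x' where x: "m + 2 = n + x" "m' + 2 = n + x'"
      using le_Suc_ex by blast
    then have l: "n \<le> 2 + m" "n \<le> 2 + m'" "Suc (Suc m) - n = x" "Suc (Suc m') - n = x'" by simp_all
    show ?thesis
      using l(1,2) unfolding prd_T_idx st ep g_def T22
      by (simp add: e lcoef_10[simplified] lcoef_01[simplified] l(3,4) sgn1_def)
        (simp add: tmat.scale_left_distrib tmat.scale_left_diff_distrib algebra_simps)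
  qed
  have A2: "prd (T 1 2 (2 - e) 0) 2 (T 1 1 m n) = tscale (- of_nat (g n 2)) (T 1 2 m n :: 'f tmat)" for m n
    using e
  proof
    assume e: "e = 0"
    then show ?thesis
      unfolding prd_T_idx st ep g_def
      by (simp add: lcoef_20[simplified] lcoef_02[simplified] sgn1_def T12[of n m, unfolded One_nat_def] tmat.scale_left_distrib tmat.scale_left_diff_distrib)
  next
    assume e: "e = 1"
    show ?thesis
      unfolding prd_T_idx st ep g_def
      by (simp add: e lcoef_10[simplified] lcoef_01[simplified] sgn1_def T12[of n m, unfolded One_nat_def],
        simp only: tmat.scale_left_distrib[symmetric] tmat.scale_left_diff_distrib[symmetric] tmat.scale_minus_left[symmetric],
        rule arg_cong2[where f = tscale], simp_all add: algebra_simps)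
  qed
  have B2: "prd (T 2 1 (2 - e) 0) 2 (T 1 1 m n) = tscale (of_nat (g m 2)) (T 2 1 m n :: 'f tmat)" for m n
    using e
  proof
    assume e: "e = 0"
    then show ?thesis
      unfolding prd_T_idx st ep g_def
      by (simp add: lcoef_20[simplified] lcoef_02[simplified] sgn1_def tmat.scale_left_distrib tmat.scale_left_diff_distrib)
  next
    assume e: "e = 1"
    show ?thesis
      unfolding prd_T_idx st ep g_def
      by (simp add: e lcoef_10[simplified] lcoef_01[simplified] sgn1_def,
        simp only: tmat.scale_left_distrib[symmetric] tmat.scale_left_diff_distrib[symmetric] tmat.scale_minus_left[symmetric],
        rule arg_cong2[where f = tscale], simp_all add: algebra_simps)
  qed
  \<comment> \<open>Up to a derivative, \<open>T 1 1 0 (1 - e)\<close> is half of the Virasoro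
    multiple, and derivatives have zero product of index 0; so this product is the derivation up to
    sign.\<close>
  have D: "prd (T 1 1 0 (1 - e)) 0 (T 1 1 m n) = tscale (- sgn1 e)
      (tscale (of_nat (m + 1)) (T 1 1 (m + 1) n) + tscale (of_nat (n + 1)) (T 1 1 m (n + 1) :: 'f tmat))" for m n
    using e
  proof
    assume e: "e = 0"
    then show ?thesis
      unfolding prd_T_idx st ep
      by (simp add: lcoef_small sgn1_def tmat.scale_right_distrib tmat.scale_left_distrib tmat.scale_left_diff_distrib algebra_simps)
  next
    assume e: "e = 1"
    then show ?thesis
      unfolding prd_T_idx st ep
      by (simp add: lcoef_small sgn1_def tmat.scale_right_distrib tmat.scale_left_distrib tmat.scale_left_diff_distrib algebra_simps)
  qed
  \<comment> \<open>For \<open>e = 0\<close> the generators have weights 2 and 3, and the start of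
    the induction, of weight 1, has to be reached by lowering.\<close>
  have Q0: "T 1 1 0 0 \<in> W"
    using e
  proof
    assume e: "e = 0"
    have "prd (T 1 1 0 (1 - e)) 2 (T 2 1 (2 - e) 0) = tscale (- 1) (T 2 1 1 0 :: 'f tmat)"
      unfolding prd_T_idx st ep by (simp add: e lcoef_small sgn1_def)
    then have "tscale (- 1) (T 2 1 1 0) \<in> W"
      using act(3)[OF W(2)] by metis
    then have 10: "T 2 1 1 0 \<in> W" by (rule pos) simp
    have "prd (T 1 2 (2 - e) 0) 3 (T 2 1 1 0) = tscale 3 (T 1 1 0 0 :: 'f tmat)"
      unfolding prd_T_idx st ep T22 by (simp add: e lcoef_20[simplified] lcoef_02[simplified] sgn1_def choose_two)
    then have "tscale 3 (T 1 1 0 0) \<in> W"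
      using act(1)[OF 10] by metis
    then show ?thesis by (rule pos) simp
  qed (use W(3) in simp)
  have P: "T 1 2 m n \<in> W" "T 2 1 m n \<in> W" if "T 1 1 m n \<in> W" for m n
  proof -
    have "tscale (- of_nat (g n 2)) (T 1 2 m n) \<in> W" "tscale (of_nat (g m 2)) (T 2 1 m n) \<in> W"
      using act(1,2)[OF that, of 2] unfolding A2 B2 by blast+
    moreover have "g j 2 \<noteq> 0" for j
      using g_pos[of 2 j] by simp
    ultimately show "T 1 2 m n \<in> W" "T 2 1 m n \<in> W"
      using pos[of "- of_nat (g n 2)" "T 1 2 m n"] pos[of "of_nat (g m 2)" "T 2 1 m n"] by simp_all
  qed
  have Q: "\<forall>m n. m + n = d \<longrightarrow> T 1 1 m n \<in> W" for d
  proof (induction d rule: less_induct)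
    case (less d)
    show ?case
    proof (cases d)
      case 0
      then show ?thesis using Q0 by simp
    next
      case (Suc d')
      have rel: "tscale (of_nat (m + 1)) (T 1 1 (m + 1) n) + tscale (of_nat (n + 1)) (T 1 1 m (n + 1)) \<in> W" if "m + n = d'" for m n
      proof -
        have "T 1 1 m n \<in> W"
          using less Suc that by auto
        then have "tscale (- sgn1 e) (tscale (of_nat (m + 1)) (T 1 1 (m + 1) n) + tscale (of_nat (n + 1)) (T 1 1 m (n + 1))) \<in> W"
          using act(3)[of "T 1 1 m n" 0] unfolding D by blast
        then show ?thesis by (rule pos) (simp add: sgn1_def)
      qed
      \<comment> \<open>A product of the corner elements supplies the one further form of degree
        \<open>d\<close>. Its two terms reinforce each other at \<open>(-1, 1)\<close> only if
        \<open>m\<close> has the parity of \<open>e\<close>; the freedom in \<open>j\<close> adjusts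
        this parity. For \<open>d' = 0\<close> and \<open>e = 1\<close> the generator itself serves
        as \<open>T 2 1 m 0\<close>.\<close>
      have "\<exists>m j. j \<le> 2 \<and> m + 2 - j = Suc d' \<and> (even m \<longleftrightarrow> even e) \<and> T 2 1 m 0 \<in> W"
      proof (cases "d' = 0")
        case True
        from e show ?thesis
        proof
          assume "e = 0"
          then show ?thesis
            using True P(2)[OF Q0] by (intro exI[of _ 0] exI[of _ 1]) auto
        next
          assume "e = 1"
          then show ?thesis
            using True W(2) by (intro exI[of _ 1] exI[of _ 2]) auto
        qed
      next
        case False
        define j :: nat where "j = (if even (d' - 1) \<longleftrightarrow> even e then 0 else 1)"
        have "d' - 1 + j < d"
          using Suc False by (auto simp: j_def)
        from less[OF this] have "T 1 1 (d' - 1 + j) 0 \<in> W"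
          by simp
        then show ?thesis
          using False P(2) by (intro exI[of _ "d' - 1 + j"] exI[of _ j]) (auto simp: j_def)
      qed
      then obtain m j where mj: "j \<le> 2" "m + 2 - j = Suc d'" "even m \<longleftrightarrow> even e" "T 2 1 m 0 \<in> W"
        by blast
      have "prd (T 1 2 (2 - e) 0) j (T 2 1 m 0) \<in> W"
        by (rule act(1)[OF mj(4)])
      then have mem: "tscale (of_nat (g m j)) (T 1 1 (m + 2 - j) 0)
        + tscale ((- 1) ^ ((m + 2 - j) + (2 - j)) * of_nat (g 0 j)) (T 1 1 (2 - j) m) \<in> W"
      proof -
        have "j = 0 \<or> j = 1 \<or> j = 2"
          using mj(1) by auto
        then have "even ((m + 2 - j) + (2 - j)) \<longleftrightarrow> even e"
          using mj(2,3) by auto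
        then have sgn: "(- 1) ^ ((m + 2 - j) + (2 - j)) = (sgn1 e :: 'f)"
          by (simp add: sgn1_def minus_one_power_iff)
        show ?thesis
          using \<open>prd (T 1 2 (2 - e) 0) j (T 2 1 m 0) \<in> W\<close> unfolding A[OF mj(1)] add_0 sgn .
      qed
      show ?thesis
      proof (intro allI impI)
        fix m' n' assume "m' + n' = d"
        then show "T 1 1 m' n' \<in> W"
          using mj Suc by (intro degree_complete[OF sub rel _ _ _ mem g_pos]) auto
      qed
    qed
  qed
  have "T 2 2 m n \<in> W"
    unfolding T22 by (rule tmat.subspace_scale[OF sub]) (use Q in blast)
  moreover have "p = 1 \<or> p = 2" "q = 1 \<or> q = 2"
    using pq k k1 by (auto simp: idx_def)
  ultimately show ?thesis
    using P[of m n] Q by auto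
qed

text \<open>Mirror symmetry maps the upper left block to the lower right one, which accounts for the
  absent fourth family. It maps each off-diagonal block to itself with exponents exchanged, so there
  \<open>Q\<close> may select one exponent pair from each mirror pair, as in the weight-2
  bases.\<close>

lemma span_families:
  fixes P Q :: "nat \<Rightarrow> nat \<Rightarrow> bool"
  assumes P: "\<And>m n. P m n \<Longrightarrow> P n m" and Q: "\<And>m n. Q m n \<Longrightarrow> P m n" "\<And>m n. P m n \<Longrightarrow> Q m n \<or> Q n m"
  shows "tmat.span ({T p q m n | p q m n. p \<in> {1..k1} \<and> q \<in> {1..k1} \<and> P m n}
      \<union> {T p (k1 + q) m n | p q m n. p \<in> {1..k1} \<and> q \<in> {1..k1} \<and> Q m n}
      \<union> {T (k1 + p) q m n | p q m n. p \<in> {1..k1} \<and> q \<in> {1..k1} \<and> Q m n})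
    = tmat.span ({T p q m n | p q m n. p \<in> idx k \<and> q \<in> idx k \<and> P m n} :: 'f::field_char_0 tmat set)"
    (is "tmat.span ?F = tmat.span ?G")
proof
  have "?F \<subseteq> ?G"
    using k Q(1) by (fastforce simp: idx_def)
  then show "tmat.span ?F \<subseteq> tmat.span ?G"
    by (rule tmat.span_mono)
  show "tmat.span ?G \<subseteq> tmat.span ?F"
  proof (rule tmat.span_minimal[OF _ tmat.subspace_span], safe)
    fix p q m n assume pq: "p \<in> idx k" "q \<in> idx k" and mn: "P m n"
    have swap: "T p q m n \<in> tmat.span ?F" if "T (st q) (st p) n m \<in> tmat.span ?F"
      using tmat.span_scale[OF that, of "- sgn1 e * (eps k1 (st q) * eps k1 (st p))"]
        T_star[of "st q" "st p" m n, where ?'a = 'f] pq by simp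
    have fam: "T p q m n \<in> tmat.span ?F"
      if "p \<in> {1..k1} \<and> q \<in> {1..k1} \<and> P m n
        \<or> p \<in> {1..k1} \<and> q - k1 \<in> {1..k1} \<and> q > k1 \<and> Q m n
        \<or> p - k1 \<in> {1..k1} \<and> p > k1 \<and> q \<in> {1..k1} \<and> Q m n" for p q m n
      using that
    proof (elim disjE conjE)
      assume "p \<in> {1..k1}" "q \<in> {1..k1}" "P m n"
      then show ?thesis by (intro tmat.span_base) blast
    next
      assume "p \<in> {1..k1}" "q - k1 \<in> {1..k1}" "q > k1" "Q m n"
      then have "T p (k1 + (q - k1)) m n \<in> tmat.span ?F" by (intro tmat.span_base) blast
      with \<open>q > k1\<close> show ?thesis by simp
    next
      assume "p - k1 \<in> {1..k1}" "p > k1" "q \<in> {1..k1}" "Q m n"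
      then have "T (k1 + (p - k1)) q m n \<in> tmat.span ?F" by (intro tmat.span_base) blast
      with \<open>p > k1\<close> show ?thesis by simp
    qed
    have idx_cases: "r \<in> {1..k1} \<and> st r > k1 \<and> st r - k1 \<in> {1..k1}
        \<or> r > k1 \<and> r - k1 \<in> {1..k1} \<and> st r \<in> {1..k1}" if "r \<in> idx k" for r
      using that k k1 by (auto simp: idx_def star_def)
    show "T p q m n \<in> tmat.span ?F"
      using idx_cases[OF pq(1)] idx_cases[OF pq(2)] Q(2)[OF mn] mn P[OF mn]
        fam[of p q m n] fam[of "st q" "st p" n m] swap by blast
  qed
qed

lemma R_eq_families:
  "R = tmat.span ({T p q m n | p q m n. p \<in> {1..k1} \<and> q \<in> {1..k1}}
      \<union> {T p (k1 + q) m n | p q m n. p \<in> {1..k1} \<and> q \<in> {1..k1}}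
      \<union> {T (k1 + p) q m n | p q m n. p \<in> {1..k1} \<and> q \<in> {1..k1}})"
  using span_families[of "\<lambda>_ _. True" "\<lambda>_ _. True"] unfolding R_eq_span simp_thms by (rule sym) simp_all

lemma weight_part_R:
  "weight_part i w R = tmat.span {T p q m n | p q m n. p \<in> idx k \<and> q \<in> idx k \<and> m + n + 1 + e = w}"
    (is "_ = tmat.span ?G")
proof
  show "weight_part i w R \<subseteq> tmat.span ?G"
  proof
    fix x :: "'a tmat" assume "x \<in> weight_part i w R"
    then have x: "x \<in> R" "\<forall>(m, n)\<in>Poly_Mapping.keys x. m + n + 1 + e = w"
      by (auto simp: weight_part_def)
    have "{T p q m n | p q m n. p \<in> idx k \<and> q \<in> idx k \<and> (m, n) \<in> Poly_Mapping.keys x} \<subseteq> ?G"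
      using x(2) by blast
    from tmat.span_mono[OF this] R_span_keys[OF x(1)] show "x \<in> tmat.span ?G" by blast
  qed
  define V :: "'a tmat set" where "V = {x. \<forall>m n. m + n + 1 + e \<noteq> w \<longrightarrow> Poly_Mapping.lookup x (m, n) = 0}"
  have sub: "tmat.subspace V"
    unfolding V_def by (rule tmat.subspaceI) (auto simp: lookup_add lookup_tscale_mat)
  have "Poly_Mapping.lookup (T p q m n :: 'a tmat) (a, b) = 0" if "a + b \<noteq> m + n" for p q m n a b
  proof -
    have "\<not> (a = m \<and> b = n)" "\<not> (a = n \<and> b = m)" using that by auto
    then show ?thesis
      by (simp only: Telt_def lookup_minus_tmat lookup_tscale_mat lookup_elt if_False mat_scale_zero diff_self)
  qed
  then have "?G \<subseteq> V"
    unfolding V_def by fastforce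
  then have "tmat.span ?G \<subseteq> V"
    by (rule tmat.span_minimal[OF _ sub])
  moreover have "tmat.span ?G \<subseteq> R"
    by (rule tmat.span_minimal[OF _ Rdag_subspace]) (use T_in in blast)
  ultimately show "tmat.span ?G \<subseteq> weight_part i w R"
    by (fastforce simp: weight_part_def V_def in_keys_iff)
qed

end

section \<open>Transfer to the two concrete algebras\<close>

lemma symplectic_1: "k1 > 0 \<Longrightarrow> k = 2 * k1 \<Longrightarrow> symplectic k1 k 1"
  and symplectic_0: "k1 > 0 \<Longrightarrow> k = 2 * k1 \<Longrightarrow> symplectic k1 k 0"
  by (unfold_locales; simp)+

lemma Telt_1_families:
  assumes "p \<in> {1..k1}" "q \<in> {1..k1}"
  shows "Telt k1 1 p q m n = elt (mat_unit p q) m n - elt (mat_unit (k1 + q) (k1 + p)) n m"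
    "Telt k1 1 p (k1 + q) m n = elt (mat_unit p (k1 + q)) m n + elt (mat_unit q (k1 + p)) n m"
    "Telt k1 1 (k1 + p) q m n = elt (mat_unit (k1 + p) q) m n + elt (mat_unit (k1 + q) p) n m"
  using assms by (auto simp: Telt_def star_def eps_def sgn1_def dlt_def)

lemma Telt_0_families:
  assumes "p \<in> {1..k1}" "q \<in> {1..k1}"
  shows "Telt k1 0 p q m n = elt (mat_unit p q) m n + elt (mat_unit (k1 + q) (k1 + p)) n m"
    "Telt k1 0 p (k1 + q) m n = elt (mat_unit p (k1 + q)) m n - elt (mat_unit q (k1 + p)) n m"
    "Telt k1 0 (k1 + p) q m n = elt (mat_unit (k1 + p) q) m n - elt (mat_unit (k1 + q) p) n m"
  using assms by (auto simp: Telt_def star_def eps_def sgn1_def dlt_def)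

lemma families_cong:
  assumes "\<And>p q m n. C p q m n \<Longrightarrow> f p q m n = g p q m n"
  shows "{f p q m n | p q m n. C p q m n} = {g p q m n | p q m n. C p q m n}"
  unfolding set_eq_iff mem_Collect_eq using assms by metis

lemma Rdag1_eq:
  assumes "k1 > 0" "k = 2 * k1"
  shows "Rdag1 k1 = Rdag k1 k 1"
proof -
  interpret symplectic k1 k 1 by (rule symplectic_1[OF assms])
  show ?thesis
    unfolding Rdag1_def R_eq_families
    by (intro arg_cong[where f = tmat.span] arg_cong2[where f = "(\<union>)"] families_cong)
      (simp_all only: Telt_1_families)
qed

lemma Rdag2_eq:
  assumes "k1 > 0" "k = 2 * k1"
  shows "Rdag2 k1 = Rdag k1 k 0"
proof -
  interpret symplectic k1 k 0 by (rule symplectic_0[OF assms])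
  show ?thesis
    unfolding Rdag2_def R_eq_families
    by (intro arg_cong[where f = tmat.span] arg_cong2[where f = "(\<union>)"] families_cong)
      (simp_all only: Telt_0_families)
qed

lemma weight_part_1:
  assumes "k1 > 0" "k = 2 * k1"
  shows "weight_part 1 2 (Rdag k1 k 1 :: 'f::field_char_0 tmat set) = tmat.span
          ({elt (mat_unit p q) \<epsilon> (1 - \<epsilon>) - elt (mat_unit (k1 + q) (k1 + p)) (1 - \<epsilon>) \<epsilon>
              | p q \<epsilon>. p \<in> {1..k1} \<and> q \<in> {1..k1} \<and> \<epsilon> \<in> {0, 1}}
         \<union> {elt (mat_unit p (k1 + q)) 1 0 + elt (mat_unit q (k1 + p)) 0 1
              | p q. p \<in> {1..k1} \<and> q \<in> {1..k1}}
         \<union> {elt (mat_unit (k1 + p) q) 1 0 + elt (mat_unit (k1 + q) p) 0 1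
              | p q. p \<in> {1..k1} \<and> q \<in> {1..k1}})"
    (is "_ = tmat.span (?A \<union> ?B \<union> ?C)")
proof -
  interpret symplectic k1 k 1 by (rule symplectic_1[OF assms])
  note F = Telt_1_families
  have *: "m + n + 1 + e = 2 \<longleftrightarrow> m \<in> {0, 1} \<and> n = 1 - m" for m n
    by (auto simp: dlt_def)
  have "weight_part 1 2 R = tmat.span ({T p q m n | p q m n. p \<in> {1..k1} \<and> q \<in> {1..k1} \<and> m + n + 1 + e = 2}
      \<union> {T p (k1 + q) m n | p q m n. p \<in> {1..k1} \<and> q \<in> {1..k1} \<and> m = 1 \<and> n = 0}
      \<union> {T (k1 + p) q m n | p q m n. p \<in> {1..k1} \<and> q \<in> {1..k1} \<and> m = 1 \<and> n = 0} :: 'f tmat set)"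
    unfolding weight_part_R by (rule span_families[symmetric]) (auto simp: dlt_def)
  also have "{T p q m n | p q m n. p \<in> {1..k1} \<and> q \<in> {1..k1} \<and> m + n + 1 + e = 2} = ?A"
    unfolding set_eq_iff mem_Collect_eq * using F(1) by metis
  also have "{T p (k1 + q) m n | p q m n. p \<in> {1..k1} \<and> q \<in> {1..k1} \<and> m = 1 \<and> n = 0} = ?B"
    unfolding set_eq_iff mem_Collect_eq using F(2) by metis
  also have "{T (k1 + p) q m n | p q m n. p \<in> {1..k1} \<and> q \<in> {1..k1} \<and> m = 1 \<and> n = 0} = ?C"
    unfolding set_eq_iff mem_Collect_eq using F(3) by metis
  finally show ?thesis .
qed

lemma weight_part_0:
  assumes "k1 > 0" "k = 2 * k1"
  shows "weight_part 0 2 (Rdag k1 k 0 :: 'f::field_char_0 tmat set) = tmat.span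
          ({elt (mat_unit p q) 0 0 + elt (mat_unit (k1 + q) (k1 + p)) 0 0
              | p q. p \<in> {1..k1} \<and> q \<in> {1..k1}}
         \<union> {elt (mat_unit p (k1 + q)) 0 0 - elt (mat_unit q (k1 + p)) 0 0
              | p q. p \<in> {1..k1} \<and> q \<in> {1..k1}}
         \<union> {elt (mat_unit (k1 + p) q) 0 0 - elt (mat_unit (k1 + q) p) 0 0
              | p q. p \<in> {1..k1} \<and> q \<in> {1..k1}})"
    (is "_ = tmat.span (?A \<union> ?B \<union> ?C)")
proof -
  interpret symplectic k1 k 0 by (rule symplectic_0[OF assms])
  note F = Telt_0_families
  have *: "m + n + 1 + e = 2 \<longleftrightarrow> m = 0 \<and> n = 0" for m n
    by (auto simp: dlt_def)
  have "weight_part 0 2 R = tmat.span ({T p q m n | p q m n. p \<in> {1..k1} \<and> q \<in> {1..k1} \<and> m + n + 1 + e = 2}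
      \<union> {T p (k1 + q) m n | p q m n. p \<in> {1..k1} \<and> q \<in> {1..k1} \<and> m + n + 1 + e = 2}
      \<union> {T (k1 + p) q m n | p q m n. p \<in> {1..k1} \<and> q \<in> {1..k1} \<and> m + n + 1 + e = 2} :: 'f tmat set)"
    unfolding weight_part_R by (rule span_families[symmetric]) (auto simp: dlt_def)
  also have "{T p q m n | p q m n. p \<in> {1..k1} \<and> q \<in> {1..k1} \<and> m + n + 1 + e = 2} = ?A"
    unfolding set_eq_iff mem_Collect_eq * using F(1) by metis
  also have "{T p (k1 + q) m n | p q m n. p \<in> {1..k1} \<and> q \<in> {1..k1} \<and> m + n + 1 + e = 2} = ?B"
    unfolding set_eq_iff mem_Collect_eq * using F(2) by metis
  also have "{T (k1 + p) q m n | p q m n. p \<in> {1..k1} \<and> q \<in> {1..k1} \<and> m + n + 1 + e = 2} = ?C"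
    unfolding set_eq_iff mem_Collect_eq * using F(3) by metis
  finally show ?thesis .
qed

lemma weight_part_generates_1:
  assumes "k1 > 1" "k = 2 * k1"
  shows "conformal_generated_by tscale (tY k 1) (Rdag k1 k 1 :: 'f::field_char_0 tmat set) (weight_part 1 2 (Rdag k1 k 1))"
proof -
  interpret symplectic k1 k 1 by (rule symplectic_1) (use assms in auto)
  have e: "e = 0" by (simp add: dlt_def)
  have S: "T p q m n \<in> weight_part 1 2 R" if "p \<in> idx k" "q \<in> idx k" "m + n = 1" for p q m n
    unfolding weight_part_R e by (intro tmat.span_base) (use that in force)
  show ?thesis
  proof (rule generated_by)
    show "weight_part 1 2 R \<subseteq> R" by (auto simp: weight_part_def)
    fix W :: "'f tmat set" and p q m n
    assume sub: "tmat.subspace W" and W: "weight_part 1 2 R \<subseteq> W"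
      and act: "\<And>x y n. x \<in> weight_part 1 2 R \<Longrightarrow> y \<in> W \<Longrightarrow> prd x n y \<in> W"
      and pq: "p \<in> idx k" "q \<in> idx k"
    show "T p q m n \<in> W"
    proof (rule generate_large_0[OF e assms(1) sub _ _ _ _ pq])
      fix p q n y
      assume "p \<in> idx k" "q \<in> idx k"
      then have *: "T p q 1 0 \<in> weight_part 1 2 R" "T p q 0 1 \<in> weight_part 1 2 R"
        by (rule S; simp)+
      then show "T p q 1 0 \<in> W" "T p q 0 1 \<in> W"
        using W by blast+
      assume "y \<in> W"
      then show "prd (T p q 1 0) n y \<in> W" "prd (T p q 0 1) n y \<in> W"
        using * act by blast+
    qed
  qed
qed

lemma weight_part_generates_0:
  assumes "k1 > 1" "k = 2 * k1"
  shows "conformal_generated_by tscale (tY k 0) (Rdag k1 k 0 :: 'f::field_char_0 tmat set) (weight_part 0 2 (Rdag k1 k 0))"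
proof -
  interpret symplectic k1 k 0 by (rule symplectic_0) (use assms in auto)
  have e: "e = 1" by (simp add: dlt_def)
  have S: "T p q 0 0 \<in> weight_part 0 2 R" if "p \<in> idx k" "q \<in> idx k" for p q
    unfolding weight_part_R e by (intro tmat.span_base) (use that in force)
  show ?thesis
  proof (rule generated_by)
    show "weight_part 0 2 R \<subseteq> R" by (auto simp: weight_part_def)
    fix W :: "'f tmat set" and p q m n
    assume sub: "tmat.subspace W" and W: "weight_part 0 2 R \<subseteq> W"
      and act: "\<And>x y n. x \<in> weight_part 0 2 R \<Longrightarrow> y \<in> W \<Longrightarrow> prd x n y \<in> W"
      and pq: "p \<in> idx k" "q \<in> idx k"
    show "T p q m n \<in> W"
    proof (rule generate_large_1[OF e assms(1) sub _ _ pq])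
      fix p q n y
      assume "p \<in> idx k" "q \<in> idx k"
      then have *: "T p q 0 0 \<in> weight_part 0 2 R"
        by (rule S)
      then show "T p q 0 0 \<in> W"
        using W by blast
      assume "y \<in> W"
      then show "prd (T p q 0 0) n y \<in> W"
        using * act by blast
    qed
  qed
qed

text \<open>One formula covers both three-element sets: exponent \<open>2 - e\<close> in the
  corners, and the weight-2 diagonal element, which for \<open>e = 1\<close> is the identity matrix
  in degree 0.\<close>

lemma (in symplectic) three_generators:
  assumes k1: "k1 = 1"
  shows "conformal_generated_by tscale (tY k i) (R :: 'f::field_char_0 tmat set)
    {T 1 2 (2 - e) 0, T 2 1 (2 - e) 0, T 1 1 0 (1 - e)}"
proof (rule generated_by)
  have "1 \<in> idx k" "2 \<in> idx k"
    using k k1 by (auto simp: idx_def)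
  then show "{T 1 2 (2 - e) 0, T 2 1 (2 - e) 0, T 1 1 0 (1 - e)} \<subseteq> R"
    using T_in by blast
next
  fix W :: "'f tmat set" and p q m n
  assume sub: "tmat.subspace W" and W: "{T 1 2 (2 - e) 0, T 2 1 (2 - e) 0, T 1 1 0 (1 - e)} \<subseteq> W"
    and act: "\<And>x y n. x \<in> {T 1 2 (2 - e) 0, T 2 1 (2 - e) 0, T 1 1 0 (1 - e)} \<Longrightarrow> y \<in> W \<Longrightarrow> prd x n y \<in> W"
    and pq: "p \<in> idx k" "q \<in> idx k"
  show "T p q m n \<in> W"
    by (rule generate_small[OF k1 sub _ _ _ _ _ _ pq]) (use W act in blast)+
qed

lemma three_generators_1:
  "conformal_generated_by tscale (tY 2 1) (Rdag 1 2 1 :: 'f::field_char_0 tmat set)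
    {elt (mat_unit 1 2) 2 0 + elt (mat_unit 1 2) 0 2,
     elt (mat_unit 2 1) 2 0 + elt (mat_unit 2 1) 0 2,
     elt (mat_unit 1 1) 0 1 - elt (mat_unit 2 2) 1 0}"
proof -
  interpret symplectic 1 2 1 by (rule symplectic_1) auto
  have eq: "{T 1 2 (2 - e) 0, T 2 1 (2 - e) 0, T 1 1 0 (1 - e)} =
    {elt (mat_unit 1 2) 2 0 + elt (mat_unit 1 2) 0 2,
     elt (mat_unit 2 1) 2 0 + elt (mat_unit 2 1) 0 2,
     elt (mat_unit 1 1) 0 1 - elt (mat_unit 2 2) 1 0 :: 'f tmat}"
    by (simp add: Telt_def dlt_def sgn1_def eps_def star_def numeral_2_eq_2)
  show ?thesis
    unfolding eq[symmetric] by (rule three_generators[OF refl])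
qed

lemma three_generators_0:
  "conformal_generated_by tscale (tY 2 0) (Rdag 1 2 0 :: 'f::field_char_0 tmat set)
    {elt (mat_id 2) 0 0,
     elt (mat_unit 1 2) 1 0 - elt (mat_unit 1 2) 0 1,
     elt (mat_unit 2 1) 1 0 - elt (mat_unit 2 1) 0 1}"
proof -
  interpret symplectic 1 2 0 by (rule symplectic_0) auto
  have "mat_id 2 = mat_unit 1 1 + (mat_unit 2 2 :: 'f fmat)"
    by (intro HOL.ext) (auto simp: mat_id_def mat_unit_def plus_fun_apply)
  then have eq: "{T 1 2 (2 - e) 0, T 2 1 (2 - e) 0, T 1 1 0 (1 - e)} =
    {elt (mat_id 2) 0 0,
     elt (mat_unit 1 2) 1 0 - elt (mat_unit 1 2) 0 1,
     elt (mat_unit 2 1) 1 0 - elt (mat_unit 2 1) 0 1 :: 'f tmat}"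
    by (auto simp: Telt_def dlt_def sgn1_def eps_def star_def numeral_2_eq_2 elt_add)
  show ?thesis
    unfolding eq[symmetric] by (rule three_generators[OF refl])
qed

theorem theorem3p3:
  fixes k k1 :: nat
  assumes "k1 > 0" and "k = 2 * k1"
  shows "(simple_conformal_algebra tscale (Rdag1 k1 :: 'f::field_char_0 tmat set) tD (tY k 1)
        \<and> simple_conformal_algebra tscale (Rdag2 k1 :: 'f tmat set) tD (tY k 0))
    \<and> (weight_part 1 2 (Rdag1 k1 :: 'f tmat set) = tmat.span
          ({elt (mat_unit p q) \<epsilon> (1 - \<epsilon>) - elt (mat_unit (k1 + q) (k1 + p)) (1 - \<epsilon>) \<epsilon>
              | p q \<epsilon>. p \<in> {1..k1} \<and> q \<in> {1..k1} \<and> \<epsilon> \<in> {0, 1}}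
         \<union> {elt (mat_unit p (k1 + q)) 1 0 + elt (mat_unit q (k1 + p)) 0 1
              | p q. p \<in> {1..k1} \<and> q \<in> {1..k1}}
         \<union> {elt (mat_unit (k1 + p) q) 1 0 + elt (mat_unit (k1 + q) p) 0 1
              | p q. p \<in> {1..k1} \<and> q \<in> {1..k1}})
        \<and> (k1 > 1 \<longrightarrow>
            conformal_generated_by tscale (tY k 1) (Rdag1 k1 :: 'f tmat set)
              (weight_part 1 2 (Rdag1 k1)))
        \<and> (k1 = 1 \<longrightarrow>
            conformal_generated_by tscale (tY k 1) (Rdag1 k1 :: 'f tmat set)
              {elt (mat_unit 1 2) 2 0 + elt (mat_unit 1 2) 0 2,
               elt (mat_unit 2 1) 2 0 + elt (mat_unit 2 1) 0 2,
               elt (mat_unit 1 1) 0 1 - elt (mat_unit 2 2) 1 0}))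
    \<and> (weight_part 0 2 (Rdag2 k1 :: 'f tmat set) = tmat.span
          ({elt (mat_unit p q) 0 0 + elt (mat_unit (k1 + q) (k1 + p)) 0 0
              | p q. p \<in> {1..k1} \<and> q \<in> {1..k1}}
         \<union> {elt (mat_unit p (k1 + q)) 0 0 - elt (mat_unit q (k1 + p)) 0 0
              | p q. p \<in> {1..k1} \<and> q \<in> {1..k1}}
         \<union> {elt (mat_unit (k1 + p) q) 0 0 - elt (mat_unit (k1 + q) p) 0 0
              | p q. p \<in> {1..k1} \<and> q \<in> {1..k1}})
        \<and> (k1 > 1 \<longrightarrow>
            conformal_generated_by tscale (tY k 0) (Rdag2 k1 :: 'f tmat set)
              (weight_part 0 2 (Rdag2 k1)))
        \<and> (k1 = 1 \<longrightarrow>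
            conformal_generated_by tscale (tY k 0) (Rdag2 k1 :: 'f tmat set)
              {elt (mat_id 2) 0 0,
               elt (mat_unit 1 2) 1 0 - elt (mat_unit 1 2) 0 1,
               elt (mat_unit 2 1) 1 0 - elt (mat_unit 2 1) 0 1}))"
proof -
  interpret A: symplectic k1 k 1 by (rule symplectic_1[OF assms])
  interpret B: symplectic k1 k 0 by (rule symplectic_0[OF assms])
  show ?thesis
    unfolding Rdag1_eq[OF assms] Rdag2_eq[OF assms]
  proof (intro conjI impI)
    show "simple_conformal_algebra tscale (Rdag k1 k 1 :: 'f tmat set) tD (tY k 1)"
      by (rule A.R_simple)
    show "simple_conformal_algebra tscale (Rdag k1 k 0 :: 'f tmat set) tD (tY k 0)"
      by (rule B.R_simple)
  next
    assume "k1 = 1"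
    then have k: "k1 = 1" "k = 2" using assms(2) by simp_all
    show "conformal_generated_by tscale (tY k 1) (Rdag k1 k 1 :: 'f tmat set)
        {elt (mat_unit 1 2) 2 0 + elt (mat_unit 1 2) 0 2, elt (mat_unit 2 1) 2 0 + elt (mat_unit 2 1) 0 2,
         elt (mat_unit 1 1) 0 1 - elt (mat_unit 2 2) 1 0}"
      unfolding k by (rule three_generators_1)
    show "conformal_generated_by tscale (tY k 0) (Rdag k1 k 0 :: 'f tmat set)
        {elt (mat_id 2) 0 0, elt (mat_unit 1 2) 1 0 - elt (mat_unit 1 2) 0 1,
         elt (mat_unit 2 1) 1 0 - elt (mat_unit 2 1) 0 1}"
      unfolding k by (rule three_generators_0)
  qed (rule weight_part_1[OF assms] weight_part_0[OF assms], assumption?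
    | erule weight_part_generates_1[OF _ assms(2)] weight_part_generates_0[OF _ assms(2)])+
qed

end
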